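(* Let $\mathfrak{a}$ be the Brownian ascent, and let $(L_s^0(\mathfrak{b}):0\le s\le1)$ denote the local time process at the level $0$ of a Brownian bridge $\mathfrak{b}$ of length $1$ from $0$ to $0$. Then $$\left(\sup_{0\le u\le s}\mathfrak{a}_u:0\le s\le1\right)\stackrel{\mathcal{L}}{=}\left(L_s^0(\mathfrak{b}):0\le s\le1\right).$$
   Context: $X$ is standard Brownian motion from $0$ under $P_0$, $S_t=\sup_{s\le t}X_s$. The Brownian ascent $\mathfrak{a}=(\mathfrak{a}_s:0\le s\le1)$ is Brownian motion on $[0,1]$ from $0$ conditioned on $\{X_1=S_1\}$: its law is the weak limit, as $\epsilon\searrow0$, of the law of $(X_s:0\le s\le1)$ under $P_0(\,\cdot\mid S_1-X_1<\epsilon)$ on $\mathcal{C}([0,1];\mathbb{R})$ with the uniform topology. Local time at level $0$ is normalized as $L_s^0(Y)=\lim_{\epsilon\searrow0}\frac1{2\epsilon}\int_0^s1_{\{|Y_r|<\epsilon\}}\,dr$, the normalization for which Lévy's equivalence $\big((S_t-X_t,S_t):t\ge0\big)\stackrel{\mathcal{L}}{=}\big((|X_t|,L_t^0(X)):t\ge0\big)$ holds under $P_0$. $\stackrel{\mathcal{L}}{=}$ denotes equality in law. *)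

theory Defs
  imports "HOL-Probability.Probability"
begin

definition standard_brownian_motion :: "'w measure \<Rightarrow> (real \<Rightarrow> 'w \<Rightarrow> real) \<Rightarrow> bool" where
  "standard_brownian_motion P X \<longleftrightarrow>
     prob_space P \<and>
     (\<forall>t\<ge>0. X t \<in> borel_measurable P) \<and>
     (\<forall>\<omega>\<in>space P. X 0 \<omega> = 0 \<and> continuous_on {0..} (\<lambda>t. X t \<omega>)) \<and>
     (\<forall>s t. 0 \<le> s \<and> s < t \<longrightarrow>
        distributed P lborel (\<lambda>\<omega>. X t \<omega> - X s \<omega>) (normal_density 0 (sqrt (t - s)))) \<and>
     (\<forall>n. \<forall>\<tau>::nat \<Rightarrow> real. 0 \<le> \<tau> 0 \<and> mono_on {..n} \<tau> \<longrightarrow>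
        prob_space.indep_vars P (\<lambda>_. borel) (\<lambda>i \<omega>. X (\<tau> (Suc i)) \<omega> - X (\<tau> i) \<omega>) {..<n})"

text \<open>The second disjunct below is the degenerate normal law of variance zero.\<close>

definition normal_variable :: "'w measure \<Rightarrow> ('w \<Rightarrow> real) \<Rightarrow> bool" where
  "normal_variable M Z \<longleftrightarrow>
     (\<exists>\<mu> \<sigma>. \<sigma> > 0 \<and> distributed M lborel Z (normal_density \<mu> \<sigma>)) \<or>
     (Z \<in> borel_measurable M \<and> (\<exists>\<mu>. AE \<omega> in M. Z \<omega> = \<mu>))"

definition gaussian_process :: "'w measure \<Rightarrow> 't set \<Rightarrow> ('t \<Rightarrow> 'w \<Rightarrow> real) \<Rightarrow> bool" where
  "gaussian_process M T Y \<longleftrightarrow>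
     (\<forall>J c. finite J \<and> J \<subseteq> T \<longrightarrow> normal_variable M (\<lambda>\<omega>. \<Sum>t\<in>J. c t * Y t \<omega>))"

text \<open>The Brownian bridge of length 1 from 0 to 0: the continuous centred Gaussian process on
  the unit interval with covariance \<open>s (1 - t)\<close> for \<open>s \<le> t\<close>.\<close>

definition brownian_bridge :: "'w measure \<Rightarrow> (real \<Rightarrow> 'w \<Rightarrow> real) \<Rightarrow> bool" where
  "brownian_bridge M b \<longleftrightarrow>
     prob_space M \<and>
     (\<forall>t\<in>{0..1}. b t \<in> borel_measurable M) \<and>
     (\<forall>\<omega>\<in>space M. continuous_on {0..1} (\<lambda>t. b t \<omega>)) \<and>
     gaussian_process M {0..1} b \<and>
     (\<forall>t\<in>{0..1}. (LINT \<omega>|M. b t \<omega>) = 0) \<and>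
     (\<forall>s t. 0 \<le> s \<and> s \<le> t \<and> t \<le> 1 \<longrightarrow> (LINT \<omega>|M. b s \<omega> * b t \<omega>) = s * (1 - t))"

definition running_sup :: "(real \<Rightarrow> 'w \<Rightarrow> real) \<Rightarrow> real \<Rightarrow> 'w \<Rightarrow> real" where
  "running_sup Y s \<omega> = (SUP u\<in>{0..s}. Y u \<omega>)"

text \<open>Continuous real functions on the unit interval (extensional outside it) with the
  supremum metric, and their Borel sigma-algebra.\<close>

abbreviation C01 :: "(real \<Rightarrow> real) metric" where
  "C01 \<equiv> cfunspace (top_of_set {0..1}) euclidean_metric"

lemma mspace_C01: "mspace C01 = {f \<in> extensional {0..1}. continuous_on {0..1} f}"
  by (subst compactin_mspace_cfunspace) (auto simp: compactin_subtopology)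

definition borel_C01 :: "(real \<Rightarrow> real) measure" where
  "borel_C01 = sigma (mspace C01) {U. openin (mtopology_of C01) U}"

definition law_C01 :: "'w measure \<Rightarrow> (real \<Rightarrow> 'w \<Rightarrow> real) \<Rightarrow> (real \<Rightarrow> real) measure" where
  "law_C01 M Y = distr M borel_C01 (\<lambda>\<omega>. \<lambda>t\<in>{0..1}. Y t \<omega>)"

definition weak_conv_C01 ::
  "('i \<Rightarrow> (real \<Rightarrow> real) measure) \<Rightarrow> (real \<Rightarrow> real) measure \<Rightarrow> 'i filter \<Rightarrow> bool" where
  "weak_conv_C01 \<mu> \<nu> F \<longleftrightarrow>
     (\<forall>\<phi>. continuous_map (mtopology_of C01) euclideanreal \<phi> \<and> bounded (\<phi> ` mspace C01) \<longrightarrow>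
        ((\<lambda>i. LINT f|\<mu> i. \<phi> f) \<longlongrightarrow> (LINT f|\<nu>. \<phi> f)) F)"

text \<open>\<open>brownian_ascent P X N a\<close>: the continuous process \<open>a\<close>, living on \<open>N\<close>, has as its law the
  weak limit of the conditional laws of \<open>X\<close> under \<open>P\<close> given \<open>S\<^sub>1 - X\<^sub>1 < \<epsilon>\<close>.
  Note that \<open>uniform_measure P A\<close> is the conditional measure \<open>P(\<cdot> | A)\<close>.\<close>

definition brownian_ascent ::
  "'w measure \<Rightarrow> (real \<Rightarrow> 'w \<Rightarrow> real) \<Rightarrow> 'v measure \<Rightarrow> (real \<Rightarrow> 'v \<Rightarrow> real) \<Rightarrow> bool" where
  "brownian_ascent P X N a \<longleftrightarrow>
     prob_space N \<and>
     (\<forall>t\<in>{0..1}. a t \<in> borel_measurable N) \<and>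
     (\<forall>\<omega>\<in>space N. continuous_on {0..1} (\<lambda>t. a t \<omega>)) \<and>
     weak_conv_C01
       (\<lambda>\<epsilon>. law_C01 (uniform_measure P {\<omega>\<in>space P. running_sup X 1 \<omega> - X 1 \<omega> < \<epsilon>}) X)
       (law_C01 N a) (at_right 0)"

text \<open>Local time at level 0, taken pathwise. Where the limit fails to exist, \<open>Lim\<close> returns a
  fixed unspecified value; for the processes of interest this is a null event at each \<open>s\<close>.\<close>

definition local_time0 :: "(real \<Rightarrow> 'w \<Rightarrow> real) \<Rightarrow> real \<Rightarrow> 'w \<Rightarrow> real" where
  "local_time0 Y s \<omega> =
     Lim (at_right 0) (\<lambda>\<epsilon>. 1 / (2 * \<epsilon>) * (LINT r:{0..s}|lborel. indicator {r. \<bar>Y r \<omega>\<bar> < \<epsilon>} r))"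

text \<open>Equality in law of real processes indexed by \<open>T\<close>: equality of the laws on the product
  space \<open>\<real>\<^sup>T\<close>. For continuous processes on the unit interval this is equality of the laws on
  \<open>C01\<close>, whose Borel sigma-algebra is generated by the evaluations.\<close>

definition equal_in_law ::
  "'t set \<Rightarrow> 'v measure \<Rightarrow> ('t \<Rightarrow> 'v \<Rightarrow> real) \<Rightarrow> 'w measure \<Rightarrow> ('t \<Rightarrow> 'w \<Rightarrow> real) \<Rightarrow> bool" where
  "equal_in_law T M Y N Z \<longleftrightarrow>
     (\<forall>t\<in>T. Y t \<in> borel_measurable M) \<and> (\<forall>t\<in>T. Z t \<in> borel_measurable N) \<and>
     distr M (PiM T (\<lambda>_. borel)) (\<lambda>\<omega>. \<lambda>t\<in>T. Y t \<omega>) =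
     distr N (PiM T (\<lambda>_. borel)) (\<lambda>\<omega>. \<lambda>t\<in>T. Z t \<omega>)"

end

theory Submission
  imports Defs
begin

text \<open>
  Let \<open>X\<close> be Brownian motion sampled on the grid \<open>j / n\<close>. Flipping each increment by the sign of the
  current position gives another Gaussian random walk \<open>\<beta>\<close>, and \<open>\<bar>X\<bar> = \<beta> + \<Lambda>\<close> with \<open>\<Lambda>\<close> nondecreasing and
  moving only at sign changes; hence \<open>\<Lambda>\<close> is the running maximum of \<open>- \<beta>\<close> up to one increment.
  Comparing with a smooth approximation of \<open>\<bar>x\<bar>\<close> shows that \<open>\<Lambda>\<close> converges to the local time, with a
  rate that also yields almost sure existence of the latter. In the limit
  \<open>(S, S\<^sub>1 - X\<^sub>1)\<close> and \<open>(L, \<bar>X\<^sub>1\<bar>)\<close> have the same law, so conditioning on \<open>S\<^sub>1 - X\<^sub>1 < \<epsilon>\<close> becomes conditioning on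
  \<open>\<bar>X\<^sub>1\<bar> < \<epsilon>\<close>. Up to a time \<open>c < 1\<close>, the latter converges in total variation to the law of the bridge, whose
  density with respect to Brownian motion is \<open>p\<^sub>1\<^sub>-\<^sub>c(X\<^sub>c) / p\<^sub>1(0)\<close>; so the possibly discontinuous
  functional \<open>L\<close> can be carried along. Time 1 is then reached by reversing the bridge.
\<close>

section \<open>Joint characteristic functions\<close>

text \<open>Two kinds of convergence have to be matched. The ascent is known only through bounded
  continuous functionals; this suffices for running suprema, which are 1-Lipschitz in the supremum
  metric. Local time is a pathwise \<open>Lim\<close> with no continuity in the path, so on the
  bridge side the conditioned laws must converge against every bounded measurable functional. They
  do so on [0, c] for c < 1, where the density is bounded by p_{1-c}(0) / p_1(0). The bound blows up
  as c tends to 1, and on all of [0, 1] the bridge is singular to Brownian motion, so the endpoint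
  needs an argument of its own. The pathwise definition also demands almost sure convergence over
  the continuum of e, not merely convergence in L1: an L1 error of order sqrt e is summable along e
  = (k + 1)^-4, and monotonicity in e fills the gaps. Laws are compared by characteristic functions
  because those of the Gaussian processes involved are explicit.\<close>

lemma borel_measurable_cis [measurable]: "cis \<in> borel_measurable borel"
  by (intro borel_measurable_continuous_onI continuous_intros)

lemma distr_eq_if_cis_integrals_eq:
  fixes Y :: "'a \<Rightarrow> real" and Z :: "'b \<Rightarrow> real"
  assumes "finite_measure M" "finite_measure N"
    and [measurable]: "Y \<in> borel_measurable M" "Z \<in> borel_measurable N"
    and eq: "\<And>v. (\<integral>\<omega>. cis (v * Y \<omega>) \<partial>M) = (\<integral>\<omega>. cis (v * Z \<omega>) \<partial>N)"
  shows "distr M borel Y = distr N borel Z"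
proof -
  interpret M: finite_measure M by fact
  interpret N: finite_measure N by fact
  define c where "c = measure M (space M)"
  have "complex_of_real (measure M (space M)) = complex_of_real (measure N (space N))"
    using eq[of 0] by (simp add: scaleR_conv_of_real)
  then have cN: "c = measure N (space N)"
    unfolding c_def of_real_eq_iff .
  show ?thesis
  proof (cases "c = 0")
    case True
    have "emeasure M A = 0" "emeasure N B = 0" for A B
      using M.bounded_measure[of A] N.bounded_measure[of B] True cN
      by (simp_all add: c_def M.emeasure_eq_measure N.emeasure_eq_measure measure_le_0_iff)
    then show ?thesis
      by (intro measure_eqI) (auto simp: emeasure_distr)
  next
    case False
    then have c: "c > 0" by (simp add: c_def zero_less_measure_iff M.emeasure_eq_measure)
    define M' where "M' = density (distr M borel Y) (\<lambda>_. ennreal (1 / c))"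
    define N' where "N' = density (distr N borel Z) (\<lambda>_. ennreal (1 / c))"
    have 1: "real_distribution M'"
      unfolding M'_def real_distribution_def real_distribution_axioms_def
      using c by (auto intro!: prob_spaceI simp: emeasure_density emeasure_distr nn_integral_distr
          M.emeasure_eq_measure c_def ennreal_mult[symmetric])
    have 2: "real_distribution N'"
      unfolding N'_def real_distribution_def real_distribution_axioms_def
      using c by (auto intro!: prob_spaceI simp: emeasure_density emeasure_distr nn_integral_distr
          N.emeasure_eq_measure cN ennreal_mult[symmetric])
    have "char M' v = (1 / c) *\<^sub>R (\<integral>\<omega>. cis (v * Y \<omega>) \<partial>M)" for v
      using c by (simp add: char_def M'_def integral_density integral_distr cis_conv_exp)
    moreover have "char N' v = (1 / c) *\<^sub>R (\<integral>\<omega>. cis (v * Z \<omega>) \<partial>N)" for v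
      using c by (simp add: char_def N'_def integral_density integral_distr cis_conv_exp)
    ultimately have "char M' = char N'" using eq by auto
    then have e: "M' = N'" using Levy_uniqueness 1 2 by blast
    show ?thesis
    proof (rule measure_eqI)
      fix A assume "A \<in> sets (distr M borel Y)"
      then have [measurable]: "A \<in> sets borel" by simp
      have "ennreal (1/c) * emeasure (distr M borel Y) A = emeasure M' A"
        by (simp add: M'_def emeasure_density nn_integral_cmult)
      also have "\<dots> = ennreal (1/c) * emeasure (distr N borel Z) A"
        by (simp add: e N'_def emeasure_density nn_integral_cmult)
      finally show "emeasure (distr M borel Y) A = emeasure (distr N borel Z) A"
        using c by (simp add: ennreal_mult_cancel_left)
    qed simp
  qed
qed

text \<open>The product of indicators converts the coordinates in \<open>A\<close> one at a time; the weight
  \<open>1 + cos\<close> is the device that keeps all measures nonnegative, so that the one-dimensional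
  uniqueness theorem applies.\<close>

lemma integrals_indicator_cis_eq:
  fixes Y :: "'i \<Rightarrow> 'a \<Rightarrow> real" and Z :: "'i \<Rightarrow> 'b \<Rightarrow> real"
  assumes fin: "finite_measure M" "finite_measure N" and J: "finite J"
    and mY: "\<And>j. j \<in> J \<Longrightarrow> Y j \<in> borel_measurable M"
    and mZ: "\<And>j. j \<in> J \<Longrightarrow> Z j \<in> borel_measurable N"
    and eq: "\<And>u. (\<integral>\<omega>. cis (\<Sum>j\<in>J. u j * Y j \<omega>) \<partial>M) = (\<integral>\<omega>. cis (\<Sum>j\<in>J. u j * Z j \<omega>) \<partial>N)"
    and A: "A \<subseteq> J"
  shows "(\<And>j. j \<in> A \<Longrightarrow> B j \<in> sets borel) \<Longrightarrow>
    (\<integral>\<omega>. (\<Prod>j\<in>A. indicator (B j) (Y j \<omega>)) *\<^sub>R cis (\<Sum>j\<in>J-A. u j * Y j \<omega>) \<partial>M) =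
    (\<integral>\<omega>. (\<Prod>j\<in>A. indicator (B j) (Z j \<omega>)) *\<^sub>R cis (\<Sum>j\<in>J-A. u j * Z j \<omega>) \<partial>N)"
proof -
  interpret M: finite_measure M by fact
  interpret N: finite_measure N by fact
  have "finite A" using A J finite_subset by auto
  then show "(\<And>j. j \<in> A \<Longrightarrow> B j \<in> sets borel) \<Longrightarrow> ?thesis" using A
  proof (induction arbitrary: B u rule: finite_subset_induct')
    case empty
    then show ?case using eq by simp
  next
    case (insert k A)
    define R where "R = J - insert k A"
    have JA: "J - A = insert k R" "k \<notin> R" "finite R" "R \<subseteq> J" using insert J by (auto simp: R_def)
    have Bm: "B k \<in> sets borel" "\<And>j. j \<in> A \<Longrightarrow> B j \<in> sets borel" using insert by auto
    define p where "p \<omega> = (\<Prod>j\<in>A. indicator (B j) (Y j \<omega>) :: real)" for \<omega>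
    define q where "q \<omega> = (\<Prod>j\<in>A. indicator (B j) (Z j \<omega>) :: real)" for \<omega>
    define S where "S u \<omega> = (\<Sum>j\<in>R. u j * Y j \<omega>)" for u \<omega>
    define T where "T u \<omega> = (\<Sum>j\<in>R. u j * Z j \<omega>)" for u \<omega>
    have mYA: "\<And>j. j \<in> A \<Longrightarrow> Y j \<in> borel_measurable M" "\<And>j. j \<in> R \<Longrightarrow> Y j \<in> borel_measurable M"
      "Y k \<in> borel_measurable M"
      using insert JA mY by auto
    have mZA: "\<And>j. j \<in> A \<Longrightarrow> Z j \<in> borel_measurable N" "\<And>j. j \<in> R \<Longrightarrow> Z j \<in> borel_measurable N"
      "Z k \<in> borel_measurable N"
      using insert JA mZ by auto
    note [measurable] = mYA(3) mZA(3) Bm(1)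
    have [measurable]: "S u \<in> borel_measurable M" "T u \<in> borel_measurable N" for u
      unfolding S_def T_def using mYA mZA by (auto intro!: borel_measurable_sum borel_measurable_times)
    have pm[measurable]: "p \<in> borel_measurable M"
      unfolding p_def using mYA Bm by (auto intro!: borel_measurable_prod measurable_compose[OF _ borel_measurable_indicator])
    have qm[measurable]: "q \<in> borel_measurable N"
      unfolding q_def using mZA Bm by (auto intro!: borel_measurable_prod measurable_compose[OF _ borel_measurable_indicator])
    have p01: "0 \<le> p \<omega>" "p \<omega> \<le> 1" for \<omega> unfolding p_def by (auto intro!: prod_nonneg prod_le_1)
    have q01: "0 \<le> q \<omega>" "q \<omega> \<le> 1" for \<omega> unfolding q_def by (auto intro!: prod_nonneg prod_le_1)
    have IH: "(\<integral>\<omega>. p \<omega> *\<^sub>R cis (v * Y k \<omega> + S u \<omega>) \<partial>M) = (\<integral>\<omega>. q \<omega> *\<^sub>R cis (v * Z k \<omega> + T u \<omega>) \<partial>N)" for v u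
    proof -
      have "(\<Sum>j\<in>R. (u(k := v)) j * f j) = (\<Sum>j\<in>R. u j * f j)" for f :: "'i \<Rightarrow> real"
        using JA by (intro sum.cong) auto
      then show ?thesis
        using insert.IH[of B "u(k:=v)"] Bm JA
        unfolding p_def q_def S_def T_def by simp
    qed
    have iM: "integrable M (\<lambda>\<omega>. p \<omega> *\<^sub>R cis (f \<omega>))" if [measurable]: "f \<in> borel_measurable M" for f
      using p01 by (intro M.integrable_const_bound[of _ 1]) auto
    have iN: "integrable N (\<lambda>\<omega>. q \<omega> *\<^sub>R cis (f \<omega>))" if [measurable]: "f \<in> borel_measurable N" for f
      using q01 by (intro N.integrable_const_bound[of _ 1]) auto
    \<comment> \<open>As a function of \<open>s\<close> the weight
      \<open>1 + cos (s + \<theta>)\<close> contains only the frequencies 0, 1 and -1, so the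
      weighted integral is a combination of three integrals covered by the induction
      hypothesis.\<close>
    have expand: "(x * (1 + cos (s + \<theta>))) *\<^sub>R cis (v * y) =
        x *\<^sub>R cis (v * y + 0) + (cis \<theta> / 2) * (x *\<^sub>R cis (v * y + s)) + (cis (- \<theta>) / 2) * (x *\<^sub>R cis (v * y - s))"
      for x s \<theta> v y :: real
    proof -
      have "cis (s+\<theta>) + cis (-(s+\<theta>)) = 2 * cos (s+\<theta>)"
        by (simp add: complex_eq_iff del: minus_add_distrib)
      moreover have "(cis \<theta> / 2) * (x *\<^sub>R cis (v * y + s)) + (cis (- \<theta>) / 2) * (x *\<^sub>R cis (v * y - s))
         = (x / 2) *\<^sub>R (cis (v * y) * (cis (s+\<theta>) + cis (-(s+\<theta>))))"
      proof -
        have c: "cis (v * y + s) = cis (v * y) * cis s" "cis (v * y - s) = cis (v * y) * cis (- s)"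
          "cis (s + \<theta>) = cis s * cis \<theta>" "cis (- (s + \<theta>)) = cis (- s) * cis (- \<theta>)"
          by (simp_all add: cis_mult)
        show ?thesis unfolding c scaleR_conv_of_real by (simp add: field_simps)
      qed
      ultimately show ?thesis
        by (simp add: scaleR_conv_of_real algebra_simps)
    qed
    have main: "(\<integral>\<omega>. p \<omega> * (1 + cos (S u \<omega> + \<theta>)) * indicator (B k) (Y k \<omega>) \<partial>M) =
       (\<integral>\<omega>. q \<omega> * (1 + cos (T u \<omega> + \<theta>)) * indicator (B k) (Z k \<omega>) \<partial>N)" for u \<theta>
    proof -
      define w where "w \<omega> = p \<omega> * (1 + cos (S u \<omega> + \<theta>))" for \<omega>
      define z where "z \<omega> = q \<omega> * (1 + cos (T u \<omega> + \<theta>))" for \<omega>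
      have c0: "0 \<le> 1 + cos x" for x :: real using cos_ge_minus_one[of x] by linarith
      have c2: "1 + cos x \<le> 2" for x :: real by simp
      have w0: "0 \<le> w \<omega>" "w \<omega> \<le> 2" for \<omega>
        using mult_mono[OF p01(2) c2 _ c0, of \<omega> "S u \<omega> + \<theta>"] p01 c0 by (auto simp: w_def)
      have z0: "0 \<le> z \<omega>" "z \<omega> \<le> 2" for \<omega>
        using mult_mono[OF q01(2) c2 _ c0, of \<omega> "T u \<omega> + \<theta>"] q01 c0 by (auto simp: z_def)
      have [measurable]: "w \<in> borel_measurable M" "z \<in> borel_measurable N" unfolding w_def z_def by measurable
      have "integrable M w" using w0 by (intro M.integrable_const_bound[of _ 2]) auto
      then have f1: "finite_measure (density M w)"
        using w0 by (intro finite_measureI) (simp add: emeasure_density nn_integral_eq_integral)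
      have "integrable N z" using z0 by (intro N.integrable_const_bound[of _ 2]) auto
      then have f2: "finite_measure (density N z)"
        using z0 by (intro finite_measureI) (simp add: emeasure_density nn_integral_eq_integral)
      have "distr (density M w) borel (Y k) = distr (density N z) borel (Z k)"
      proof (rule distr_eq_if_cis_integrals_eq[OF f1 f2])
        fix v
        have "(\<integral>\<omega>. cis (v * Y k \<omega>) \<partial>density M w) = (\<integral>\<omega>. w \<omega> *\<^sub>R cis (v * Y k \<omega>) \<partial>M)"
          using w0 by (simp add: integral_density)
        also have "\<dots> = (\<integral>\<omega>. p \<omega> *\<^sub>R cis (v * Y k \<omega> + 0) \<partial>M) + (cis \<theta> / 2) * (\<integral>\<omega>. p \<omega> *\<^sub>R cis (v * Y k \<omega> + S u \<omega>) \<partial>M)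
            + (cis (- \<theta>) / 2) * (\<integral>\<omega>. p \<omega> *\<^sub>R cis (v * Y k \<omega> - S u \<omega>) \<partial>M)"
          unfolding w_def expand by (subst Bochner_Integration.integral_add, (intro Bochner_Integration.integrable_add integrable_mult_right iM; measurable)+)+ (simp only: integral_mult_right_zero)
        also have "\<dots> = (\<integral>\<omega>. q \<omega> *\<^sub>R cis (v * Z k \<omega> + 0) \<partial>N) + (cis \<theta> / 2) * (\<integral>\<omega>. q \<omega> *\<^sub>R cis (v * Z k \<omega> + T u \<omega>) \<partial>N)
            + (cis (- \<theta>) / 2) * (\<integral>\<omega>. q \<omega> *\<^sub>R cis (v * Z k \<omega> - T u \<omega>) \<partial>N)"
        proof -
          have "S (\<lambda>_. 0) = (\<lambda>_. 0)" "T (\<lambda>_. 0) = (\<lambda>_. 0)" "S (\<lambda>j. - u j) = (\<lambda>\<omega>. - S u \<omega>)" "T (\<lambda>j. - u j) = (\<lambda>\<omega>. - T u \<omega>)"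
            by (auto simp: S_def T_def sum_negf)
          then show ?thesis using IH[of v "\<lambda>_. 0"] IH[of v u] IH[of v "\<lambda>j. - u j"] by simp
        qed
        also have "\<dots> = (\<integral>\<omega>. z \<omega> *\<^sub>R cis (v * Z k \<omega>) \<partial>N)"
          unfolding z_def expand by (subst Bochner_Integration.integral_add, (intro Bochner_Integration.integrable_add integrable_mult_right iN; measurable)+)+ (simp only: integral_mult_right_zero)
        also have "\<dots> = (\<integral>\<omega>. cis (v * Z k \<omega>) \<partial>density N z)"
          using z0 by (simp add: integral_density)
        finally show "(\<integral>\<omega>. cis (v * Y k \<omega>) \<partial>density M w) = (\<integral>\<omega>. cis (v * Z k \<omega>) \<partial>density N z)" .
      qed simp_all
      moreover have "(\<integral>x. indicator (B k) x \<partial>distr (density M w) borel (Y k)) = (\<integral>\<omega>. w \<omega> * indicator (B k) (Y k \<omega>) \<partial>M)"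
        by (subst integral_distr; (measurable)?) (use w0 in \<open>subst integral_density; auto\<close>)
      moreover have "(\<integral>x. indicator (B k) x \<partial>distr (density N z) borel (Z k)) = (\<integral>\<omega>. z \<omega> * indicator (B k) (Z k \<omega>) \<partial>N)"
        by (subst integral_distr; (measurable)?) (use z0 in \<open>subst integral_density; auto\<close>)
      ultimately show ?thesis by (simp only: w_def z_def)
    qed
    \<comment> \<open>The choice \<open>u = 0\<close>, \<open>\<theta> = 0\<close> makes the weight
      the constant 2 and gives the unweighted equality; subtracting it from \<open>main\<close>
      isolates the cosine.\<close>
    have main2: "(\<integral>\<omega>. p \<omega> * indicator (B k) (Y k \<omega>) * cos (S u \<omega> + \<theta>) \<partial>M) =
       (\<integral>\<omega>. q \<omega> * indicator (B k) (Z k \<omega>) * cos (T u \<omega> + \<theta>) \<partial>N)" for u \<theta>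
    proof -
      have b: "\<bar>p \<omega> * indicator (B k) (Y k \<omega>) * cos x\<bar> \<le> 1" "\<bar>q \<omega>' * indicator (B k) (Z k \<omega>') * cos x\<bar> \<le> 1" for \<omega> \<omega>' x
        using p01 q01 by (auto simp: abs_mult indicator_def intro!: mult_le_one)
      have i1: "integrable M (\<lambda>\<omega>. p \<omega> * indicator (B k) (Y k \<omega>) * cos (S u \<omega> + \<theta>))" for u \<theta>
        using b by (intro M.integrable_const_bound[of _ 1]) auto
      have i2: "integrable N (\<lambda>\<omega>. q \<omega> * indicator (B k) (Z k \<omega>) * cos (T u \<omega> + \<theta>))" for u \<theta>
        using b by (intro N.integrable_const_bound[of _ 1]) auto
      have i3: "integrable M (\<lambda>\<omega>. p \<omega> * indicator (B k) (Y k \<omega>))"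
        using b(1)[of _ 0] by (intro M.integrable_const_bound[of _ 1]) auto
      have i4: "integrable N (\<lambda>\<omega>. q \<omega> * indicator (B k) (Z k \<omega>))"
        using b(2)[of _ 0] by (intro N.integrable_const_bound[of _ 1]) auto
      have z0: "S (\<lambda>_. 0) = (\<lambda>_. 0)" "T (\<lambda>_. 0) = (\<lambda>_. 0)" by (auto simp: S_def T_def)
      have d: "(\<integral>\<omega>. p \<omega> * indicator (B k) (Y k \<omega>) \<partial>M) = (\<integral>\<omega>. q \<omega> * indicator (B k) (Z k \<omega>) \<partial>N)"
        using main[of "\<lambda>_. 0" 0] by (simp add: z0 mult.commute[of _ 2] mult.assoc)
      have "(\<integral>\<omega>. p \<omega> * indicator (B k) (Y k \<omega>) + p \<omega> * indicator (B k) (Y k \<omega>) * cos (S u \<omega> + \<theta>) \<partial>M) =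
         (\<integral>\<omega>. q \<omega> * indicator (B k) (Z k \<omega>) + q \<omega> * indicator (B k) (Z k \<omega>) * cos (T u \<omega> + \<theta>) \<partial>N)"
        using main[of u \<theta>] by (simp add: algebra_simps)
      then show ?thesis using i1 i2 i3 i4 d by simp
    qed
    have p_ins: "(\<Prod>j\<in>insert k A. indicator (B j) (Y j \<omega>)) = p \<omega> * indicator (B k) (Y k \<omega>)" for \<omega>
      using insert by (simp add: p_def mult.commute)
    have q_ins: "(\<Prod>j\<in>insert k A. indicator (B j) (Z j \<omega>)) = q \<omega> * indicator (B k) (Z k \<omega>)" for \<omega>
      using insert by (simp add: q_def mult.commute)
    have bd: "cmod ((p \<omega> * indicator (B k) (Y k \<omega>)) *\<^sub>R cis x) \<le> 1" "cmod ((q \<omega>' * indicator (B k) (Z k \<omega>')) *\<^sub>R cis x) \<le> 1" for \<omega> \<omega>' x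
      using p01 q01 by (auto simp: indicator_def)
    have i1: "integrable M (\<lambda>\<omega>. (p \<omega> * indicator (B k) (Y k \<omega>)) *\<^sub>R cis (S u \<omega>))"
      using bd(1) by (intro M.integrable_const_bound[of _ 1]) auto
    have i2: "integrable N (\<lambda>\<omega>. (q \<omega> * indicator (B k) (Z k \<omega>)) *\<^sub>R cis (T u \<omega>))"
      using bd(2) by (intro N.integrable_const_bound[of _ 1]) auto
    \<comment> \<open>The phases 0 and -pi/2 turn the cosine into the real and the imaginary part of
      \<open>cis\<close>.\<close>
    have "(\<integral>\<omega>. (p \<omega> * indicator (B k) (Y k \<omega>)) *\<^sub>R cis (S u \<omega>) \<partial>M) = (\<integral>\<omega>. (q \<omega> * indicator (B k) (Z k \<omega>)) *\<^sub>R cis (T u \<omega>) \<partial>N)"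
      using i1 i2 main2[of u 0] main2[of u "-(pi/2)"]
      by (simp add: complex_eq_iff integral_Re[symmetric] integral_Im[symmetric] cos_diff del: integral_Re integral_Im)
    then show ?case unfolding p_ins q_ins S_def T_def R_def .
  qed
qed

text \<open>Cylinder sets over finite \<open>J\<close> determine a finite measure on the product.
  With \<open>A = J\<close> in the preceding lemma the exponent becomes an empty sum and the
  integral is the mass of a cylinder.\<close>

theorem distr_PiM_eq_if_cis_integrals_eq:
  fixes Y :: "'i \<Rightarrow> 'a \<Rightarrow> real" and Z :: "'i \<Rightarrow> 'b \<Rightarrow> real"
  assumes fin: "finite_measure M" "finite_measure N"
    and mY: "\<And>j. j \<in> I \<Longrightarrow> Y j \<in> borel_measurable M"
    and mZ: "\<And>j. j \<in> I \<Longrightarrow> Z j \<in> borel_measurable N"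
    and eq: "\<And>J u. finite J \<Longrightarrow> J \<subseteq> I \<Longrightarrow>
      (\<integral>\<omega>. cis (\<Sum>j\<in>J. u j * Y j \<omega>) \<partial>M) = (\<integral>\<omega>. cis (\<Sum>j\<in>J. u j * Z j \<omega>) \<partial>N)"
  shows "distr M (PiM I (\<lambda>_. borel)) (\<lambda>\<omega>. \<lambda>j\<in>I. Y j \<omega>) = distr N (PiM I (\<lambda>_. borel)) (\<lambda>\<omega>. \<lambda>j\<in>I. Z j \<omega>)"
proof (rule measure_eqI_PiM_infinite)
  interpret M: finite_measure M by fact
  interpret N: finite_measure N by fact
  have mY': "(\<lambda>\<omega>. \<lambda>j\<in>I. Y j \<omega>) \<in> measurable M (PiM I (\<lambda>_. borel))"
    using mY by (auto intro!: measurable_restrict)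
  have mZ': "(\<lambda>\<omega>. \<lambda>j\<in>I. Z j \<omega>) \<in> measurable N (PiM I (\<lambda>_. borel))"
    using mZ by (auto intro!: measurable_restrict)
  show "finite_measure (distr M (PiM I (\<lambda>_. borel)) (\<lambda>\<omega>. \<lambda>j\<in>I. Y j \<omega>))"
    using M.finite_measure_distr[OF mY'] .
  fix B :: "'i \<Rightarrow> real set" and J assume J: "finite J" "J \<subseteq> I" and B: "\<And>i. i \<in> J \<Longrightarrow> B i \<in> sets borel"
  have "(\<integral>\<omega>. (\<Prod>j\<in>J. indicator (B j) (Y j \<omega>)) *\<^sub>R cis (\<Sum>j\<in>J-J. 0 * Y j \<omega>) \<partial>M) =
    (\<integral>\<omega>. (\<Prod>j\<in>J. indicator (B j) (Z j \<omega>)) *\<^sub>R cis (\<Sum>j\<in>J-J. 0 * Z j \<omega>) \<partial>N)"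
    using J mY mZ eq by (intro integrals_indicator_cis_eq[OF fin J(1), where u="\<lambda>_. 0"] B) auto
  moreover have ind: "(\<Prod>j\<in>J. indicator (B j) (f j)) = (indicator {x. \<forall>j\<in>J. x j \<in> B j} f :: real)" for f
    using J by (auto simp: indicator_def prod_zero_iff)
  ultimately have *: "complex_of_real (\<integral>\<omega>. indicator {x. \<forall>j\<in>J. x j \<in> B j} (\<lambda>j. Y j \<omega>) \<partial>M) =
      complex_of_real (\<integral>\<omega>. indicator {x. \<forall>j\<in>J. x j \<in> B j} (\<lambda>j. Z j \<omega>) \<partial>N)"
    by (simp add: scaleR_conv_of_real)
  have setM: "{\<omega>\<in>space M. \<forall>j\<in>J. Y j \<omega> \<in> B j} \<in> sets M"
  proof (intro sets.sets_Collect_finite_All J)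
    fix j assume "j \<in> J"
    then have "Y j -` B j \<inter> space M \<in> sets M" using J B mY by (intro measurable_sets) auto
    then show "{\<omega>\<in>space M. Y j \<omega> \<in> B j} \<in> sets M" by (simp add: vimage_def Int_def conj_commute)
  qed
  have setN: "{\<omega>\<in>space N. \<forall>j\<in>J. Z j \<omega> \<in> B j} \<in> sets N"
  proof (intro sets.sets_Collect_finite_All J)
    fix j assume "j \<in> J"
    then have "Z j -` B j \<inter> space N \<in> sets N" using J B mZ by (intro measurable_sets) auto
    then show "{\<omega>\<in>space N. Z j \<omega> \<in> B j} \<in> sets N" by (simp add: vimage_def Int_def conj_commute)
  qed
  have "(\<integral>\<omega>. indicator {x. \<forall>j\<in>J. x j \<in> B j} (\<lambda>j. Y j \<omega>) \<partial>M) = (\<integral>\<omega>. indicator {\<omega>\<in>space M. \<forall>j\<in>J. Y j \<omega> \<in> B j} \<omega> \<partial>M :: real)"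
    by (intro Bochner_Integration.integral_cong) (auto simp: indicator_def)
  moreover have "(\<integral>\<omega>. indicator {x. \<forall>j\<in>J. x j \<in> B j} (\<lambda>j. Z j \<omega>) \<partial>N) = (\<integral>\<omega>. indicator {\<omega>\<in>space N. \<forall>j\<in>J. Z j \<omega> \<in> B j} \<omega> \<partial>N :: real)"
    by (intro Bochner_Integration.integral_cong) (auto simp: indicator_def)
  moreover have "{\<omega>\<in>space M. \<forall>j\<in>J. Y j \<omega> \<in> B j} \<inter> space M = {\<omega>\<in>space M. \<forall>j\<in>J. Y j \<omega> \<in> B j}"
      "{\<omega>\<in>space N. \<forall>j\<in>J. Z j \<omega> \<in> B j} \<inter> space N = {\<omega>\<in>space N. \<forall>j\<in>J. Z j \<omega> \<in> B j}" by auto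
  ultimately have **: "measure M {\<omega>\<in>space M. \<forall>j\<in>J. Y j \<omega> \<in> B j} = measure N {\<omega>\<in>space N. \<forall>j\<in>J. Z j \<omega> \<in> B j}"
    using * setM setN by simp
  have E: "prod_emb I (\<lambda>_. borel) J (Pi\<^sub>E J B) \<in> sets (PiM I (\<lambda>_. borel))"
    using J B by (intro sets_PiM_I) auto
  have "(\<lambda>\<omega>. \<lambda>j\<in>I. Y j \<omega>) -` prod_emb I (\<lambda>_. borel) J (Pi\<^sub>E J B) \<inter> space M = {\<omega>\<in>space M. \<forall>j\<in>J. Y j \<omega> \<in> B j}"
    using J by (fastforce simp: prod_emb_def PiE_def Pi_def extensional_def restrict_def subset_eq)
  moreover have "(\<lambda>\<omega>. \<lambda>j\<in>I. Z j \<omega>) -` prod_emb I (\<lambda>_. borel) J (Pi\<^sub>E J B) \<inter> space N = {\<omega>\<in>space N. \<forall>j\<in>J. Z j \<omega> \<in> B j}"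
    using J by (fastforce simp: prod_emb_def PiE_def Pi_def extensional_def restrict_def subset_eq)
  ultimately show "emeasure (distr M (PiM I (\<lambda>_. borel)) (\<lambda>\<omega>. \<lambda>j\<in>I. Y j \<omega>)) (prod_emb I (\<lambda>_. borel) J (Pi\<^sub>E J B)) =
       emeasure (distr N (PiM I (\<lambda>_. borel)) (\<lambda>\<omega>. \<lambda>j\<in>I. Z j \<omega>)) (prod_emb I (\<lambda>_. borel) J (Pi\<^sub>E J B))"
    using E ** by (simp add: emeasure_distr[OF mY'] emeasure_distr[OF mZ'] M.emeasure_eq_measure N.emeasure_eq_measure)
qed simp_all

section \<open>Characteristic functions of Brownian motion and of the bridge\<close>

lemma (in prob_space) integral_cis_normal:
  assumes Z: "distributed M lborel Z (normal_density \<mu> \<sigma>)" and \<sigma>: "\<sigma> > 0"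
  shows "(\<integral>\<omega>. cis (u * Z \<omega>) \<partial>M) = cis (u * \<mu>) * of_real (exp (- (u * \<sigma>)\<^sup>2 / 2))"
proof -
  define W where "W \<omega> = (Z \<omega> - \<mu>) / \<sigma>" for \<omega>
  have W: "distributed M lborel W std_normal_density"
    using normal_standard_normal_convert[OF \<sigma>, of Z \<mu>] Z unfolding W_def by simp
  then have [measurable]: "W \<in> borel_measurable M" by (simp add: distributed_def)
  have "(\<integral>\<omega>. cis (u * Z \<omega>) \<partial>M) = (\<integral>\<omega>. cis (u * \<mu>) * cis ((u * \<sigma>) * W \<omega>) \<partial>M)"
    using \<sigma> by (intro Bochner_Integration.integral_cong) (auto simp: W_def cis_mult field_simps)
  also have "\<dots> = cis (u * \<mu>) * (\<integral>\<omega>. cis ((u * \<sigma>) * W \<omega>) \<partial>M)" by simp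
  also have "(\<integral>\<omega>. cis ((u * \<sigma>) * W \<omega>) \<partial>M) = (\<integral>x. cis ((u * \<sigma>) * x) \<partial>distr M lborel W)"
    by (subst integral_distr) auto
  also have "distr M lborel W = std_normal_distribution"
    using W by (simp add: distributed_def)
  also have "(\<integral>x. cis ((u * \<sigma>) * x) \<partial>std_normal_distribution) = char std_normal_distribution (u * \<sigma>)"
    by (simp add: char_def cis_conv_exp)
  finally show ?thesis by (simp add: char_std_normal_distribution)
qed

lemma (in prob_space) normal_variable_integrable:
  assumes "normal_variable M Z"
  shows "integrable M Z" "integrable M (\<lambda>\<omega>. (Z \<omega>)\<^sup>2)"
proof -
  consider (n) \<mu> \<sigma> where "\<sigma> > 0" "distributed M lborel Z (normal_density \<mu> \<sigma>)"
    | (c) \<mu> where "Z \<in> borel_measurable M" "AE \<omega> in M. Z \<omega> = \<mu>"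
    using assms unfolding normal_variable_def by blast
  then have "integrable M Z \<and> integrable M (\<lambda>\<omega>. (Z \<omega>)\<^sup>2)"
  proof cases
    case n
    have 1: "integrable lborel (\<lambda>x. normal_density \<mu> \<sigma> x * x)"
      using integrable_normal_moment_nz_1[OF n(1)] .
    \<comment> \<open>The square is written as x^2 = (x - \<mu>)^2 + 2 \<mu> x - \<mu>^2, to pass
      from the centred second moment to the plain one.\<close>
    have "integrable lborel (\<lambda>x. normal_density \<mu> \<sigma> x * (x - \<mu>)^2 + (2 * \<mu>) * (normal_density \<mu> \<sigma> x * x) - \<mu>\<^sup>2 * normal_density \<mu> \<sigma> x)"
      using integrable_normal_moment[OF n(1), of \<mu> 2] 1 integrable_normal_density[OF n(1), of \<mu>]
      by (intro Bochner_Integration.integrable_diff Bochner_Integration.integrable_add integrable_mult_right)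
    then have 2: "integrable lborel (\<lambda>x. normal_density \<mu> \<sigma> x * x^2)"
      by (rule Bochner_Integration.integrable_cong[THEN iffD1, rotated 2]) (auto simp: power2_eq_square algebra_simps)
    have "integrable lborel (\<lambda>x. normal_density \<mu> \<sigma> x * g x) = integrable M (\<lambda>\<omega>. g (Z \<omega>))"
      if "g \<in> borel_measurable borel" for g :: "real \<Rightarrow> real"
      using that by (intro distributed_integrable[OF n(2)]) auto
    from this[of "\<lambda>x. x"] this[of "\<lambda>x. x^2"] 1 2 show ?thesis by simp
  next
    case c
    have "integrable M (\<lambda>_. \<mu>)" "integrable M (\<lambda>_. \<mu>\<^sup>2)" by auto
    then show ?thesis using c
      by (auto intro!: integrable_cong_AE_imp[of M "\<lambda>_. \<mu>" Z] integrable_cong_AE_imp[of M "\<lambda>_. \<mu>\<^sup>2" "\<lambda>\<omega>. (Z \<omega>)\<^sup>2"])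
  qed
  then show "integrable M Z" "integrable M (\<lambda>\<omega>. (Z \<omega>)\<^sup>2)" by auto
qed

text \<open>One formula covers both disjuncts of \<open>normal_variable\<close>: in the degenerate
  case, being centred forces the constant to be 0, and both sides are 1.\<close>

lemma (in prob_space) integral_cis_centred_normal_variable:
  assumes "normal_variable M Z" and m: "(\<integral>\<omega>. Z \<omega> \<partial>M) = 0"
  shows "(\<integral>\<omega>. cis (Z \<omega>) \<partial>M) = of_real (exp (- (\<integral>\<omega>. (Z \<omega>)\<^sup>2 \<partial>M) / 2))"
proof -
  consider (n) \<mu> \<sigma> where "\<sigma> > 0" "distributed M lborel Z (normal_density \<mu> \<sigma>)"
    | (c) \<mu> where "Z \<in> borel_measurable M" "AE \<omega> in M. Z \<omega> = \<mu>"
    using assms unfolding normal_variable_def by blast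
  then show ?thesis
  proof cases
    case n
    have "(\<integral>x. normal_density \<mu> \<sigma> x * g x \<partial>lborel) = (\<integral>\<omega>. g (Z \<omega>) \<partial>M)"
      if "g \<in> borel_measurable borel" for g :: "real \<Rightarrow> real"
      using that by (intro distributed_integral[OF n(2)]) auto
    note d = this[of "\<lambda>x. x"] this[of "\<lambda>x. x^2"]
    have \<mu>: "\<mu> = 0" using d(1) m integral_normal_moment_nz_1[OF n(1), of \<mu>] by simp
    have "(\<integral>\<omega>. (Z \<omega>)\<^sup>2 \<partial>M) = \<sigma>\<^sup>2"
      using d(2) integral_normal_moment_even[OF n(1), of \<mu> 1] n(1) \<mu> by (simp add: fact_2)
    then show ?thesis using integral_cis_normal[OF n(2,1), of 1] \<mu> by simp
  next
    case c
    have "(\<integral>\<omega>. Z \<omega> \<partial>M) = (\<integral>\<omega>. \<mu> \<partial>M)"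
      using c by (intro integral_cong_AE) auto
    then have "\<mu> = 0" using m by (simp add: prob_space)
    then have ae: "AE \<omega> in M. Z \<omega> = 0" using c by simp
    have "(\<integral>\<omega>. cis (Z \<omega>) \<partial>M) = (\<integral>\<omega>. 1 \<partial>M)"
      using ae c by (intro integral_cong_AE) auto
    moreover have "(\<integral>\<omega>. (Z \<omega>)\<^sup>2 \<partial>M) = (\<integral>\<omega>. 0 \<partial>M)"
      using ae c by (intro integral_cong_AE) auto
    ultimately show ?thesis by (simp add: prob_space)
  qed
qed

text \<open>The exponent is a normal variable by the Gaussian property, so mean and variance decide.
  \<open>min s t - s * t\<close> is the covariance s (1 - t) written symmetrically in s and t, which
  allows a plain double sum.\<close>

lemma integral_cis_brownian_bridge:
  assumes b: "brownian_bridge M b" and J: "finite J" "J \<subseteq> {0..1}"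
  shows "(\<integral>\<omega>. cis (\<Sum>t\<in>J. u t * b t \<omega>) \<partial>M) =
    of_real (exp (- (\<Sum>s\<in>J. \<Sum>t\<in>J. u s * u t * (min s t - s * t)) / 2))"
proof -
  interpret prob_space M using b by (simp add: brownian_bridge_def)
  have G: "normal_variable M (\<lambda>\<omega>. \<Sum>t\<in>J. c t * b t \<omega>)" if "finite J" "J \<subseteq> {0..1}" for J c
    using b that by (auto simp: brownian_bridge_def gaussian_process_def)
  have i: "integrable M (b t)" "integrable M (\<lambda>\<omega>. (b t \<omega>)\<^sup>2)" if "t \<in> J" for t
    using normal_variable_integrable[OF G[of "{t}" "\<lambda>_. 1"]] that J by auto
  \<comment> \<open>The definition prescribes covariances but not integrability of the products;
    that comes from square integrability of each value.\<close>
  have i2: "integrable M (\<lambda>\<omega>. b s \<omega> * b t \<omega>)" if "s \<in> J" "t \<in> J" for s t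
  proof (rule Bochner_Integration.integrable_bound)
    show "integrable M (\<lambda>\<omega>. (b s \<omega>)\<^sup>2 + (b t \<omega>)\<^sup>2)" using i that by auto
    show "(\<lambda>\<omega>. b s \<omega> * b t \<omega>) \<in> borel_measurable M" using i(1) that by auto
    have "\<bar>x * y\<bar> \<le> x\<^sup>2 + y\<^sup>2" for x y :: real
    proof -
      have "2 * (\<bar>x\<bar> * \<bar>y\<bar>) \<le> x\<^sup>2 + y\<^sup>2" using sum_squares_bound[of "\<bar>x\<bar>" "\<bar>y\<bar>"] by simp
      moreover have "0 \<le> \<bar>x\<bar> * \<bar>y\<bar>" by simp
      ultimately show ?thesis unfolding abs_mult by linarith
    qed
    then show "AE \<omega> in M. norm (b s \<omega> * b t \<omega>) \<le> norm ((b s \<omega>)\<^sup>2 + (b t \<omega>)\<^sup>2)" by (simp add: abs_mult)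
  qed
  have cov: "(\<integral>\<omega>. b s \<omega> * b t \<omega> \<partial>M) = min s t - s * t" if "s \<in> J" "t \<in> J" for s t
  proof (cases "s \<le> t")
    case True
    then have "(\<integral>\<omega>. b s \<omega> * b t \<omega> \<partial>M) = s * (1 - t)"
      using b that(1) subsetD[OF J(2) that(2)] subsetD[OF J(2) that(1)] by (auto simp: brownian_bridge_def)
    then show ?thesis using True by (simp add: algebra_simps)
  next
    case False
    then have "(\<integral>\<omega>. b t \<omega> * b s \<omega> \<partial>M) = t * (1 - s)"
      using b that(1) subsetD[OF J(2) that(2)] subsetD[OF J(2) that(1)] by (auto simp: brownian_bridge_def)
    then show ?thesis using False by (simp add: algebra_simps)
  qed
  have "(\<integral>\<omega>. (\<Sum>t\<in>J. u t * b t \<omega>) \<partial>M) = (\<Sum>t\<in>J. u t * (\<integral>\<omega>. b t \<omega> \<partial>M))"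
    using i by simp
  also have "\<dots> = 0" using b J by (intro sum.neutral) (auto simp: brownian_bridge_def)
  finally have m: "(\<integral>\<omega>. (\<Sum>t\<in>J. u t * b t \<omega>) \<partial>M) = 0" .
  have "(\<integral>\<omega>. (\<Sum>t\<in>J. u t * b t \<omega>)\<^sup>2 \<partial>M) = (\<integral>\<omega>. (\<Sum>s\<in>J. \<Sum>t\<in>J. u s * u t * (b s \<omega> * b t \<omega>)) \<partial>M)"
    by (simp add: power2_eq_square sum_product algebra_simps)
  also have "\<dots> = (\<Sum>s\<in>J. \<Sum>t\<in>J. u s * u t * (min s t - s * t))"
    using i2 cov by (simp add: Bochner_Integration.integral_sum)
  finally show ?thesis
    using integral_cis_centred_normal_variable[OF G[OF J, of u] m] by simp
qed

locale brownian_motion = prob_space P for P :: "'w measure" +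
  fixes X :: "real \<Rightarrow> 'w \<Rightarrow> real"
  assumes standard_brownian_motion: "standard_brownian_motion P X"
begin

lemma X_measurable: "0 \<le> t \<Longrightarrow> X t \<in> borel_measurable P"
  and X_0: "\<omega> \<in> space P \<Longrightarrow> X 0 \<omega> = 0"
  and X_continuous: "\<omega> \<in> space P \<Longrightarrow> continuous_on {0..} (\<lambda>t. X t \<omega>)"
  and X_increment: "0 \<le> s \<Longrightarrow> s < t \<Longrightarrow>
    distributed P lborel (\<lambda>\<omega>. X t \<omega> - X s \<omega>) (normal_density 0 (sqrt (t - s)))"
  and X_indep: "0 \<le> \<tau> 0 \<Longrightarrow> mono_on {..n} \<tau> \<Longrightarrow>
    indep_vars (\<lambda>_. borel) (\<lambda>i \<omega>. X (\<tau> (Suc i)) \<omega> - X (\<tau> i) \<omega>) {..<n}" for \<tau> :: "nat \<Rightarrow> real"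
  using standard_brownian_motion unfolding standard_brownian_motion_def by blast+

lemma integral_cis_increment:
  assumes "0 \<le> s" "s < t"
  shows "(\<integral>\<omega>. cis (u * (X t \<omega> - X s \<omega>)) \<partial>P) = of_real (exp (- u\<^sup>2 * (t - s) / 2))"
  using integral_cis_normal[OF X_increment[OF assms], of u] assms by (simp add: power_mult_distrib)

text \<open>Sorting the times turns the linear combination into one of independent increments. Times
  are given by a map \<open>T\<close> that may repeat values, because later uses freeze times at
  \<open>c\<close> through \<open>min t c\<close>.\<close>

lemma integral_cis_brownian_motion:
  assumes K: "finite K" "\<And>i. i \<in> K \<Longrightarrow> 0 \<le> T i"
  shows "(\<integral>\<omega>. cis (\<Sum>i\<in>K. u i * X (T i) \<omega>) \<partial>P) =
    of_real (exp (- (\<Sum>i\<in>K. \<Sum>j\<in>K. u i * u j * min (T i) (T j)) / 2))"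
proof -
  define J where "J = T ` K"
  have J: "finite J" "J \<subseteq> {0..}" using K by (auto simp: J_def)
  \<comment> \<open>Time 0 is added so that every telescoping sum starts from
    \<open>X 0 = 0\<close>.\<close>
  define \<tau> where "\<tau> k = sorted_list_of_set (insert 0 J) ! k" for k
  define n where "n = card (insert 0 J) - 1"
  have len: "length (sorted_list_of_set (insert 0 J)) = Suc n"
  proof -
    have "card (insert 0 J) > 0" using J by (subst card_gt_0_iff) auto
    then show ?thesis unfolding n_def length_sorted_list_of_set by (rule Suc_diff_1[symmetric, THEN trans]) simp
  qed
  have strict: "\<tau> i < \<tau> j" if "i < j" "j \<le> n" for i j
    using that len J sorted_wrt_nth_less[OF strict_sorted_list_of_set[of "insert 0 J"], of i j] unfolding \<tau>_def
    by simp
  have ge: "\<tau> i \<le> \<tau> j" if "i \<le> j" "j \<le> n" for i j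
    using strict[of i j] that by (cases "i = j") auto
  have range: "\<exists>m\<le>n. \<tau> m = t" if "t \<in> insert 0 J" for t
  proof -
    have "t \<in> set (sorted_list_of_set (insert 0 J))" using that J by (subst set_sorted_list_of_set) auto
    then show ?thesis unfolding in_set_conv_nth len \<tau>_def using less_Suc_eq_le by blast
  qed
  have pos: "0 \<le> \<tau> i" if "i \<le> n" for i
  proof -
    have "\<tau> i \<in> set (sorted_list_of_set (insert 0 J))" unfolding \<tau>_def using that len by (intro nth_mem) simp
    moreover have "set (sorted_list_of_set (insert 0 J)) = insert 0 J" using J by (subst set_sorted_list_of_set) auto
    ultimately show ?thesis using J by auto
  qed
  obtain m where "m \<le> n" "\<tau> m = 0" using range[of 0] by auto
  then have \<tau>0: "\<tau> 0 = 0" using ge[of 0 m] pos[of 0] by simp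
  \<comment> \<open>\<open>I t k\<close> selects the increments that precede \<open>t\<close>. The
    fact \<open>tele\<close> is used twice: with \<open>F\<close> a path it rewrites the exponent,
    and with \<open>F\<close> the identity it evaluates the variance, since
    \<open>I (min s t)\<close> is the product of \<open>I s\<close> and \<open>I t\<close>.\<close>
  define I where "I t k = (if \<tau> k < t then 1 else 0 :: real)" for t k
  have tele: "(\<Sum>k<n. I t k * (F (\<tau> (Suc k)) - F (\<tau> k))) = F t - F 0" if t: "t \<in> J" for F :: "real \<Rightarrow> real" and t
  proof -
    obtain m where m: "m \<le> n" "\<tau> m = t" using range[of t] t by auto
    have "(\<Sum>k<n. I t k * (F (\<tau> (Suc k)) - F (\<tau> k))) = (\<Sum>k<m. F (\<tau> (Suc k)) - F (\<tau> k))"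
    proof (intro sum.mono_neutral_cong_right)
      have iff: "\<tau> k < t \<longleftrightarrow> k < m" if "k < n" for k
        using strict[of k m] ge[of m k] m that by (cases "k < m") auto
      then show "\<forall>k\<in>{..<n} - {..<m}. I t k * (F (\<tau> (Suc k)) - F (\<tau> k)) = 0"
        by (auto simp: I_def)
      show "I t k * (F (\<tau> (Suc k)) - F (\<tau> k)) = F (\<tau> (Suc k)) - F (\<tau> k)" if "k \<in> {..<m}" for k
        using iff[of k] m that by (simp add: I_def)
    qed (use m in auto)
    also have "\<dots> = F t - F 0" using m \<tau>0 sum_lessThan_telescope[of "\<lambda>k. F (\<tau> k)" m] by simp
    finally show ?thesis .
  qed
  define w where "w k = (\<Sum>i\<in>K. u i * I (T i) k)" for k
  define D where "D k \<omega> = X (\<tau> (Suc k)) \<omega> - X (\<tau> k) \<omega>" for k \<omega>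
  have mono: "mono_on {..n} \<tau>" using ge by (auto simp: mono_on_def)
  have ind: "indep_vars (\<lambda>_. borel) D {..<n}"
    unfolding D_def using X_indep[of \<tau> n] mono \<tau>0 by simp
  have Dm[measurable]: "k < n \<Longrightarrow> D k \<in> borel_measurable P" for k
    using ind by (auto simp: indep_vars_def)
  have [measurable]: "cis \<in> borel_measurable borel"
    by simp
  have ind': "indep_vars (\<lambda>_. borel) (\<lambda>k \<omega>. cis (w k * D k \<omega>)) {..<n}"
    by (rule indep_vars_compose2[OF ind]) auto
  have sumX: "(\<Sum>i\<in>K. u i * X (T i) \<omega>) = (\<Sum>k<n. w k * D k \<omega>)" if "\<omega> \<in> space P" for \<omega>
  proof -
    have "(\<Sum>k<n. w k * D k \<omega>) = (\<Sum>i\<in>K. u i * (\<Sum>k<n. I (T i) k * (X (\<tau> (Suc k)) \<omega> - X (\<tau> k) \<omega>)))"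
      unfolding w_def D_def sum_distrib_right sum_distrib_left by (subst sum.swap) (simp add: mult.assoc)
    also have "\<dots> = (\<Sum>i\<in>K. u i * X (T i) \<omega>)"
      using X_0[OF that] by (intro sum.cong) (auto simp: J_def tele[of _ "\<lambda>t. X t \<omega>"])
    finally show ?thesis by simp
  qed
  have cis_sum: "cis (\<Sum>k\<in>A. f k) = (\<Prod>k\<in>A. cis (f k))" if "finite A" for A :: "nat set" and f
    using that by (induction A) (auto simp: cis_mult[symmetric])
  have "(\<integral>\<omega>. cis (\<Sum>i\<in>K. u i * X (T i) \<omega>) \<partial>P) = (\<integral>\<omega>. (\<Prod>k<n. cis (w k * D k \<omega>)) \<partial>P)"
    by (intro Bochner_Integration.integral_cong) (auto simp: sumX cis_sum)
  also have "\<dots> = (\<Prod>k<n. \<integral>\<omega>. cis (w k * D k \<omega>) \<partial>P)"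
  proof (rule indep_vars_lebesgue_integral[OF _ ind'])
    show "integrable P (\<lambda>\<omega>. cis (w i * D i \<omega>))" if "i \<in> {..<n}" for i
      using that by (intro integrable_const_bound[of _ 1]) auto
  qed simp
  also have "\<dots> = (\<Prod>k<n. of_real (exp (- (w k)\<^sup>2 * (\<tau> (Suc k) - \<tau> k) / 2)))"
    unfolding D_def using pos strict by (intro prod.cong refl integral_cis_increment) auto
  also have "\<dots> = of_real (exp (- (\<Sum>k<n. (w k)\<^sup>2 * (\<tau> (Suc k) - \<tau> k)) / 2))"
    by (simp add: exp_sum sum_divide_distrib sum_negf[symmetric])
  also have "(\<Sum>k<n. (w k)\<^sup>2 * (\<tau> (Suc k) - \<tau> k)) = (\<Sum>i\<in>K. \<Sum>j\<in>K. u i * u j * min (T i) (T j))"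
  proof -
    have "(\<Sum>k<n. (w k)\<^sup>2 * (\<tau> (Suc k) - \<tau> k)) =
        (\<Sum>k<n. \<Sum>i\<in>K. \<Sum>j\<in>K. u i * u j * (I (min (T i) (T j)) k * (\<tau> (Suc k) - \<tau> k)))"
    proof -
      have I: "I (min s t) k = I s k * I t k" for s t k by (simp add: I_def)
      show ?thesis unfolding w_def power2_eq_square sum_product unfolding sum_distrib_right I
        by (intro sum.cong refl) (simp add: mult_ac)
    qed
    also have "\<dots> = (\<Sum>i\<in>K. \<Sum>j\<in>K. \<Sum>k<n. u i * u j * (I (min (T i) (T j)) k * (\<tau> (Suc k) - \<tau> k)))"
      by (subst sum.swap, intro sum.cong refl, subst sum.swap) simp
    also have "\<dots> = (\<Sum>i\<in>K. \<Sum>j\<in>K. u i * u j * min (T i) (T j))"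
    proof (intro sum.cong refl)
      fix i j assume "i \<in> K" "j \<in> K"
      then have "min (T i) (T j) \<in> J" by (simp add: min_def J_def)
      from tele[OF this, of "\<lambda>x. x"]
      show "(\<Sum>k<n. u i * u j * (I (min (T i) (T j)) k * (\<tau> (Suc k) - \<tau> k))) = u i * u j * min (T i) (T j)"
        by (simp add: sum_distrib_left[symmetric])
    qed
    finally show ?thesis .
  qed
  finally show ?thesis .
qed

end

section \<open>Occupation times of a fixed path\<close>

text \<open>Away from 0 the function is locally zero or a plain power. At 0 the difference quotient
  is at most \<open>\<bar>h\<bar> ^ Suc k\<close>.\<close>

lemma DERIV_pos_part_power:
  "((\<lambda>x::real. max 0 x ^ Suc (Suc k)) has_real_derivative real (Suc (Suc k)) * max 0 x ^ Suc k) (at x)"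
proof -
  consider "x < 0" | "x > 0" | "x = 0" by linarith
  then show ?thesis
  proof cases
    case 1
    have "((\<lambda>x::real. 0) has_real_derivative 0) (at x)" by simp
    then have "((\<lambda>x::real. max 0 x ^ Suc (Suc k)) has_real_derivative 0) (at x)"
      by (rule has_field_derivative_transform_within_open[of _ _ _ "{..<0}"]) (use 1 in auto)
    then show ?thesis using 1 by simp
  next
    case 2
    have "((\<lambda>x::real. x ^ Suc (Suc k)) has_real_derivative real (Suc (Suc k)) * x ^ Suc k) (at x)"
      by (auto intro!: derivative_eq_intros simp del: power_Suc)
    then have "((\<lambda>x::real. max 0 x ^ Suc (Suc k)) has_real_derivative real (Suc (Suc k)) * x ^ Suc k) (at x)"
      by (rule has_field_derivative_transform_within_open[of _ _ _ "{0<..}"]) (use 2 in auto)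
    then show ?thesis using 2 by simp
  next
    case 3
    have "((\<lambda>h::real. max 0 h ^ Suc (Suc k) / h) \<longlongrightarrow> 0) (at 0)"
    proof (rule Lim_null_comparison)
      show "((\<lambda>h::real. \<bar>h\<bar> ^ Suc k) \<longlongrightarrow> 0) (at 0)"
        by (auto intro!: tendsto_eq_intros)
      have "norm (max 0 h ^ Suc (Suc k) / h) \<le> \<bar>h\<bar> ^ Suc k" for h :: real
      proof (cases "h \<le> 0")
        case True
        then have "max 0 h = 0" by simp
        then have "norm (max 0 h ^ Suc (Suc k) / h) = 0" by simp
        then show ?thesis by (metis abs_ge_zero zero_le_power)
      qed (simp add: max_def)
      then show "\<forall>\<^sub>F h::real in at 0. norm (max 0 h ^ Suc (Suc k) / h) \<le> \<bar>h\<bar> ^ Suc k" by simp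
    qed
    then show ?thesis using 3 by (simp add: DERIV_def)
  qed
qed

text \<open>A twice differentiable approximation of the absolute value: the second derivative is the tent
  of mass 2 on \<open>[-e, e]\<close>.\<close>

definition spline :: "real \<Rightarrow> real \<Rightarrow> real" where
  "spline e x = (max 0 (x + e) ^ 3 - 2 * max 0 x ^ 3 + max 0 (x - e) ^ 3) / (3 * e\<^sup>2) - x"

definition spline' :: "real \<Rightarrow> real \<Rightarrow> real" where
  "spline' e x = (max 0 (x + e) ^ 2 - 2 * max 0 x ^ 2 + max 0 (x - e) ^ 2) / e\<^sup>2 - 1"

definition tent :: "real \<Rightarrow> real \<Rightarrow> real" where
  "tent e x = 2 * max 0 (e - \<bar>x\<bar>) / e\<^sup>2"

text \<open>The value at 0 is 1, unlike that of \<open>sgn\<close>: flipping an increment must never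
  erase it, or the flipped walk would not keep its law.\<close>

definition sign :: "real \<Rightarrow> real" where
  "sign x = (if x < 0 then -1 else 1)"

lemma sign_measurable [measurable]: "sign \<in> borel_measurable borel"
  unfolding sign_def by measurable

lemma spline_measurable [measurable]: "spline e \<in> borel_measurable borel"
  unfolding spline_def by measurable

lemma spline'_measurable [measurable]: "spline' e \<in> borel_measurable borel"
  unfolding spline'_def by measurable

lemma continuous_tent: "continuous_on UNIV (tent e)"
  unfolding tent_def divide_inverse by (intro continuous_intros)

lemma tent_measurable [measurable]: "tent e \<in> borel_measurable borel"
  by (intro borel_measurable_continuous_onI continuous_tent)

lemma DERIV_spline: "e > 0 \<Longrightarrow> (spline e has_real_derivative spline' e x) (at x)"
proof -
  assume e: "e > 0"
  have d: "((\<lambda>x. max 0 (x + a) ^ 3) has_real_derivative 3 * max 0 (x + a) ^ 2) (at x)" for a :: real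
  proof -
    have "((\<lambda>x. max 0 x ^ 3) has_real_derivative 3 * max 0 (x + a) ^ 2) (at (x + a))"
      using DERIV_pos_part_power[of 1 "x + a"] by (simp add: numeral_3_eq_3 power2_eq_square)
    then show ?thesis using DERIV_shift[of "\<lambda>x. max 0 x ^ 3" _ x a] by blast
  qed
  have "((\<lambda>x. (max 0 (x + e) ^ 3 - 2 * max 0 (x + 0) ^ 3 + max 0 (x + (- e)) ^ 3) / (3 * e\<^sup>2) - x)
     has_real_derivative (3 * max 0 (x + e) ^ 2 - 2 * (3 * max 0 (x + 0) ^ 2) + 3 * max 0 (x + (- e)) ^ 2) / (3 * e\<^sup>2) - 1) (at x)"
    by (intro DERIV_diff DERIV_add DERIV_cdivide DERIV_cmult d DERIV_ident)
  moreover have "(3 * max 0 (x + e) ^ 2 - 2 * (3 * max 0 (x + 0) ^ 2) + 3 * max 0 (x + (- e)) ^ 2) / (3 * e\<^sup>2) - 1 = spline' e x"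
    using e by (simp add: spline'_def field_simps)
  ultimately show ?thesis by (simp add: spline_def[abs_def])
qed

lemma DERIV_spline': "e > 0 \<Longrightarrow> (spline' e has_real_derivative tent e x) (at x)"
proof -
  assume e: "e > 0"
  have d: "((\<lambda>x. max 0 (x + a) ^ 2) has_real_derivative 2 * max 0 (x + a)) (at x)" for a :: real
  proof -
    have "((\<lambda>x. max 0 x ^ 2) has_real_derivative 2 * max 0 (x + a)) (at (x + a))"
      using DERIV_pos_part_power[of 0 "x + a"] by (simp add: numeral_2_eq_2)
    then show ?thesis using DERIV_shift[of "\<lambda>x. max 0 x ^ 2" _ x a] by blast
  qed
  have "((\<lambda>x. (max 0 (x + e) ^ 2 - 2 * max 0 (x + 0) ^ 2 + max 0 (x + (- e)) ^ 2) / e\<^sup>2 - 1)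
     has_real_derivative (2 * max 0 (x + e) - 2 * (2 * max 0 (x + 0)) + 2 * max 0 (x + (- e))) / e\<^sup>2 - 0) (at x)"
    by (intro DERIV_diff DERIV_add DERIV_cdivide DERIV_cmult d DERIV_const)
  moreover have "(2 * max 0 (x + e) - 2 * (2 * max 0 (x + 0)) + 2 * max 0 (x + (- e))) / e\<^sup>2 - 0 = tent e x"
    using e by (simp add: tent_def max_def)
  ultimately show ?thesis by (simp add: spline'_def[abs_def])
qed

lemma tent_bounds: "e > 0 \<Longrightarrow> 0 \<le> tent e x" "e > 0 \<Longrightarrow> tent e x \<le> 2 / e"
  by (auto simp: tent_def max_def field_simps power2_eq_square)

lemma tent_lipschitz: "e > 0 \<Longrightarrow> \<bar>tent e x - tent e y\<bar> \<le> 2 * \<bar>x - y\<bar> / e\<^sup>2"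
proof -
  assume e: "e > 0"
  have "\<bar>max 0 (e - \<bar>x\<bar>) - max 0 (e - \<bar>y\<bar>)\<bar> \<le> \<bar>x - y\<bar>" by linarith
  then have "2 * \<bar>max 0 (e - \<bar>x\<bar>) - max 0 (e - \<bar>y\<bar>)\<bar> / e\<^sup>2 \<le> 2 * \<bar>x - y\<bar> / e\<^sup>2"
    by (intro divide_right_mono) auto
  moreover have "\<bar>tent e x - tent e y\<bar> = 2 * \<bar>max 0 (e - \<bar>x\<bar>) - max 0 (e - \<bar>y\<bar>)\<bar> / e\<^sup>2"
  proof -
    have "tent e x - tent e y = 2 * (max 0 (e - \<bar>x\<bar>) - max 0 (e - \<bar>y\<bar>)) / e\<^sup>2"
      unfolding tent_def by (simp only: diff_divide_distrib right_diff_distrib)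
    then show ?thesis by (simp only: abs_mult abs_divide abs_numeral abs_power2)
  qed
  ultimately show ?thesis by simp
qed

text \<open>Outside (-e, e) the spline coincides with the absolute value, so its slope is exactly
  the sign there. The error is thus confined to the times at which the path is near 0, and those are
  rare.\<close>

lemma spline'_sign: "e > 0 \<Longrightarrow> \<bar>spline' e x - sign x\<bar> \<le> (if \<bar>x\<bar> < e then 2 else 0)"
proof -
  assume e: "e > 0"
  consider "x \<ge> e" | "0 \<le> x" "x < e" | "-e < x" "x < 0" | "x \<le> -e" by linarith
  then show ?thesis
  proof cases
    case 1
    have "(x + e)\<^sup>2 - 2 * x\<^sup>2 + (x - e)\<^sup>2 = 2 * e\<^sup>2" by algebra
    then show ?thesis using 1 e by (simp add: spline'_def sign_def)
  next
    case 2
    then have 3: "spline' e x = (2 * e * x - x\<^sup>2) / e\<^sup>2"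
      using e by (simp add: spline'_def field_simps power2_eq_square)
    have "0 \<le> x * (2 * e - x)" using 2 by (intro mult_nonneg_nonneg) auto
    moreover have "0 \<le> (e - x)\<^sup>2" by simp
    ultimately have "0 \<le> spline' e x" "spline' e x \<le> 1"
      unfolding 3 using e by (auto simp: field_simps power2_eq_square)
    then show ?thesis using 2 by (simp add: sign_def)
  next
    case 3
    then have "spline' e x = (x + e)\<^sup>2 / e\<^sup>2 - 1" by (simp add: spline'_def)
    moreover have "(x + e)\<^sup>2 \<le> e\<^sup>2" using 3 by (intro power_mono) auto
    moreover have "(x + e)\<^sup>2 / e\<^sup>2 \<le> 1" "0 \<le> (x + e)\<^sup>2 / e\<^sup>2"
      using \<open>(x + e)\<^sup>2 \<le> e\<^sup>2\<close> e by (auto simp: divide_le_eq_1)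
    ultimately have q: "spline' e x - sign x = (x + e)\<^sup>2 / e\<^sup>2" "\<bar>(x + e)\<^sup>2 / e\<^sup>2\<bar> \<le> 2"
      subgoal using 3 by (simp add: sign_def)
      subgoal using \<open>(x + e)\<^sup>2 / e\<^sup>2 \<le> 1\<close> \<open>0 \<le> (x + e)\<^sup>2 / e\<^sup>2\<close> by linarith
      done
    have "\<bar>x\<bar> < e" using 3 by simp
    then show ?thesis unfolding q(1) using q(2) by (simp only: if_True)
  next
    case 4
    then show ?thesis using e by (simp add: sign_def spline'_def)
  qed
qed

lemma spline_abs: "e > 0 \<Longrightarrow> \<bar>spline e x - \<bar>x\<bar>\<bar> \<le> 4 * e"
proof -
  assume e: "e > 0"
  consider "x \<ge> e" | "0 \<le> x" "x < e" | "-e < x" "x < 0" | "x \<le> -e" by linarith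
  then show ?thesis
  proof cases
    case 1
    have "(x + e) ^ 3 - 2 * x ^ 3 + (x - e) ^ 3 = 2 * x * (3 * e\<^sup>2)" by algebra
    then show ?thesis using 1 e by (simp add: spline_def)
  next
    case 2
    have "(x + e) ^ 3 \<le> (2 * e) ^ 3" by (rule power_mono) (use 2 e in auto)
    moreover have "x ^ 3 \<le> e ^ 3" "0 \<le> x ^ 3" "0 \<le> (x + e)^3"
      using 2 e by (auto intro!: power_mono zero_le_power simp del: zero_le_power_eq_numeral)
    moreover have "(2 * e) ^ 3 = 8 * e ^ 3" by (simp add: power_mult_distrib)
    ultimately have "\<bar>(x + e) ^ 3 - 2 * x ^ 3\<bar> \<le> 8 * e ^ 3" by linarith
    then have "\<bar>(x + e) ^ 3 - 2 * x ^ 3\<bar> / (3 * e\<^sup>2) \<le> 8 * e ^ 3 / (3 * e\<^sup>2)" using e by (intro divide_right_mono) auto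
    also have "\<dots> = 8 / 3 * e" using e by (simp add: power3_eq_cube power2_eq_square)
    finally have "\<bar>((x + e) ^ 3 - 2 * x ^ 3) / (3 * e\<^sup>2)\<bar> \<le> 8/3 * e" by simp
    moreover have "((x + e) ^ 3 - 2 * x ^ 3) / (3 * e\<^sup>2) - 2 * x \<ge> - 2 * e"
    proof -
      have "(x + e) ^ 3 - 2 * x ^ 3 \<ge> 0"
      proof -
        have "x * (x * x) \<le> e * (x * x)" using 2 by (intro mult_right_mono) auto
        moreover have "(x + e)^3 = x * (x * x) + 3 * (e * (x * x)) + 3 * (e * e * x) + e * e * e" by algebra
        moreover have "x ^ 3 = x * (x * x)" by algebra
        moreover have "0 \<le> e * (x * x)" "0 \<le> e * e * x" "0 \<le> e * e * e" using 2 e by auto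
        ultimately show ?thesis by linarith
      qed
      then have "0 \<le> ((x + e) ^ 3 - 2 * x ^ 3) / (3 * e\<^sup>2)" by simp
      then show ?thesis using 2 by linarith
    qed
    moreover have "spline e x - \<bar>x\<bar> = ((x + e) ^ 3 - 2 * x ^ 3) / (3 * e\<^sup>2) - 2 * x"
      using 2 by (simp add: spline_def)
    ultimately show ?thesis using 2 e by linarith
  next
    case 3
    then have s: "spline e x - \<bar>x\<bar> = (x + e) ^ 3 / (3 * e\<^sup>2)" by (simp add: spline_def)
    have "(x + e) ^ 3 \<le> e ^ 3" "0 \<le> (x + e) ^ 3" using 3 by (auto intro!: power_mono)
    then have "(x + e) ^ 3 / (3 * e\<^sup>2) \<le> e ^ 3 / (3 * e\<^sup>2)" "0 \<le> (x + e) ^ 3 / (3 * e\<^sup>2)"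
      using e by (auto intro!: divide_right_mono)
    moreover have "e ^ 3 / (3 * e\<^sup>2) = e / 3" using e by (simp add: power3_eq_cube power2_eq_square)
    ultimately show ?thesis using e unfolding s by linarith
  next
    case 4
    then show ?thesis using e by (simp add: spline_def)
  qed
qed

text \<open>Taylor's theorem puts the second derivative at an intermediate point;
  \<open>tent e\<close> has Lipschitz constant 2 / e^2, so moving that point back to
  \<open>x\<close> costs a term of third order.\<close>

lemma spline_taylor:
  assumes e: "e > 0"
  shows "\<bar>spline e y - spline e x - spline' e x * (y - x) - tent e x / 2 * (y - x)\<^sup>2\<bar> \<le> \<bar>y - x\<bar> ^ 3 / e\<^sup>2"
proof (cases "y = x")
  case False
  define d where "d k = (if k = 0 then spline e else if k = Suc 0 then spline' e else tent e)" for k :: nat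
  have "\<exists>t. (if y < x then y < t \<and> t < x else x < t \<and> t < y) \<and>
      spline e y = (\<Sum>m<2. d m x / fact m * (y - x) ^ m) + d 2 t / fact 2 * (y - x) ^ 2"
    by (rule Taylor[where a="min x y" and b="max x y" and diff=d])
       (use False e DERIV_spline DERIV_spline' in \<open>auto simp: d_def less_Suc_eq numeral_2_eq_2\<close>)
  then obtain t where t: "\<bar>t - x\<bar> \<le> \<bar>y - x\<bar>"
      and eq: "spline e y = spline e x + spline' e x * (y - x) + tent e t / 2 * (y - x) ^ 2"
    by (simp add: d_def numeral_2_eq_2 split: if_splits) (metis abs_minus_commute abs_of_pos diff_gt_0_iff_gt less_imp_le diff_left_mono diff_right_mono less_trans)+
  have "\<bar>spline e y - spline e x - spline' e x * (y - x) - tent e x / 2 * (y - x)\<^sup>2\<bar>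
      = \<bar>tent e t - tent e x\<bar> / 2 * (y - x)\<^sup>2"
    unfolding eq by (simp add: left_diff_distrib[symmetric] diff_divide_distrib[symmetric]) (simp add: abs_mult)
  also have "\<dots> \<le> (2 * \<bar>y - x\<bar> / e\<^sup>2) / 2 * (y - x)\<^sup>2"
  proof -
    have "2 * \<bar>t - x\<bar> / e\<^sup>2 \<le> 2 * \<bar>y - x\<bar> / e\<^sup>2" using t by (intro divide_right_mono) auto
    then show ?thesis using tent_lipschitz[OF e, of t x] by (intro mult_right_mono divide_right_mono) (linarith | simp)+
  qed
  also have "\<dots> = \<bar>y - x\<bar> ^ 3 / e\<^sup>2"
    by (simp add: power3_eq_cube power2_eq_square abs_mult_self_eq)
  finally show ?thesis .
qed (simp)

section \<open>Grid points and Riemann sums\<close>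

lemma grid_floor:
  fixes s :: real
  assumes "0 \<le> s"
  shows "real (nat \<lfloor>real n * s\<rfloor>) / real n \<le> s" "n > 0 \<Longrightarrow> s - real (nat \<lfloor>real n * s\<rfloor>) / real n \<le> 1 / real n"
    "s \<le> 1 \<Longrightarrow> nat \<lfloor>real n * s\<rfloor> \<le> n"
proof -
  have 0: "real (nat \<lfloor>real n * s\<rfloor>) = of_int \<lfloor>real n * s\<rfloor>" using assms by simp
  show "real (nat \<lfloor>real n * s\<rfloor>) / real n \<le> s"
    using assms unfolding 0 by (cases "n = 0") (auto simp: field_simps)
  have "real n * s < of_int \<lfloor>real n * s\<rfloor> + 1" by linarith
  then show "n > 0 \<Longrightarrow> s - real (nat \<lfloor>real n * s\<rfloor>) / real n \<le> 1 / real n"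
    unfolding 0 diff_le_eq by (simp add: add_divide_distrib[symmetric] pos_le_divide_eq mult.commute[of s] add.commute)
  assume "s \<le> 1"
  then have "real n * s \<le> real n * 1" by (intro mult_left_mono) auto
  then have "\<lfloor>real n * s\<rfloor> \<le> int n" by linarith
  then show "nat \<lfloor>real n * s\<rfloor> \<le> n" by linarith
qed

lemma tendsto_grid_floor:
  fixes s :: real
  assumes "0 \<le> s"
  shows "(\<lambda>n. real (nat \<lfloor>real n * s\<rfloor>) / real n) \<longlonglongrightarrow> s"
proof -
  have "(\<lambda>n. s - real (nat \<lfloor>real n * s\<rfloor>) / real n) \<longlonglongrightarrow> 0"
  proof (rule Lim_null_comparison)
    show "(\<lambda>n. 1 / real n) \<longlonglongrightarrow> 0" by (rule lim_1_over_n)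
    show "\<forall>\<^sub>F n in sequentially. norm (s - real (nat \<lfloor>real n * s\<rfloor>) / real n) \<le> 1 / real n"
      using eventually_gt_at_top[of 0] by eventually_elim (use grid_floor[OF assms] in auto)
  qed
  from tendsto_diff[OF tendsto_const[of s] this] show ?thesis by simp
qed

text \<open>The upper limit of the sum moves with \<open>n\<close> too. The sum is therefore
  compared with the primitive \<open>F\<close> at the last grid point, cell by cell through the mean
  value theorem, and continuity of \<open>F\<close> moves that point to \<open>s\<close>.\<close>

lemma riemann_sum_tendsto:
  fixes g :: "real \<Rightarrow> real"
  assumes g: "continuous_on {0..1} g" and s: "0 \<le> s" "s \<le> 1"
  shows "(\<lambda>n. \<Sum>j<nat \<lfloor>real n * s\<rfloor>. g (real j / real n) / real n) \<longlonglongrightarrow> (LINT r:{0..s}|lborel. g r)"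
proof -
  define F where "F x = integral {0..x} g" for x
  have F: "(F has_real_derivative g x) (at x within {0..1})" if "x \<in> {0..1}" for x
    unfolding F_def using integral_has_real_derivative[OF g that] .
  have "continuous_on {0..1} F" using F has_field_derivative_imp_has_derivative has_derivative_continuous_on
    by (metis (no_types, lifting) DERIV_continuous continuous_on_eq_continuous_within)
  then have "(\<lambda>n. F (real (nat \<lfloor>real n * s\<rfloor>) / real n)) \<longlonglongrightarrow> F s"
  proof (rule continuous_on_tendsto_compose[OF _ tendsto_grid_floor[OF s(1)]])
    show "s \<in> {0..1}" using s by simp
    have "real (nat \<lfloor>real n * s\<rfloor>) / real n \<in> {0..1}" for n
      using grid_floor[OF s(1), of n] s by auto
    then show "\<forall>\<^sub>F n in sequentially. real (nat \<lfloor>real n * s\<rfloor>) / real n \<in> {0..1}" by simp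
  qed
  moreover have "(\<lambda>n. (\<Sum>j<nat \<lfloor>real n * s\<rfloor>. g (real j / real n) / real n) - F (real (nat \<lfloor>real n * s\<rfloor>) / real n)) \<longlonglongrightarrow> 0"
  proof (rule LIMSEQ_I)
    fix r :: real assume r: "r > 0"
    have "uniformly_continuous_on {0..1} g" using g compact_uniformly_continuous by blast
    then obtain d where d: "d > 0" "\<And>x y. x \<in> {0..1} \<Longrightarrow> y \<in> {0..1} \<Longrightarrow> \<bar>y - x\<bar> < d \<Longrightarrow> \<bar>g y - g x\<bar> < r / 2"
      unfolding uniformly_continuous_on_def dist_real_def by (metis half_gt_zero r)
    obtain N where N: "1 / real (Suc N) < d" using d(1) nat_approx_posE by blast
    show "\<exists>no. \<forall>n\<ge>no. norm ((\<Sum>j<nat \<lfloor>real n * s\<rfloor>. g (real j / real n) / real n) - F (real (nat \<lfloor>real n * s\<rfloor>) / real n) - 0) < r"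
    proof (intro exI allI impI)
      fix n assume n: "Suc N \<le> n"
      then have n0: "n > 0" by simp
      have "1 / real n \<le> 1 / real (Suc N)" using n by (intro divide_left_mono) auto
      then have nd: "1 / real n < d" using N by simp
      let ?k = "nat \<lfloor>real n * s\<rfloor>"
      have k: "?k \<le> n" using grid_floor(3)[OF s] .
      have step: "\<bar>g (real j / real n) / real n - (F (real (Suc j) / real n) - F (real j / real n))\<bar> \<le> r / 2 / real n"
        if j: "j < ?k" for j
      proof -
        define x y where "x = real j / real n" and "y = real (Suc j) / real n"
        have xy: "0 \<le> x" "x < y" "y \<le> 1" "y - x = 1 / real n"
          using j k n0 by (auto simp: x_def y_def field_simps)
        obtain z where z: "x < z" "z < y" "F y - F x = (y - x) * g z"
        proof -
          have "\<exists>z\<in>{x<..<y}. F y - F x = g z * (y - x)"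
          proof (rule mvt_simple[OF xy(2)])
            fix u assume "x \<le> u" "u \<le> y"
            then have "(F has_real_derivative g u) (at u within {x..y})"
              using xy by (intro DERIV_subset[OF F]) auto
            then show "(F has_derivative (*) (g u)) (at u within {x..y})" by (simp add: has_field_derivative_def)
          qed
          then show ?thesis using that by (auto simp: mult.commute)
        qed
        have "\<bar>g z - g x\<bar> < r / 2" using z xy nd by (intro d) auto
        then have "\<bar>g z - g x\<bar> / real n \<le> r / 2 / real n" by (intro divide_right_mono) auto
        moreover have "g x / real n - (F y - F x) = - ((g z - g x) / real n)"
          unfolding z(3) xy(4) by (simp add: diff_divide_distrib)
        ultimately have "\<bar>g x / real n - (F y - F x)\<bar> \<le> r / 2 / real n" by simp
        then show ?thesis unfolding x_def y_def .
      qed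
      have F0: "F 0 = 0" by (simp add: F_def)
      have "(\<Sum>j<?k. g (real j / real n) / real n) - F (real ?k / real n)
         = (\<Sum>j<?k. g (real j / real n) / real n - (F (real (Suc j) / real n) - F (real j / real n)))"
        using sum_lessThan_telescope[of "\<lambda>j. F (real j / real n)" ?k] by (simp add: sum_subtractf F0)
      also have "norm \<dots> \<le> (\<Sum>j<?k. r / 2 / real n)"
        unfolding real_norm_def using step by (intro order_trans[OF sum_abs] sum_mono) auto
      also have "\<dots> = real ?k * (r / 2 / real n)" by simp
      also have "\<dots> \<le> real n * (r / 2 / real n)" using k r n0 by (intro mult_right_mono) auto
      also have "\<dots> < r" using n0 r by simp
      finally show "norm ((\<Sum>j<?k. g (real j / real n) / real n) - F (real ?k / real n) - 0) < r" by simp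
    qed
  qed
  ultimately have "(\<lambda>n. \<Sum>j<nat \<lfloor>real n * s\<rfloor>. g (real j / real n) / real n) \<longlonglongrightarrow> F s"
    using tendsto_add by fastforce
  moreover have "(LINT r:{0..s}|lborel. g r) = F s"
    unfolding F_def using s by (intro set_borel_integral_eq_integral borel_integrable_atLeastAtMost' continuous_on_subset[OF g]) auto
  ultimately show ?thesis by simp
qed

text \<open>Consecutive members of the sequence m^-4 have ratio tending to 1, so monotonicity of
  \<open>T\<close> squeezes the quotient at any \<open>e\<close> between neighbouring members. The
  exponent 8 is this ratio's power 4, squared by the denominator.\<close>

lemma quotient_tendsto_of_sequence:
  fixes T :: "real \<Rightarrow> real"
  assumes mono: "\<And>a b. 0 < a \<Longrightarrow> a \<le> b \<Longrightarrow> T a \<le> T b" and pos: "\<And>a. 0 < a \<Longrightarrow> 0 \<le> T a"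
    and seq: "(\<lambda>m. T (1 / real m ^ 4) / (1 / real m ^ 4)\<^sup>2) \<longlonglongrightarrow> L"
  shows "((\<lambda>e. T e / e\<^sup>2) \<longlongrightarrow> L) (at_right 0)"
proof -
  \<comment> \<open>Chosen so that \<open>e\<close> lies between 1 / (N e + 1)^4 and 1 / (N e)^4
    whenever 0 < e < 1.\<close>
  define N where "N e = nat \<lfloor>e powr (-1/4)\<rfloor>" for e :: real
  have "filterlim (\<lambda>e::real. e powr (-1/4)) at_top (at_right 0)" by real_asymp
  then have Ninf: "filterlim N at_top (at_right 0)" unfolding N_def
    by (intro filterlim_compose[OF filterlim_nat_sequentially] filterlim_compose[OF filterlim_floor_sequentially])
  define q where "q m = T (1 / real m ^ 4) / (1 / real m ^ 4)\<^sup>2" for m :: nat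
  have 1: "(\<lambda>m. q m * (real (Suc m) / real m) ^ 8) \<longlonglongrightarrow> L"
  proof -
    have "(\<lambda>m. (real (Suc m) / real m) ^ 8) \<longlonglongrightarrow> 1" by real_asymp
    from tendsto_mult[OF seq this] show ?thesis unfolding q_def by simp
  qed
  have 2: "(\<lambda>m. q (Suc m) * (real m / real (Suc m)) ^ 8) \<longlonglongrightarrow> L"
  proof -
    have "(\<lambda>m. (real m / real (Suc m)) ^ 8) \<longlonglongrightarrow> 1" by real_asymp
    from tendsto_mult[OF LIMSEQ_Suc[OF seq] this] show ?thesis unfolding q_def by simp
  qed
  have bnd: "q (Suc (N e)) * (real (N e) / real (Suc (N e))) ^ 8 \<le> T e / e\<^sup>2 \<and>
     T e / e\<^sup>2 \<le> q (N e) * (real (Suc (N e)) / real (N e)) ^ 8" if e: "0 < e" "e < 1" for e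
  proof -
    let ?n = "N e"
    define x where "x = e powr (-1/4)"
    have x0: "x > 0" using e by (simp add: x_def)
    have "x ^ 4 = x powr 4" using x0 by (simp add: powr_numeral)
    also have "\<dots> = e powr (- 1)" unfolding x_def powr_powr by simp
    also have "\<dots> = 1 / e" using e by (simp add: powr_minus_divide)
    finally have x: "x > 0" "x ^ 4 = 1 / e" using x0 by auto
    have "x > 1"
    proof (rule ccontr)
      assume "\<not> x > 1"
      then have "x ^ 4 \<le> 1" using x by (intro power_le_one) auto
      then show False using x e by simp
    qed
    then have n: "?n \<ge> 1" "real ?n \<le> x" "x < real (Suc ?n)" unfolding N_def x_def[symmetric] by linarith+
    have a: "real ?n ^ 4 \<le> 1 / e" using n x(2) power_mono[of "real ?n" x 4] by simp
    have b: "1 / e \<le> real (Suc ?n) ^ 4" using n x power_mono[of x "real (Suc ?n)" 4] by simp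
    have a': "e \<le> 1 / real ?n ^ 4" using a e n by (simp add: field_simps)
    have b': "1 / real (Suc ?n) ^ 4 \<le> e" using b e by (simp add: field_simps del: of_nat_Suc)
    have "T e / e\<^sup>2 = T e * (1 / e)\<^sup>2" by (simp add: power_divide)
    also have "\<dots> \<le> T (1 / real ?n ^ 4) * (real (Suc ?n) ^ 4)\<^sup>2"
      using b e a' n by (intro mult_mono power_mono mono pos) auto
    also have "\<dots> = q ?n * (real (Suc ?n) / real ?n) ^ 8"
      using n by (simp add: q_def power_divide power_mult[symmetric] field_simps del: of_nat_Suc)
    finally have u: "T e / e\<^sup>2 \<le> q ?n * (real (Suc ?n) / real ?n) ^ 8" .
    have "q (Suc ?n) * (real ?n / real (Suc ?n)) ^ 8 = T (1 / real (Suc ?n) ^ 4) * (real ?n ^ 4)\<^sup>2"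
      using n by (simp add: q_def power_divide power_mult[symmetric] field_simps del: of_nat_Suc)
    also have "\<dots> \<le> T e * (1 / e)\<^sup>2"
      using a e b' n by (intro mult_mono power_mono mono pos) auto
    also have "\<dots> = T e / e\<^sup>2" by (simp add: power_divide)
    finally show ?thesis using u by simp
  qed
  have ev: "\<forall>\<^sub>F e in at_right (0::real). 0 < e \<and> e < 1"
    using eventually_at_right_less[of 0] eventually_at_right_real[of 0 1] by (auto elim!: eventually_mono simp: eventually_conj_iff)
  show ?thesis
    by (rule tendsto_sandwich[OF _ _ filterlim_compose[OF 2 Ninf] filterlim_compose[OF 1 Ninf]])
       (use ev bnd in \<open>auto elim!: eventually_mono\<close>)
qed

text \<open>A monotone density theorem: \<open>J\<close> plays the role of a derivative of \<open>T\<close>.\<close>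

lemma derivative_quotient_tendsto:
  fixes T J :: "real \<Rightarrow> real"
  assumes low: "\<And>a b. 0 < a \<Longrightarrow> a < b \<Longrightarrow> (b - a) * J a \<le> T b - T a"
    and up: "\<And>a b. 0 < a \<Longrightarrow> a < b \<Longrightarrow> T b - T a \<le> (b - a) * J b"
    and T: "((\<lambda>e. T e / e\<^sup>2) \<longlongrightarrow> L) (at_right 0)"
  shows "((\<lambda>e. J e / (2 * e)) \<longlongrightarrow> L) (at_right 0)"
proof -
  have scale: "((\<lambda>e. T (q * e) / (q * e)\<^sup>2) \<longlongrightarrow> L) (at_right 0)" if q: "q > 0" for q
  proof (rule filterlim_compose[OF T])
    show "filterlim (\<lambda>e. q * e) (at_right 0) (at_right 0)" using q by real_asymp
  qed
  \<comment> \<open>This is the difference quotient of \<open>T\<close> between \<open>e\<close> and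
    \<open>q * e\<close>, divided by 2 e. By \<open>low\<close> and \<open>up\<close> it bounds J e
    / (2 e) from above for q > 1 and from below for q < 1, and its limit L (q + 1) / 2 tends to L as
    q tends to 1.\<close>
  have D: "((\<lambda>e. (q\<^sup>2 * (T (q * e) / (q * e)\<^sup>2) - T e / e\<^sup>2) / (2 * (q - 1))) \<longlongrightarrow> L * (q + 1) / 2) (at_right 0)"
    if q: "q > 0" "q \<noteq> 1" for q
  proof -
    have "((\<lambda>e. (q\<^sup>2 * (T (q * e) / (q * e)\<^sup>2) - T e / e\<^sup>2) / (2 * (q - 1))) \<longlongrightarrow> (q\<^sup>2 * L - L) / (2 * (q - 1))) (at_right 0)"
      using q by (intro tendsto_intros scale T) auto
    moreover have "(q\<^sup>2 * L - L) / (2 * (q - 1)) = L * (q + 1) / 2"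
      using q by (simp add: field_simps power2_eq_square)
    ultimately show ?thesis by (simp only:)
  qed
  have eqD: "(q\<^sup>2 * (T (q * e) / (q * e)\<^sup>2) - T e / e\<^sup>2) / (2 * (q - 1)) = (T (q * e) - T e) / ((q * e - e) * (2 * e))"
    if "q > 0" "q \<noteq> 1" "e > 0" for q e
  proof -
    have 1: "q\<^sup>2 * (T (q * e) / (q * e)\<^sup>2) = T (q * e) / e\<^sup>2" using that by (simp add: power_mult_distrib)
    have 2: "(q * e - e) * (2 * e) = e\<^sup>2 * (2 * (q - 1))" by (simp add: algebra_simps power2_eq_square)
    show ?thesis unfolding 1 2 by (simp only: diff_divide_distrib[symmetric] divide_divide_eq_left)
  qed
  have ge: "J e / (2 * e) \<le> (q\<^sup>2 * (T (q * e) / (q * e)\<^sup>2) - T e / e\<^sup>2) / (2 * (q - 1))" if "q > 1" "e > 0" for q e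
  proof -
    have "(q * e - e) * J e \<le> T (q * e) - T e" using low[of e "q * e"] that by simp
    then have "(q * e - e) * J e / ((q * e - e) * (2 * e)) \<le> (T (q * e) - T e) / ((q * e - e) * (2 * e))"
      using that by (intro divide_right_mono) auto
    moreover have "q * e - e > 0" using that by simp
    ultimately show ?thesis using that eqD[of q e] by simp
  qed
  have le: "(q\<^sup>2 * (T (q * e) / (q * e)\<^sup>2) - T e / e\<^sup>2) / (2 * (q - 1)) \<le> J e / (2 * e)" if "0 < q" "q < 1" "e > 0" for q e
  proof -
    have "T e - T (q * e) \<le> (e - q * e) * J e" using up[of "q * e" e] that by simp
    then have "(T e - T (q * e)) / ((e - q * e) * (2 * e)) \<le> (e - q * e) * J e / ((e - q * e) * (2 * e))"
      using that by (intro divide_right_mono) (auto simp: mult_le_cancel_right1)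
    moreover have "e - q * e > 0" using that by simp
    moreover have "(T e - T (q * e)) / ((e - q * e) * (2 * e)) = (T (q * e) - T e) / ((q * e - e) * (2 * e))"
    proof -
      have "(e - q * e) * (2 * e) = - ((q * e - e) * (2 * e))" "T e - T (q * e) = - (T (q * e) - T e)"
        by (simp_all add: algebra_simps)
      then show ?thesis by (simp only: minus_divide_divide)
    qed
    ultimately show ?thesis using that eqD[of q e] by simp
  qed
  show ?thesis
  proof (rule order_tendstoI)
    fix a assume a: "a < L"
    have "((\<lambda>q. L * (q + 1) / 2) \<longlongrightarrow> L * (1 + 1) / 2) (at_left 1)" by (intro tendsto_intros) auto
    then have "\<forall>\<^sub>F q in at_left 1. a < L * (q + 1) / 2" using a by (intro order_tendstoD) auto
    moreover have "\<forall>\<^sub>F q in at_left (1::real). q \<in> {0<..<1}" by (intro eventually_at_left_real) simp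
    ultimately have "\<forall>\<^sub>F q in at_left (1::real). q \<in> {0<..<1} \<and> a < L * (q + 1) / 2" by (simp add: eventually_conj_iff)
    then obtain q where q: "0 < q" "q < 1" "a < L * (q + 1) / 2"
      using eventually_happens'[OF trivial_limit_at_left_real] by (auto simp: greaterThanLessThan_iff)
    show "\<forall>\<^sub>F e in at_right 0. a < J e / (2 * e)"
      using order_tendstoD(1)[OF D[OF q(1) less_imp_neq[OF q(2)]] q(3)] eventually_at_right_less[of 0]
      by eventually_elim (use q le[of q] in \<open>auto intro: less_le_trans\<close>)
  next
    fix a assume a: "L < a"
    have "((\<lambda>q. L * (q + 1) / 2) \<longlongrightarrow> L * (1 + 1) / 2) (at_right 1)" by (intro tendsto_intros) auto
    then have "\<forall>\<^sub>F q in at_right 1. L * (q + 1) / 2 < a" using a by (intro order_tendstoD) auto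
    moreover have "\<forall>\<^sub>F q in at_right (1::real). 1 < q" by (rule eventually_at_right_less)
    ultimately have "\<forall>\<^sub>F q in at_right (1::real). 1 < q \<and> L * (q + 1) / 2 < a" by (simp add: eventually_conj_iff)
    then obtain q where q: "1 < q" "L * (q + 1) / 2 < a"
      using eventually_happens'[OF trivial_limit_at_right_real] by auto
    show "\<forall>\<^sub>F e in at_right 0. J e / (2 * e) < a"
      using order_tendstoD(2)[OF D[OF order.strict_trans[OF zero_less_one q(1)] less_imp_neq[OF q(1), symmetric]] q(2)] eventually_at_right_less[of 0]
      by eventually_elim (use q ge[of q] in \<open>auto intro: le_less_trans\<close>)
  qed
qed

section \<open>A discrete Tanaka formula\<close>

lemma (in prob_space) expectation_abs_le_sqrt:
  fixes f :: "'a \<Rightarrow> real"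
  assumes [measurable]: "f \<in> borel_measurable M" and i: "integrable M (\<lambda>x. (f x)\<^sup>2)"
  shows "integrable M f" "expectation (\<lambda>x. \<bar>f x\<bar>) \<le> sqrt (expectation (\<lambda>x. (f x)\<^sup>2))"
proof -
  show f: "integrable M f"
    using i square_integrable_imp_integrable[of f] by simp
  have "0 \<le> variance (\<lambda>x. \<bar>f x\<bar>)" by (intro integral_nonneg_AE) simp
  then have "(expectation (\<lambda>x. \<bar>f x\<bar>))\<^sup>2 \<le> expectation (\<lambda>x. (f x)\<^sup>2)"
    using f i by (subst (asm) variance_eq) auto
  then show "expectation (\<lambda>x. \<bar>f x\<bar>) \<le> sqrt (expectation (\<lambda>x. (f x)\<^sup>2))"
    by (rule real_le_rsqrt)
qed

text \<open>The discrete counterpart of integrating x^(-1/2). It makes the expected time spent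
  within distance \<open>e\<close> of 0 of order \<open>e\<close>.\<close>

lemma sum_inverse_sqrt_le: "(\<Sum>j=1..n. 1 / sqrt (real j)) \<le> 2 * sqrt (real n)"
proof (induction n)
  case (Suc n)
  define a b where "a = sqrt (real n)" and "b = sqrt (real (Suc n))"
  have ab: "0 \<le> a" "0 < b" "b * b = a * a + 1" by (auto simp: a_def b_def)
  have "0 \<le> (b - a) * (b - a)" by simp
  then have "1 \<le> 2 * (b - a) * b" using ab(3) by (simp add: algebra_simps)
  then have "1 / b \<le> 2 * (b - a)" using ab by (simp add: pos_divide_le_eq)
  then show ?case using Suc by (simp add: a_def b_def)
qed simp

section \<open>Increments along the grid and their moments\<close>

context brownian_motion
begin

definition D :: "nat \<Rightarrow> nat \<Rightarrow> 'w \<Rightarrow> real" where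
  "D n j \<omega> = X (real (Suc j) / real n) \<omega> - X (real j / real n) \<omega>"

text \<open>The path at the grid points (\<open>W_eq\<close>), written as a partial sum so that it
  is visibly a function of the increments before step \<open>j\<close>, as the independence
  arguments require.\<close>

definition W :: "nat \<Rightarrow> nat \<Rightarrow> 'w \<Rightarrow> real" where
  "W n j \<omega> = (\<Sum>i<j. D n i \<omega>)"

lemma W_eq: "\<omega> \<in> space P \<Longrightarrow> W n j \<omega> = X (real j / real n) \<omega>"
  using sum_lessThan_telescope[of "\<lambda>i. X (real i / real n) \<omega>" j]
  by (simp add: W_def D_def X_0)

lemma D_measurable [measurable]: "D n j \<in> borel_measurable P"
  unfolding D_def by (intro borel_measurable_diff X_measurable) auto

lemma W_measurable [measurable]: "W n j \<in> borel_measurable P"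
  unfolding W_def by measurable

lemma W_Suc: "W n (Suc j) \<omega> = W n j \<omega> + D n j \<omega>"
  by (simp add: W_def)

lemma D_normal:
  assumes "n > 0"
  shows "distributed P lborel (D n j) (normal_density 0 (sqrt (1 / real n)))"
proof -
  have "real (Suc j) / real n - real j / real n = 1 / real n" by (simp add: diff_divide_distrib[symmetric])
  then show ?thesis using X_increment[of "real j / real n" "real (Suc j) / real n"] assms
    by (simp add: D_def[abs_def] divide_strict_right_mono)
qed

lemma D_indep: "indep_vars (\<lambda>_. borel) (D n) {..<m}"
  unfolding D_def[abs_def] using X_indep[of "\<lambda>i. real i / real n" m]
  by (simp add: mono_on_def divide_right_mono)

lemma D_integral:
  assumes n: "n > 0" and [measurable]: "g \<in> borel_measurable borel"
  shows "(\<integral>\<omega>. g (D n j \<omega>) \<partial>P) = (\<integral>x. normal_density 0 (sqrt (1 / real n)) x * g x \<partial>lborel)"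
    and "integrable P (\<lambda>\<omega>. g (D n j \<omega>)) \<longleftrightarrow> integrable lborel (\<lambda>x. normal_density 0 (sqrt (1 / real n)) x * g x)"
  using distributed_integral[OF D_normal[OF n], of g j] distributed_integrable[OF D_normal[OF n], of g j]
  by (simp_all)

lemma D_moments:
  assumes n: "n > 0"
  shows "integrable P (\<lambda>\<omega>. D n j \<omega> ^ k)" "integrable P (\<lambda>\<omega>. \<bar>D n j \<omega>\<bar> ^ k)"
    "(\<integral>\<omega>. D n j \<omega> \<partial>P) = 0" "(\<integral>\<omega>. (D n j \<omega>)\<^sup>2 \<partial>P) = 1 / real n" "(\<integral>\<omega>. D n j \<omega> ^ 4 \<partial>P) = 3 / (real n)\<^sup>2"
    "(\<integral>\<omega>. \<bar>D n j \<omega>\<bar> ^ 3 \<partial>P) \<le> 2 / (real n * sqrt (real n))"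
proof -
  let ?s = "sqrt (1 / real n)"
  have s: "?s > 0" "?s\<^sup>2 = 1 / real n" using n by simp_all
  show "integrable P (\<lambda>\<omega>. D n j \<omega> ^ k)"
    using D_integral(2)[OF n, of "\<lambda>x. x ^ k"] integrable_normal_moment[OF s(1), of 0 k] by simp
  show "integrable P (\<lambda>\<omega>. \<bar>D n j \<omega>\<bar> ^ k)"
    using D_integral(2)[OF n, of "\<lambda>x. \<bar>x\<bar> ^ k"] integrable_normal_moment_abs[OF s(1), of 0 k] by simp
  show "(\<integral>\<omega>. D n j \<omega> \<partial>P) = 0"
    using D_integral(1)[OF n, of "\<lambda>x. x"] integral_normal_moment_nz_1[OF s(1), of 0] by simp
  show "(\<integral>\<omega>. (D n j \<omega>)\<^sup>2 \<partial>P) = 1 / real n"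
    using D_integral(1)[OF n, of "\<lambda>x. x\<^sup>2"] integral_normal_moment_even[OF s(1), of 0 1] s n by (simp add: fact_2)
  show "(\<integral>\<omega>. D n j \<omega> ^ 4 \<partial>P) = 3 / (real n)\<^sup>2"
    using D_integral(1)[OF n, of "\<lambda>x. x ^ 4"] integral_normal_moment_even[OF s(1), of 0 2] s n
    by (simp add: fact_numeral power_divide power_mult_distrib field_simps power2_eq_square)
  have "sqrt (2 / pi) \<le> 1" using pi_ge_two by simp
  then have "2 * ?s ^ 3 * sqrt (2 / pi) \<le> 2 * ?s ^ 3 * 1" using s by (intro mult_left_mono) auto
  also have "\<dots> = 2 / (real n * sqrt (real n))"
    using n by (simp add: power3_eq_cube real_sqrt_divide)
  finally show "(\<integral>\<omega>. \<bar>D n j \<omega>\<bar> ^ 3 \<partial>P) \<le> 2 / (real n * sqrt (real n))"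
    using D_integral(1)[OF n, of "\<lambda>x. \<bar>x\<bar> ^ 3"] integral_normal_moment_abs_odd[OF s(1), of 0 1] by simp
qed

text \<open>Takes the place of conditioning on the past: \<open>F\<close> may be any measurable
  function of the first \<open>k\<close> increments, and the next increment factors out.\<close>

lemma D_indep_integral:
  fixes F :: "(nat \<Rightarrow> real) \<Rightarrow> 'c::{real_normed_field, banach, second_countable_topology}"
  assumes F: "F \<in> borel_measurable (PiM {..<k} (\<lambda>_. borel))" and g: "g \<in> borel_measurable borel"
    and i: "integrable P (\<lambda>\<omega>. F (\<lambda>i\<in>{..<k}. D n i \<omega>))" "integrable P (\<lambda>\<omega>. g (D n k \<omega>))"
  shows "(\<integral>\<omega>. F (\<lambda>i\<in>{..<k}. D n i \<omega>) * g (D n k \<omega>) \<partial>P) =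
      (\<integral>\<omega>. F (\<lambda>i\<in>{..<k}. D n i \<omega>) \<partial>P) * (\<integral>\<omega>. g (D n k \<omega>) \<partial>P)"
    "integrable P (\<lambda>\<omega>. F (\<lambda>i\<in>{..<k}. D n i \<omega>) * g (D n k \<omega>))"
proof -
  have "indep_var (PiM {..<k} (\<lambda>_. borel)) (\<lambda>\<omega>. \<lambda>i\<in>{..<k}. D n i \<omega>) (PiM {k} (\<lambda>_. borel)) (\<lambda>\<omega>. \<lambda>i\<in>{k}. D n i \<omega>)"
    by (rule indep_var_restrict[OF D_indep[of n "Suc k"]]) auto
  from indep_var_compose[OF this F, of "\<lambda>x. g (x k)" borel]
  have "indep_var borel (\<lambda>\<omega>. F (\<lambda>i\<in>{..<k}. D n i \<omega>)) borel (\<lambda>\<omega>. g (D n k \<omega>))"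
    using g by (auto simp: comp_def)
  then show "(\<integral>\<omega>. F (\<lambda>i\<in>{..<k}. D n i \<omega>) * g (D n k \<omega>) \<partial>P) =
      (\<integral>\<omega>. F (\<lambda>i\<in>{..<k}. D n i \<omega>) \<partial>P) * (\<integral>\<omega>. g (D n k \<omega>) \<partial>P)"
    "integrable P (\<lambda>\<omega>. F (\<lambda>i\<in>{..<k}. D n i \<omega>) * g (D n k \<omega>))"
    using indep_var_lebesgue_integral indep_var_integrable i by blast+
qed

text \<open>The summands are orthogonal: \<open>d (D n j)\<close> is centred and independent of
  everything before step \<open>j\<close>, so all cross terms vanish and each square contributes
  \<open>v\<close> times the expected square of \<open>h\<close>.\<close>

lemma martingale_second_moment:
  fixes h d :: "real \<Rightarrow> real"
  assumes [measurable]: "h \<in> borel_measurable borel" "d \<in> borel_measurable borel"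
    and h: "\<And>x. \<bar>h x\<bar> \<le> C"
    and d2: "\<And>j. integrable P (\<lambda>\<omega>. (d (D n j \<omega>))\<^sup>2)"
    and d0: "\<And>j. (\<integral>\<omega>. d (D n j \<omega>) \<partial>P) = 0" and v: "\<And>j. (\<integral>\<omega>. (d (D n j \<omega>))\<^sup>2 \<partial>P) = v"
  shows "integrable P (\<lambda>\<omega>. (\<Sum>j<m. h (W n j \<omega>) * d (D n j \<omega>))\<^sup>2) \<and>
    (\<integral>\<omega>. (\<Sum>j<m. h (W n j \<omega>) * d (D n j \<omega>))\<^sup>2 \<partial>P) = v * (\<Sum>j<m. \<integral>\<omega>. (h (W n j \<omega>))\<^sup>2 \<partial>P)"
proof (induction m)
  case (Suc m)
  define M where "M \<omega> = (\<Sum>j<m. h (W n j \<omega>) * d (D n j \<omega>))" for \<omega>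
  have [measurable]: "M \<in> borel_measurable P" unfolding M_def by measurable
  have IH: "integrable P (\<lambda>\<omega>. (M \<omega>)\<^sup>2)"
    "(\<integral>\<omega>. (M \<omega>)\<^sup>2 \<partial>P) = v * (\<Sum>j<m. \<integral>\<omega>. (h (W n j \<omega>))\<^sup>2 \<partial>P)"
    using Suc unfolding M_def by auto
  have C: "C \<ge> 0" using h[of 0] by linarith
  have d1: "integrable P (\<lambda>\<omega>. d (D n m \<omega>))" by (rule square_integrable_imp_integrable[OF _ d2]) measurable
  define S where "S j x = (\<Sum>i<j. x i)" for j and x :: "nat \<Rightarrow> real"
  define F where "F x = (\<Sum>j<m. h (S j x) * d (x j)) * h (S m x)" for x
  have comp[measurable]: "(\<lambda>x. x i) \<in> borel_measurable (PiM {..<m} (\<lambda>_. borel))" if "i < m" for i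
    using that by (intro measurable_component_singleton) auto
  have S_m: "S j \<in> borel_measurable (PiM {..<m} (\<lambda>_. borel))" if "j \<le> m" for j
    unfolding S_def using that by (intro borel_measurable_sum comp) auto
  have F_m: "F \<in> borel_measurable (PiM {..<m} (\<lambda>_. borel))"
    unfolding F_def
    by (intro borel_measurable_times borel_measurable_sum measurable_compose[OF S_m] measurable_compose[OF comp]) auto
  have F_eq: "F (\<lambda>i\<in>{..<m}. D n i \<omega>) = M \<omega> * h (W n m \<omega>)" for \<omega>
    unfolding F_def M_def S_def W_def by (intro arg_cong2[where f="(*)"] sum.cong arg_cong[where f=h]) auto
  have Mi: "integrable P M" by (rule square_integrable_imp_integrable[OF _ IH(1)]) measurable
  have Mh: "integrable P (\<lambda>\<omega>. M \<omega> * h (W n m \<omega>))"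
  proof (rule Bochner_Integration.integrable_bound[OF integrable_mult_right[OF Mi, of C]])
    show "AE \<omega> in P. norm (M \<omega> * h (W n m \<omega>)) \<le> norm (C * M \<omega>)"
      using mult_right_mono[OF h abs_ge_zero] C by (intro AE_I2) (simp add: abs_mult mult.commute[of "\<bar>M _\<bar>"])
  qed measurable
  have cross: "(\<integral>\<omega>. (M \<omega> * h (W n m \<omega>)) * d (D n m \<omega>) \<partial>P) = 0"
     "integrable P (\<lambda>\<omega>. (M \<omega> * h (W n m \<omega>)) * d (D n m \<omega>))"
    using D_indep_integral[OF F_m, of d n] Mh d1 d0 unfolding F_eq by auto
  define G where "G x = (h (S m x))\<^sup>2" for x
  have G_m: "G \<in> borel_measurable (PiM {..<m} (\<lambda>_. borel))"
    unfolding G_def by (intro borel_measurable_power measurable_compose[OF S_m]) auto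
  have G_eq: "G (\<lambda>i\<in>{..<m}. D n i \<omega>) = (h (W n m \<omega>))\<^sup>2" for \<omega>
    unfolding G_def S_def W_def by (intro arg_cong[where f="\<lambda>x. (h x)\<^sup>2"] sum.cong) auto
  have h2: "integrable P (\<lambda>\<omega>. (h (W n m \<omega>))\<^sup>2)"
    using power_mono[OF h abs_ge_zero, of _ 2] by (intro integrable_const_bound[of _ "C\<^sup>2"] AE_I2) (simp_all add: power2_abs)
  have sq: "(\<integral>\<omega>. (h (W n m \<omega>))\<^sup>2 * (d (D n m \<omega>))\<^sup>2 \<partial>P) = (\<integral>\<omega>. (h (W n m \<omega>))\<^sup>2 \<partial>P) * v"
     "integrable P (\<lambda>\<omega>. (h (W n m \<omega>))\<^sup>2 * (d (D n m \<omega>))\<^sup>2)"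
    using D_indep_integral[OF G_m, of "\<lambda>x. (d x)\<^sup>2" n] h2 d2 v unfolding G_eq by auto
  have eq: "(\<Sum>j<Suc m. h (W n j \<omega>) * d (D n j \<omega>))\<^sup>2 = (M \<omega>)\<^sup>2 + 2 * ((M \<omega> * h (W n m \<omega>)) * d (D n m \<omega>))
     + (h (W n m \<omega>))\<^sup>2 * (d (D n m \<omega>))\<^sup>2" for \<omega>
    by (simp add: M_def power2_eq_square algebra_simps)
  show ?case unfolding eq using IH cross sq by (simp add: distrib_left mult.commute[of _ v])
qed simp

text \<open>The normal density of variance \<open>t\<close> is at most 1 / (2 sqrt t), since pi is
  at least 2, and the interval has length 2 e.\<close>

lemma small_ball:
  assumes t: "t > 0" and e: "e > 0"
  shows "(\<integral>\<omega>. (if \<bar>X t \<omega>\<bar> < e then 1 else 0 :: real) \<partial>P) \<le> e / sqrt t"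
proof -
  have X: "distributed P lborel (\<lambda>\<omega>. X t \<omega> - X 0 \<omega>) (normal_density 0 (sqrt t))"
    using X_increment[of 0 t] t by simp
  have bd: "normal_density 0 (sqrt t) x \<le> 1 / (2 * sqrt t)" for x
  proof -
    have "2 * sqrt t \<le> sqrt (2 * pi * t)"
      using pi_ge_two t by (intro real_le_rsqrt) (auto simp: power_mult_distrib)
    then have "1 / sqrt (2 * pi * t) \<le> 1 / (2 * sqrt t)" using t by (intro divide_left_mono) auto
    moreover have "exp (- x\<^sup>2 / (2 * t)) \<le> 1" using t by simp
    ultimately have "1 / sqrt (2 * pi * t) * exp (- x\<^sup>2 / (2 * t)) \<le> 1 / (2 * sqrt t) * 1"
      using t by (intro mult_mono) auto
    then show ?thesis using t by (simp add: normal_density_def)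
  qed
  have "(\<integral>\<omega>. (if \<bar>X t \<omega>\<bar> < e then 1 else 0 :: real) \<partial>P) = (\<integral>\<omega>. indicator {-e<..<e} (X t \<omega> - X 0 \<omega>) \<partial>P)"
    by (intro Bochner_Integration.integral_cong) (auto simp: X_0 indicator_def)
  also have "\<dots> = (\<integral>x. normal_density 0 (sqrt t) x * indicator {-e<..<e} x \<partial>lborel)"
    by (rule distributed_integral[OF X, symmetric]) auto
  also have "\<dots> \<le> (\<integral>x. 1 / (2 * sqrt t) * indicator {-e<..<e} x \<partial>lborel)"
  proof (rule integral_mono)
    show "integrable lborel (\<lambda>x. normal_density 0 (sqrt t) x * indicator {-e<..<e} x)"
      using t by (intro integrable_real_mult_indicator) auto
    show "integrable lborel (\<lambda>x. 1 / (2 * sqrt t) * indicator {-e<..<e} x)"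
      using e by (intro integrable_mult_right integrable_real_indicator) auto
    show "normal_density 0 (sqrt t) x * indicator {- e<..<e} x \<le> 1 / (2 * sqrt t) * indicator {- e<..<e} x" for x
      using bd by (intro mult_right_mono) auto
  qed
  also have "\<dots> = e / sqrt t" using e by simp
  finally show ?thesis .
qed

text \<open>The walk starts at 0, so the term \<open>j = 0\<close> can only be bounded by 1; this is
  the summand 1 / n. The other terms are covered by \<open>small_ball\<close> and summed by
  \<open>sum_inverse_sqrt_le\<close>.\<close>

lemma occupation_bound:
  assumes n: "n > 0" and e: "e > 0" and m: "m \<le> n"
  shows "(1 / real n) * (\<Sum>j<m. \<integral>\<omega>. (if \<bar>W n j \<omega>\<bar> < e then 1 else 0 :: real) \<partial>P) \<le> 1 / real n + 2 * e"
proof -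
  have W: "(\<integral>\<omega>. (if \<bar>W n j \<omega>\<bar> < e then 1 else 0 :: real) \<partial>P) = (\<integral>\<omega>. (if \<bar>X (real j / real n) \<omega>\<bar> < e then 1 else 0 :: real) \<partial>P)" for j
    by (intro Bochner_Integration.integral_cong) (auto simp: W_eq)
  have p1: "(\<integral>\<omega>. (if \<bar>W n j \<omega>\<bar> < e then 1 else 0 :: real) \<partial>P) \<le> e * sqrt (real n) * (1 / sqrt (real j))" if "j \<ge> 1" for j
    using small_ball[of "real j / real n" e] that n e unfolding W by (simp add: real_sqrt_divide)
  have p0: "(\<integral>\<omega>. (if \<bar>W n j \<omega>\<bar> < e then 1 else 0 :: real) \<partial>P) \<le> 1" for j
    by (rule integral_le_const) (auto intro!: integrable_const_bound[of _ 1])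
  have nn: "0 \<le> (\<integral>\<omega>. (if \<bar>W n j \<omega>\<bar> < e then 1 else 0 :: real) \<partial>P)" for j by (intro integral_nonneg_AE) auto
  have "(\<Sum>j<m. \<integral>\<omega>. (if \<bar>W n j \<omega>\<bar> < e then 1 else 0 :: real) \<partial>P) \<le> (\<Sum>j<n. \<integral>\<omega>. (if \<bar>W n j \<omega>\<bar> < e then 1 else 0 :: real) \<partial>P)"
    using m nn by (intro sum_mono2) auto
  also have "{..<n} = insert 0 {1..<n}" using n by auto
  also have "(\<Sum>j\<in>insert 0 {1..<n}. \<integral>\<omega>. (if \<bar>W n j \<omega>\<bar> < e then 1 else 0 :: real) \<partial>P)
      \<le> 1 + (\<Sum>j=1..<n. e * sqrt (real n) * (1 / sqrt (real j)))"
    using p0 p1 by (subst sum.insert) (auto intro!: add_mono sum_mono)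
  also have "\<dots> = 1 + e * sqrt (real n) * (\<Sum>j=1..<n. 1 / sqrt (real j))" by (simp add: sum_distrib_left)
  also have "\<dots> \<le> 1 + e * sqrt (real n) * (2 * sqrt (real n))"
  proof -
    have "(\<Sum>j=1..<n. 1 / sqrt (real j)) \<le> (\<Sum>j=1..n. 1 / sqrt (real j))" by (intro sum_mono2) auto
    then show ?thesis using sum_inverse_sqrt_le[of n] e by (intro add_left_mono mult_left_mono) auto
  qed
  also have "\<dots> = 1 + 2 * e * real n" by simp
  finally have "(1 / real n) * (\<Sum>j<m. \<integral>\<omega>. (if \<bar>W n j \<omega>\<bar> < e then 1 else 0 :: real) \<partial>P) \<le> (1 / real n) * (1 + 2 * e * real n)"
    by (intro mult_left_mono) auto
  then show ?thesis using n by (simp add: algebra_simps)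
qed

text \<open>The nondecreasing part in the discrete Tanaka decomposition of \<open>\<bar>W\<bar>\<close>.\<close>

definition Lam :: "nat \<Rightarrow> nat \<Rightarrow> 'w \<Rightarrow> real" where
  "Lam n m \<omega> = \<bar>W n m \<omega>\<bar> - (\<Sum>j<m. sign (W n j \<omega>) * D n j \<omega>)"

text \<open>\<open>tent e / 2\<close> has mass 1, like the kernel in \<open>local_time0\<close>;
  this is the Riemann sum of the corresponding smoothed occupation integral.\<close>

definition Riem :: "real \<Rightarrow> nat \<Rightarrow> nat \<Rightarrow> 'w \<Rightarrow> real" where
  "Riem e n m \<omega> = (\<Sum>j<m. tent e (W n j \<omega>) / 2 / real n)"

lemma Lam_measurable [measurable]: "Lam n m \<in> borel_measurable P"
  unfolding Lam_def by measurable

lemma Riem_measurable [measurable]: "Riem e n m \<in> borel_measurable P"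
  unfolding Riem_def by measurable

lemma Riem_bounds:
  assumes "e > 0" "m \<le> n"
  shows "0 \<le> Riem e n m \<omega>" "Riem e n m \<omega> \<le> 1 / e"
proof -
  show "0 \<le> Riem e n m \<omega>" unfolding Riem_def using tent_bounds(1)[OF assms(1)] by (intro sum_nonneg) auto
  have "Riem e n m \<omega> \<le> (\<Sum>j<m. 1 / e / real n)"
    unfolding Riem_def using tent_bounds(2)[OF assms(1)] by (intro sum_mono divide_right_mono) (auto simp: field_simps)
  also have "\<dots> = (real m / real n) * (1 / e)" by simp
  also have "\<dots> \<le> 1 * (1 / e)" using assms by (intro mult_right_mono) (auto simp: divide_le_eq_1)
  finally show "Riem e n m \<omega> \<le> 1 / e" by simp
qed

text \<open>A discrete Ito formula for \<open>spline e\<close>. Its four errors are the replacement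
  of the absolute value at the endpoint (\<open>A\<close>), a martingale with integrand
  \<open>spline' - sign\<close> (\<open>B\<close>), the Taylor remainders (\<open>C\<close>) and the
  fluctuation of the squared increments about 1 / n (\<open>E\<close>). \<open>A\<close> gives 8 e,
  \<open>B\<close> the square root, and \<open>C\<close> and \<open>E\<close> the terms that vanish
  as n grows with e fixed.\<close>

lemma Lam_Riem_bound:
  assumes n: "n > 0" and e: "e > 0" and m: "m \<le> n"
  shows "integrable P (Lam n m)"
    "(\<integral>\<omega>. \<bar>Lam n m \<omega> - Riem e n m \<omega>\<bar> \<partial>P) \<le>
      8 * e + 2 * sqrt (2 * e + 1 / real n) + (2 / e\<^sup>2 + 2 / e) / sqrt (real n)"
proof -
  define A where "A \<omega> = \<bar>W n m \<omega>\<bar> - spline e (W n m \<omega>) + spline e 0" for \<omega>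
  define B where "B \<omega> = (\<Sum>j<m. (spline' e (W n j \<omega>) - sign (W n j \<omega>)) * D n j \<omega>)" for \<omega>
  define C where "C \<omega> = (\<Sum>j<m. spline e (W n (Suc j) \<omega>) - spline e (W n j \<omega>) - spline' e (W n j \<omega>) * D n j \<omega>
     - tent e (W n j \<omega>) / 2 * (D n j \<omega>)\<^sup>2)" for \<omega>
  define E where "E \<omega> = (\<Sum>j<m. (tent e (W n j \<omega>) / 2) * ((D n j \<omega>)\<^sup>2 - 1 / real n))" for \<omega>
  have [measurable]: "A \<in> borel_measurable P" "B \<in> borel_measurable P" "C \<in> borel_measurable P" "E \<in> borel_measurable P"
    unfolding A_def B_def C_def E_def by measurable
  have W0: "W n 0 \<omega> = 0" for \<omega> by (simp add: W_def)
  have decomp: "Lam n m \<omega> - Riem e n m \<omega> = A \<omega> + B \<omega> + C \<omega> + E \<omega>" for \<omega>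
  proof -
    have "C \<omega> = (spline e (W n m \<omega>) - spline e 0) - (\<Sum>j<m. spline' e (W n j \<omega>) * D n j \<omega>)
        - (\<Sum>j<m. tent e (W n j \<omega>) / 2 * (D n j \<omega>)\<^sup>2)"
      unfolding C_def sum_subtractf using sum_lessThan_telescope[of "\<lambda>j. spline e (W n j \<omega>)" m] by (simp add: W0 sum_subtractf)
    moreover have "B \<omega> = (\<Sum>j<m. spline' e (W n j \<omega>) * D n j \<omega>) - (\<Sum>j<m. sign (W n j \<omega>) * D n j \<omega>)"
      unfolding B_def by (simp add: left_diff_distrib sum_subtractf)
    moreover have "E \<omega> = (\<Sum>j<m. tent e (W n j \<omega>) / 2 * (D n j \<omega>)\<^sup>2) - Riem e n m \<omega>"
      unfolding E_def Riem_def by (simp add: right_diff_distrib sum_subtractf)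
    ultimately show ?thesis by (simp add: A_def Lam_def)
  qed
  have A: "\<bar>A \<omega>\<bar> \<le> 8 * e" for \<omega>
    using spline_abs[OF e, of "W n m \<omega>"] spline_abs[OF e, of 0] unfolding A_def by simp
  have Ai: "integrable P A" using A by (intro integrable_const_bound[of _ "8 * e"]) auto
  have AE: "(\<integral>\<omega>. \<bar>A \<omega>\<bar> \<partial>P) \<le> 8 * e" using A Ai by (intro integral_le_const) auto
  \<comment> \<open>Bounded by 2 and zero outside (-e, e), so the second moment of \<open>B\<close>
    is at most four times the expected occupation time of (-e, e), hence of order e + 1 / n.\<close>
  define h where "h x = spline' e x - sign x" for x
  have h: "\<bar>h x\<bar> \<le> 2" "(h x)\<^sup>2 \<le> 4 * (if \<bar>x\<bar> < e then 1 else 0 :: real)" for x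
  proof -
    show "\<bar>h x\<bar> \<le> 2" using spline'_sign[OF e, of x] unfolding h_def by (auto split: if_splits)
    show "(h x)\<^sup>2 \<le> 4 * (if \<bar>x\<bar> < e then 1 else 0 :: real)"
      using spline'_sign[OF e, of x] power_mono[of "\<bar>h x\<bar>" 2 2] unfolding h_def by (auto split: if_splits)
  qed
  have [measurable]: "h \<in> borel_measurable borel" unfolding h_def by measurable
  have B: "integrable P (\<lambda>\<omega>. (B \<omega>)\<^sup>2)" "(\<integral>\<omega>. (B \<omega>)\<^sup>2 \<partial>P) = 1 / real n * (\<Sum>j<m. \<integral>\<omega>. (h (W n j \<omega>))\<^sup>2 \<partial>P)"
  proof -
    have "integrable P (\<lambda>\<omega>. (\<Sum>j<m. h (W n j \<omega>) * D n j \<omega>)\<^sup>2) \<and>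
      (\<integral>\<omega>. (\<Sum>j<m. h (W n j \<omega>) * D n j \<omega>)\<^sup>2 \<partial>P) = 1 / real n * (\<Sum>j<m. \<integral>\<omega>. (h (W n j \<omega>))\<^sup>2 \<partial>P)"
      by (rule martingale_second_moment[where d="\<lambda>x. x" and C=2, OF _ _ h(1) D_moments(1,3,4)[OF n]]) simp_all
    then show "integrable P (\<lambda>\<omega>. (B \<omega>)\<^sup>2)" "(\<integral>\<omega>. (B \<omega>)\<^sup>2 \<partial>P) = 1 / real n * (\<Sum>j<m. \<integral>\<omega>. (h (W n j \<omega>))\<^sup>2 \<partial>P)"
      unfolding B_def h_def by blast+
  qed
  have "(\<Sum>j<m. \<integral>\<omega>. (h (W n j \<omega>))\<^sup>2 \<partial>P) \<le> (\<Sum>j<m. \<integral>\<omega>. 4 * (if \<bar>W n j \<omega>\<bar> < e then 1 else 0 :: real) \<partial>P)"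
  proof (intro sum_mono integral_mono)
    show "integrable P (\<lambda>\<omega>. (h (W n j \<omega>))\<^sup>2)" for j
      using power_mono[OF h(1) abs_ge_zero, of _ 2] by (intro integrable_const_bound[of _ "4"] AE_I2) (simp_all add: power2_abs)
    show "integrable P (\<lambda>\<omega>. 4 * (if \<bar>W n j \<omega>\<bar> < e then 1 else 0 :: real))" for j
      by (intro integrable_const_bound[of _ "4"]) auto
  qed (rule h)
  also have "\<dots> = 4 * (\<Sum>j<m. \<integral>\<omega>. (if \<bar>W n j \<omega>\<bar> < e then 1 else 0 :: real) \<partial>P)" by (simp add: sum_distrib_left)
  finally have "(\<integral>\<omega>. (B \<omega>)\<^sup>2 \<partial>P) \<le> 1 / real n * (4 * (\<Sum>j<m. \<integral>\<omega>. (if \<bar>W n j \<omega>\<bar> < e then 1 else 0 :: real) \<partial>P))"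
    unfolding B(2) by (intro mult_left_mono) auto
  also have "\<dots> \<le> 4 * (2 * e + 1 / real n)" using occupation_bound[OF n e m] by simp
  finally have "sqrt (\<integral>\<omega>. (B \<omega>)\<^sup>2 \<partial>P) \<le> sqrt (4 * (2 * e + 1 / real n))" by simp
  also have "\<dots> = 2 * sqrt (2 * e + 1 / real n)" by (simp only: real_sqrt_mult real_sqrt_four)
  finally have BE: "(\<integral>\<omega>. \<bar>B \<omega>\<bar> \<partial>P) \<le> 2 * sqrt (2 * e + 1 / real n)"
    using expectation_abs_le_sqrt(2)[OF _ B(1)] by simp
  have Bi: "integrable P B" using expectation_abs_le_sqrt(1)[OF _ B(1)] by simp
  have Cb: "\<bar>C \<omega>\<bar> \<le> (\<Sum>j<m. \<bar>D n j \<omega>\<bar> ^ 3 / e\<^sup>2)" for \<omega>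
    unfolding C_def
  proof (intro order_trans[OF sum_abs] sum_mono)
    fix j
    have "W n (Suc j) \<omega> - W n j \<omega> = D n j \<omega>" by (simp add: W_Suc)
    then show "\<bar>spline e (W n (Suc j) \<omega>) - spline e (W n j \<omega>) - spline' e (W n j \<omega>) * D n j \<omega>
     - tent e (W n j \<omega>) / 2 * (D n j \<omega>)\<^sup>2\<bar> \<le> \<bar>D n j \<omega>\<bar> ^ 3 / e\<^sup>2"
      using spline_taylor[OF e, of "W n (Suc j) \<omega>" "W n j \<omega>"] by simp
  qed
  have Cbi: "integrable P (\<lambda>\<omega>. \<Sum>j<m. \<bar>D n j \<omega>\<bar> ^ 3 / e\<^sup>2)" using D_moments(2)[OF n] by auto
  have Ci: "integrable P C"
    by (intro Bochner_Integration.integrable_bound[OF Cbi])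
       (simp_all only: real_norm_def order_trans[OF Cb abs_ge_self] AE_I2, measurable)
  have "(\<integral>\<omega>. \<bar>C \<omega>\<bar> \<partial>P) \<le> (\<integral>\<omega>. (\<Sum>j<m. \<bar>D n j \<omega>\<bar> ^ 3 / e\<^sup>2) \<partial>P)"
    by (rule integral_mono[OF integrable_abs[OF Ci] Cbi Cb])
  also have "\<dots> = (\<Sum>j<m. (\<integral>\<omega>. \<bar>D n j \<omega>\<bar> ^ 3 \<partial>P) / e\<^sup>2)" using D_moments(2)[OF n] by simp
  also have "\<dots> \<le> (\<Sum>j<m. 2 / (real n * sqrt (real n)) / e\<^sup>2)"
    using D_moments(6)[OF n] by (intro sum_mono divide_right_mono) auto
  also have "\<dots> = real m * (2 / (real n * sqrt (real n)) / e\<^sup>2)" by simp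
  also have "\<dots> \<le> real n * (2 / (real n * sqrt (real n)) / e\<^sup>2)" using m by (intro mult_right_mono) auto
  also have "\<dots> = 2 / e\<^sup>2 / sqrt (real n)" using n by simp
  finally have CE: "(\<integral>\<omega>. \<bar>C \<omega>\<bar> \<partial>P) \<le> 2 / e\<^sup>2 / sqrt (real n)" .
  \<comment> \<open>The variance of the square of a centred normal variable of variance 1 / n,
    computed from its fourth moment 3 / n^2.\<close>
  have v: "integrable P (\<lambda>\<omega>. ((D n j \<omega>)\<^sup>2 - 1 / real n)\<^sup>2)" "(\<integral>\<omega>. ((D n j \<omega>)\<^sup>2 - 1 / real n)\<^sup>2 \<partial>P) = 2 / (real n)\<^sup>2" for j
  proof -
    have eq: "((D n j \<omega>)\<^sup>2 - 1 / real n)\<^sup>2 = D n j \<omega> ^ 4 - 2 / real n * (D n j \<omega>)\<^sup>2 + 1 / (real n)\<^sup>2" for \<omega>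
      by (simp add: power2_eq_square power4_eq_xxxx algebra_simps)
    show "integrable P (\<lambda>\<omega>. ((D n j \<omega>)\<^sup>2 - 1 / real n)\<^sup>2)" unfolding eq using D_moments(1)[OF n] by auto
    show "(\<integral>\<omega>. ((D n j \<omega>)\<^sup>2 - 1 / real n)\<^sup>2 \<partial>P) = 2 / (real n)\<^sup>2"
    proof -
      have "(\<integral>\<omega>. D n j \<omega> ^ 4 - 2 / real n * (D n j \<omega>)\<^sup>2 + 1 / (real n)\<^sup>2 \<partial>P) =
          (\<integral>\<omega>. D n j \<omega> ^ 4 \<partial>P) - 2 / real n * (\<integral>\<omega>. (D n j \<omega>)\<^sup>2 \<partial>P) + 1 / (real n)\<^sup>2"
        using D_moments(1)[OF n, of j 4] D_moments(1)[OF n, of j 2] by (simp add: prob_space)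
      then show ?thesis unfolding eq D_moments(4,5)[OF n] by (simp add: field_simps power2_eq_square)
    qed
  qed
  have tb: "\<bar>tent e x / 2\<bar> \<le> 1 / e" for x using tent_bounds[OF e, of x] by simp
  have E: "integrable P (\<lambda>\<omega>. (E \<omega>)\<^sup>2)" "(\<integral>\<omega>. (E \<omega>)\<^sup>2 \<partial>P) = 2 / (real n)\<^sup>2 * (\<Sum>j<m. \<integral>\<omega>. (tent e (W n j \<omega>) / 2)\<^sup>2 \<partial>P)"
  proof -
    have z: "(\<integral>\<omega>. (D n j \<omega>)\<^sup>2 - 1 / real n \<partial>P) = 0" for j
      using D_moments(1)[OF n, of j 2] D_moments(4)[OF n, of j] by (simp add: prob_space)
    have "integrable P (\<lambda>\<omega>. (\<Sum>j<m. (tent e (W n j \<omega>) / 2) * ((D n j \<omega>)\<^sup>2 - 1 / real n))\<^sup>2) \<and>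
      (\<integral>\<omega>. (\<Sum>j<m. (tent e (W n j \<omega>) / 2) * ((D n j \<omega>)\<^sup>2 - 1 / real n))\<^sup>2 \<partial>P) =
        2 / (real n)\<^sup>2 * (\<Sum>j<m. \<integral>\<omega>. (tent e (W n j \<omega>) / 2)\<^sup>2 \<partial>P)"
      by (rule martingale_second_moment[where h="\<lambda>x. tent e x / 2" and d="\<lambda>x. x\<^sup>2 - 1 / real n" and C="1 / e", OF _ _ tb v(1) z v(2)])
         simp_all
    then show "integrable P (\<lambda>\<omega>. (E \<omega>)\<^sup>2)" "(\<integral>\<omega>. (E \<omega>)\<^sup>2 \<partial>P) = 2 / (real n)\<^sup>2 * (\<Sum>j<m. \<integral>\<omega>. (tent e (W n j \<omega>) / 2)\<^sup>2 \<partial>P)"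
      unfolding E_def by blast+
  qed
  have tb2: "(tent e x / 2)\<^sup>2 \<le> (1 / e)\<^sup>2" for x using power_mono[OF tb abs_ge_zero, of x 2] unfolding power2_abs .
  have "(\<Sum>j<m. \<integral>\<omega>. (tent e (W n j \<omega>) / 2)\<^sup>2 \<partial>P) \<le> (\<Sum>j<m. (1 / e)\<^sup>2)"
  proof (intro sum_mono integral_le_const)
    show "integrable P (\<lambda>\<omega>. (tent e (W n j \<omega>) / 2)\<^sup>2)" for j
      using tb2 by (intro integrable_const_bound[of _ "(1/e)\<^sup>2"]) auto
  qed (use tb2 in auto)
  also have "\<dots> = real m * (1 / e)\<^sup>2" by simp
  also have "\<dots> \<le> real n * (1 / e)\<^sup>2" using m by (intro mult_right_mono) auto
  finally have "(\<integral>\<omega>. (E \<omega>)\<^sup>2 \<partial>P) \<le> 2 / (real n)\<^sup>2 * (real n * (1 / e)\<^sup>2)"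
    unfolding E(2) by (intro mult_left_mono) auto
  also have "\<dots> \<le> (2 / e / sqrt (real n))\<^sup>2"
  proof -
    have "2 / (real n)\<^sup>2 * (real n * (1 / e)\<^sup>2) = 2 / (e\<^sup>2 * real n)"
      using n by (simp add: power2_eq_square)
    also have "\<dots> \<le> 4 / (e\<^sup>2 * real n)" using n e by (intro divide_right_mono) auto
    also have "\<dots> = (2 / e / sqrt (real n))\<^sup>2" by (simp add: power_divide power_mult_distrib)
    finally show ?thesis .
  qed
  finally have "sqrt (\<integral>\<omega>. (E \<omega>)\<^sup>2 \<partial>P) \<le> sqrt ((2 / e / sqrt (real n))\<^sup>2)" by (rule real_sqrt_le_mono)
  also have "\<dots> = 2 / e / sqrt (real n)" using e by (simp only: real_sqrt_abs) simp
  finally have EE: "(\<integral>\<omega>. \<bar>E \<omega>\<bar> \<partial>P) \<le> 2 / e / sqrt (real n)"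
    using expectation_abs_le_sqrt(2)[OF _ E(1)] by simp
  have Ei: "integrable P E" using expectation_abs_le_sqrt(1)[OF _ E(1)] by simp
  have Ri: "integrable P (Riem e n m)" using Riem_bounds[OF e m] by (intro integrable_const_bound[of _ "1/e"]) auto
  have "Lam n m = (\<lambda>\<omega>. Riem e n m \<omega> + (A \<omega> + B \<omega> + C \<omega> + E \<omega>))" using decomp by (auto simp: fun_eq_iff algebra_simps)
  then show "integrable P (Lam n m)" using Ri Ai Bi Ci Ei by simp
  have "(\<integral>\<omega>. \<bar>Lam n m \<omega> - Riem e n m \<omega>\<bar> \<partial>P) \<le> (\<integral>\<omega>. \<bar>A \<omega>\<bar> + \<bar>B \<omega>\<bar> + \<bar>C \<omega>\<bar> + \<bar>E \<omega>\<bar> \<partial>P)"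
    unfolding decomp
    by (rule integral_mono) (use Ai Bi Ci Ei in \<open>auto intro!: Bochner_Integration.integrable_add integrable_abs\<close>)
  also have "\<dots> = (\<integral>\<omega>. \<bar>A \<omega>\<bar> \<partial>P) + (\<integral>\<omega>. \<bar>B \<omega>\<bar> \<partial>P) + (\<integral>\<omega>. \<bar>C \<omega>\<bar> \<partial>P) + (\<integral>\<omega>. \<bar>E \<omega>\<bar> \<partial>P)"
    using Ai Bi Ci Ei by simp
  also have "\<dots> \<le> 8 * e + 2 * sqrt (2 * e + 1 / real n) + (2 / e\<^sup>2 + 2 / e) / sqrt (real n)"
    using AE BE CE EE by (simp add: add_divide_distrib)
  finally show "(\<integral>\<omega>. \<bar>Lam n m \<omega> - Riem e n m \<omega>\<bar> \<partial>P) \<le>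
      8 * e + 2 * sqrt (2 * e + 1 / real n) + (2 / e\<^sup>2 + 2 / e) / sqrt (real n)" .
qed

end

section \<open>Existence of the local time\<close>

text \<open>Nothing is known about \<open>y\<close> off the interval, where the set {r. \<bar>y
  r\<bar> < e} may fail to be measurable; hence the truncation by an indicator before measurability
  is claimed.\<close>

lemma set_integrable_occupation:
  fixes y :: "real \<Rightarrow> real"
  assumes y: "continuous_on {0..s} y"
  shows "set_integrable lborel {0..s} (\<lambda>r. indicator {r. \<bar>y r\<bar> < e} r :: real)"
proof -
  have ym: "(\<lambda>r. indicator {0..s} r *\<^sub>R y r) \<in> borel_measurable borel"
    using borel_measurable_continuous_on_indicator[OF _ y] by simp
  have Jm: "(\<lambda>r. indicator {0..s} r *\<^sub>R (indicator {r. \<bar>y r\<bar> < e} r :: real)) \<in> borel_measurable borel"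
  proof -
    have "(\<lambda>r. indicator {0..s} r *\<^sub>R (if \<bar>indicator {0..s} r *\<^sub>R y r\<bar> < e then 1 else 0 :: real)) \<in> borel_measurable borel"
      using ym by measurable
    also have "(\<lambda>r. indicator {0..s} r *\<^sub>R (if \<bar>indicator {0..s} r *\<^sub>R y r\<bar> < e then 1 else 0 :: real)) =
        (\<lambda>r. indicator {0..s} r *\<^sub>R (indicator {r. \<bar>y r\<bar> < e} r :: real))"
      by (auto simp: indicator_def)
    finally show ?thesis .
  qed
  show ?thesis
    unfolding set_integrable_def
  proof (rule Bochner_Integration.integrable_bound[of _ "indicator {0..s} :: real \<Rightarrow> real"])
    show "integrable lborel (indicator {0..s} :: real \<Rightarrow> real)"
      by (rule integrable_real_indicator) (auto simp: emeasure_lborel_Icc_eq)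
  qed (use Jm in \<open>auto simp: indicator_def\<close>)
qed

text \<open>The integral \<open>T e\<close> of max 0 (e - \<bar>y\<bar>) is a primitive in
  \<open>e\<close> of the occupation time \<open>J e\<close>, and the tent averages are T e / e^2.
  Convergence along one sequence extends to all \<open>e\<close> because \<open>T\<close> is
  monotone, and then passes to the derivative because \<open>J\<close> is monotone.\<close>

lemma occupation_limit:
  fixes y :: "real \<Rightarrow> real"
  assumes y: "continuous_on {0..s} y"
    and L: "(\<lambda>k. LINT r:{0..s}|lborel. tent (1 / real (Suc k) ^ 4) (y r) / 2) \<longlonglongrightarrow> L"
  shows "((\<lambda>e. 1 / (2 * e) * (LINT r:{0..s}|lborel. indicator {r. \<bar>y r\<bar> < e} r)) \<longlongrightarrow> L) (at_right 0)"
proof -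
  define T where "T e = (LINT r:{0..s}|lborel. max 0 (e - \<bar>y r\<bar>))" for e
  define J where "J e = (LINT r:{0..s}|lborel. indicator {r. \<bar>y r\<bar> < e} r :: real)" for e
  have Ti: "set_integrable lborel {0..s} (\<lambda>r. max 0 (e - \<bar>y r\<bar>))" for e
    by (intro borel_integrable_atLeastAtMost' continuous_intros y)
  have Ji: "set_integrable lborel {0..s} (\<lambda>r. indicator {r. \<bar>y r\<bar> < e} r :: real)" for e
    by (rule set_integrable_occupation[OF y])
  have mono: "T a \<le> T b" if "a \<le> b" for a b
    unfolding T_def by (intro set_integral_mono Ti) (use that in auto)
  have pos: "0 \<le> T a" for a unfolding T_def set_lebesgue_integral_def by (rule Bochner_Integration.integral_nonneg) simp
  have low: "(b - a) * J a \<le> T b - T a" if "0 < a" "a < b" for a b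
    unfolding J_def T_def set_integral_mult_right[symmetric] set_integral_diff(2)[OF Ti Ti, symmetric]
    by (rule set_integral_mono[OF set_integrable_mult_right set_integral_diff(1)[OF Ti Ti]])
       (use that Ji in \<open>auto simp: indicator_def\<close>)
  have up: "T b - T a \<le> (b - a) * J b" if "0 < a" "a < b" for a b
    unfolding J_def T_def set_integral_mult_right[symmetric] set_integral_diff(2)[OF Ti Ti, symmetric]
    by (rule set_integral_mono[OF set_integral_diff(1)[OF Ti Ti] set_integrable_mult_right])
       (use that Ji in \<open>auto simp: indicator_def\<close>)
  have TA: "(LINT r:{0..s}|lborel. tent e (y r) / 2) = T e / e\<^sup>2" for e
  proof -
    have "tent e (y r) / 2 = max 0 (e - \<bar>y r\<bar>) / e\<^sup>2" for r by (simp add: tent_def)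
    then show ?thesis unfolding T_def by (simp only: set_integral_divide_zero)
  qed
  have "(\<lambda>m. T (1 / real m ^ 4) / (1 / real m ^ 4)\<^sup>2) \<longlonglongrightarrow> L"
    using L unfolding TA by (rule LIMSEQ_imp_Suc)
  then have "((\<lambda>e. T e / e\<^sup>2) \<longlongrightarrow> L) (at_right 0)"
    using mono pos by (intro quotient_tendsto_of_sequence) auto
  from derivative_quotient_tendsto[OF low up this]
  show ?thesis unfolding J_def by simp
qed

context brownian_motion
begin

definition Aint :: "real \<Rightarrow> real \<Rightarrow> 'w \<Rightarrow> real" where
  "Aint s e \<omega> = (LINT r:{0..s}|lborel. tent e (X r \<omega>) / 2)"

lemma Riem_tendsto:
  assumes "\<omega> \<in> space P" "0 \<le> s" "s \<le> 1"
  shows "(\<lambda>n. Riem e n (nat \<lfloor>real n * s\<rfloor>) \<omega>) \<longlonglongrightarrow> Aint s e \<omega>"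
proof -
  have "continuous_on {0..1} (\<lambda>r. tent e (X r \<omega>) / 2)"
    by (intro continuous_intros continuous_on_compose2[OF continuous_tent continuous_on_subset[OF X_continuous[OF assms(1)]]]) auto
  from riemann_sum_tendsto[OF this assms(2,3)]
  show ?thesis unfolding Aint_def Riem_def using assms(1) by (simp add: W_eq)
qed

lemma Aint_measurable: "0 \<le> s \<Longrightarrow> s \<le> 1 \<Longrightarrow> Aint s e \<in> borel_measurable P"
  by (rule borel_measurable_LIMSEQ_real[OF Riem_tendsto]) auto

lemma Aint_bounds:
  assumes "\<omega> \<in> space P" "0 \<le> s" "s \<le> 1" "e > 0"
  shows "0 \<le> Aint s e \<omega>" "Aint s e \<omega> \<le> 1 / e"
  using LIMSEQ_le_const[OF Riem_tendsto[OF assms(1-3), of e], of 0]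
    LIMSEQ_le_const2[OF Riem_tendsto[OF assms(1-3), of e], of "1 / e"]
    Riem_bounds[OF assms(4) grid_floor(3)[OF assms(2,3)]] by auto

lemma Aint_integrable: "0 \<le> s \<Longrightarrow> s \<le> 1 \<Longrightarrow> e > 0 \<Longrightarrow> integrable P (Aint s e)"
  using Aint_bounds Aint_measurable by (intro integrable_const_bound[of _ "1 / e"]) auto

text \<open>For fixed \<open>e\<close> the terms with sqrt n disappear and 8 e + 2 sqrt (2 e)
  remains, which is at most 11 sqrt e by e \<le> sqrt e and sqrt 2 \<le> 3/2. The constant 12 leaves
  the strict gap needed for an eventual bound.\<close>

lemma Lam_Aint:
  assumes s: "0 \<le> s" "s \<le> 1" and e: "0 < e" "e \<le> 1"
  shows "\<forall>\<^sub>F n in sequentially. (\<integral>\<omega>. \<bar>Lam n (nat \<lfloor>real n * s\<rfloor>) \<omega> - Aint s e \<omega>\<bar> \<partial>P) \<le> 12 * sqrt e"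
proof -
  note m = grid_floor(3)[OF s]
  let ?k = "\<lambda>n. nat \<lfloor>real n * s\<rfloor>"
  have [measurable]: "Aint s e \<in> borel_measurable P" using Aint_measurable s by simp
  have "(\<lambda>n. \<integral>\<omega>. \<bar>Riem e n (?k n) \<omega> - Aint s e \<omega>\<bar> \<partial>P) \<longlonglongrightarrow> (\<integral>\<omega>. 0 \<partial>P)"
  proof (rule integral_dominated_convergence[where w="\<lambda>_. 1 / e"])
    show "AE \<omega> in P. (\<lambda>n. \<bar>Riem e n (?k n) \<omega> - Aint s e \<omega>\<bar>) \<longlonglongrightarrow> 0"
      using tendsto_rabs_zero[OF LIM_zero[OF Riem_tendsto[OF _ s]]] by auto
    show "AE \<omega> in P. norm \<bar>Riem e n (?k n) \<omega> - Aint s e \<omega>\<bar> \<le> 1 / e" for n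
    proof (rule AE_I2)
      fix \<omega> assume "\<omega> \<in> space P"
      then show "norm \<bar>Riem e n (?k n) \<omega> - Aint s e \<omega>\<bar> \<le> 1 / e"
        using Aint_bounds[OF _ s e(1), of \<omega>] Riem_bounds[OF e(1) m[of n], of \<omega>] by simp
    qed
  qed auto
  moreover have "(\<lambda>n. 8 * e + 2 * sqrt (2 * e + 1 / real n) + (2 / e\<^sup>2 + 2 / e) / sqrt (real n)) \<longlonglongrightarrow> 8 * e + 2 * sqrt (2 * e + 0) + (2 / e\<^sup>2 + 2 / e) * 0"
    unfolding divide_inverse[of _ "sqrt _"]
    by (intro tendsto_intros lim_1_over_n tendsto_inverse_0_at_top
         filterlim_compose[OF sqrt_at_top filterlim_real_sequentially])
  ultimately have "(\<lambda>n. (8 * e + 2 * sqrt (2 * e + 1 / real n) + (2 / e\<^sup>2 + 2 / e) / sqrt (real n)) +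
     (\<integral>\<omega>. \<bar>Riem e n (?k n) \<omega> - Aint s e \<omega>\<bar> \<partial>P)) \<longlonglongrightarrow> (8 * e + 2 * sqrt (2 * e + 0) + (2 / e\<^sup>2 + 2 / e) * 0) + 0"
    by (intro tendsto_add[of "\<lambda>n. 8 * e + 2 * sqrt (2 * e + 1 / real n) + (2 / e\<^sup>2 + 2 / e) / sqrt (real n)"]) simp_all
  moreover have "(8 * e + 2 * sqrt (2 * e + 0) + (2 / e\<^sup>2 + 2 / e) * 0) + 0 < 12 * sqrt e"
  proof -
    have "e = sqrt e * sqrt e" using e by simp
    also have "\<dots> \<le> sqrt e * 1" using e by (intro mult_left_mono) auto
    finally have "8 * e \<le> 8 * sqrt e" by simp
    moreover have "sqrt (2 * e) \<le> 3/2 * sqrt e" unfolding real_sqrt_mult using e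
      by (intro mult_right_mono real_le_lsqrt) (auto simp: power2_eq_square)
    moreover have "sqrt e > 0" using e by simp
    ultimately show ?thesis by simp
  qed
  ultimately have "\<forall>\<^sub>F n in sequentially. (8 * e + 2 * sqrt (2 * e + 1 / real n) + (2 / e\<^sup>2 + 2 / e) / sqrt (real n)) +
     (\<integral>\<omega>. \<bar>Riem e n (?k n) \<omega> - Aint s e \<omega>\<bar> \<partial>P) < 12 * sqrt e"
    by (rule order_tendstoD)
  then show ?thesis using eventually_gt_at_top[of 0]
  proof eventually_elim
    case (elim n)
    have Ri: "integrable P (Riem e n (?k n))" using Riem_bounds[OF e(1) m[of n]]
      by (intro integrable_const_bound[of _ "1/e"]) auto
    have i: "integrable P (\<lambda>\<omega>. \<bar>Lam n (?k n) \<omega> - Riem e n (?k n) \<omega>\<bar>)" "integrable P (\<lambda>\<omega>. \<bar>Riem e n (?k n) \<omega> - Aint s e \<omega>\<bar>)"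
      "integrable P (\<lambda>\<omega>. \<bar>Lam n (?k n) \<omega> - Aint s e \<omega>\<bar>)"
      using Lam_Riem_bound(1)[OF elim(2) e(1) m[of n]] Ri Aint_integrable[OF s e(1)] by auto
    have "(\<integral>\<omega>. \<bar>Lam n (?k n) \<omega> - Aint s e \<omega>\<bar> \<partial>P) \<le>
        (\<integral>\<omega>. \<bar>Lam n (?k n) \<omega> - Riem e n (?k n) \<omega>\<bar> + \<bar>Riem e n (?k n) \<omega> - Aint s e \<omega>\<bar> \<partial>P)"
      using i by (intro integral_mono Bochner_Integration.integrable_add) auto
    also have "\<dots> = (\<integral>\<omega>. \<bar>Lam n (?k n) \<omega> - Riem e n (?k n) \<omega>\<bar> \<partial>P) + (\<integral>\<omega>. \<bar>Riem e n (?k n) \<omega> - Aint s e \<omega>\<bar> \<partial>P)"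
      using i by simp
    also have "\<dots> \<le> 12 * sqrt e"
      using elim(1) Lam_Riem_bound(2)[OF elim(2) e(1) m[of n]] by linarith
    finally show ?case .
  qed
qed

lemma Lam_integrable: "0 \<le> s \<Longrightarrow> s \<le> 1 \<Longrightarrow> n > 0 \<Longrightarrow> integrable P (Lam n (nat \<lfloor>real n * s\<rfloor>))"
  using Lam_Riem_bound(1)[of n 1] grid_floor(3) by simp

lemma L1_triangle:
  fixes f g h :: "'w \<Rightarrow> real"
  assumes "integrable P f" "integrable P g" "integrable P h"
  shows "(\<integral>\<omega>. \<bar>f \<omega> - h \<omega>\<bar> \<partial>P) \<le> (\<integral>\<omega>. \<bar>f \<omega> - g \<omega>\<bar> \<partial>P) + (\<integral>\<omega>. \<bar>g \<omega> - h \<omega>\<bar> \<partial>P)"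
proof -
  have "(\<integral>\<omega>. \<bar>f \<omega> - h \<omega>\<bar> \<partial>P) \<le> (\<integral>\<omega>. \<bar>f \<omega> - g \<omega>\<bar> + \<bar>g \<omega> - h \<omega>\<bar> \<partial>P)"
    using assms by (intro integral_mono Bochner_Integration.integrable_add integrable_abs Bochner_Integration.integrable_diff) auto
  also have "\<dots> = (\<integral>\<omega>. \<bar>f \<omega> - g \<omega>\<bar> \<partial>P) + (\<integral>\<omega>. \<bar>g \<omega> - h \<omega>\<bar> \<partial>P)"
    using assms by simp
  finally show ?thesis .
qed

text \<open>\<open>Lam\<close> does not depend on \<open>e\<close>, so it can be inserted between
  the two approximations for one large \<open>n\<close>.\<close>

lemma Aint_diff:
  assumes s: "0 \<le> s" "s \<le> 1" and e: "0 < e" "e \<le> 1" and e': "0 < e'" "e' \<le> 1"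
  shows "(\<integral>\<omega>. \<bar>Aint s e \<omega> - Aint s e' \<omega>\<bar> \<partial>P) \<le> 12 * sqrt e + 12 * sqrt e'"
proof -
  have "\<forall>\<^sub>F n in sequentially. n > 0 \<and> (\<integral>\<omega>. \<bar>Lam n (nat \<lfloor>real n * s\<rfloor>) \<omega> - Aint s e \<omega>\<bar> \<partial>P) \<le> 12 * sqrt e \<and>
     (\<integral>\<omega>. \<bar>Lam n (nat \<lfloor>real n * s\<rfloor>) \<omega> - Aint s e' \<omega>\<bar> \<partial>P) \<le> 12 * sqrt e'"
    using Lam_Aint[OF s e] Lam_Aint[OF s e'] eventually_gt_at_top[of 0] by eventually_elim auto
  then obtain n where n: "n > 0" "(\<integral>\<omega>. \<bar>Lam n (nat \<lfloor>real n * s\<rfloor>) \<omega> - Aint s e \<omega>\<bar> \<partial>P) \<le> 12 * sqrt e"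
     "(\<integral>\<omega>. \<bar>Lam n (nat \<lfloor>real n * s\<rfloor>) \<omega> - Aint s e' \<omega>\<bar> \<partial>P) \<le> 12 * sqrt e'"
    using eventually_happens'[OF sequentially_bot] by blast
  have "(\<integral>\<omega>. \<bar>Aint s e \<omega> - Aint s e' \<omega>\<bar> \<partial>P) \<le>
     (\<integral>\<omega>. \<bar>Aint s e \<omega> - Lam n (nat \<lfloor>real n * s\<rfloor>) \<omega>\<bar> \<partial>P) + (\<integral>\<omega>. \<bar>Lam n (nat \<lfloor>real n * s\<rfloor>) \<omega> - Aint s e' \<omega>\<bar> \<partial>P)"
    using s n e e' by (intro L1_triangle Aint_integrable Lam_integrable)
  then show ?thesis using n by (simp add: abs_minus_commute)
qed

text \<open>The smoothed occupation integrals along one sequence form a series that converges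
  absolutely almost surely and in L1; its sum is the local time. It is also the L1 limit of
  \<open>Lam\<close>, which connects local time with the reflected walk.\<close>

lemma local_time_exists:
  assumes s: "0 \<le> s" "s \<le> 1"
  obtains L where "integrable P L"
    "AE \<omega> in P. ((\<lambda>e. 1 / (2 * e) * (LINT r:{0..s}|lborel. indicator {r. \<bar>X r \<omega>\<bar> < e} r)) \<longlongrightarrow> L \<omega>) (at_right 0)"
    "(\<lambda>n. \<integral>\<omega>. \<bar>Lam n (nat \<lfloor>real n * s\<rfloor>) \<omega> - L \<omega>\<bar> \<partial>P) \<longlonglongrightarrow> 0"
proof -
  \<comment> \<open>The power 4 makes the square root of \<epsilon> k equal to (k + 1)^-2, so that
    the bound of \<open>Aint_diff\<close> is summable. \<open>occupation_limit\<close> is stated for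
    the same sequence.\<close>
  define \<epsilon> where "\<epsilon> k = 1 / real (Suc k) ^ 4" for k
  have \<epsilon>: "0 < \<epsilon> k" "\<epsilon> k \<le> 1" "sqrt (\<epsilon> k) = 1 / real (Suc k) ^ 2" for k
  proof -
    show "0 < \<epsilon> k" by (simp add: \<epsilon>_def)
    show "\<epsilon> k \<le> 1" unfolding \<epsilon>_def by (simp add: divide_le_eq_1 one_le_power del: of_nat_Suc)
    have "real (Suc k) ^ 4 = (real (Suc k) ^ 2) ^ 2" by (simp only: power_mult[symmetric]) simp
    then show "sqrt (\<epsilon> k) = 1 / real (Suc k) ^ 2"
      unfolding \<epsilon>_def by (simp only: real_sqrt_divide real_sqrt_abs) simp
  qed
  define A where "A k = Aint s (\<epsilon> k)" for k
  define d where "d k \<omega> = A (Suc k) \<omega> - A k \<omega>" for k \<omega>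
  have Ai: "integrable P (A k)" for k unfolding A_def using s \<epsilon> by (intro Aint_integrable)
  then have [measurable]: "A k \<in> borel_measurable P" for k by auto
  have di: "integrable P (d k)" for k unfolding d_def using Ai by auto
  have dL: "(\<integral>\<omega>. norm (d k \<omega>) \<partial>P) \<le> 24 / real (Suc k) ^ 2" for k
  proof -
    have "(\<integral>\<omega>. norm (d k \<omega>) \<partial>P) \<le> 12 * sqrt (\<epsilon> (Suc k)) + 12 * sqrt (\<epsilon> k)"
      unfolding d_def A_def real_norm_def by (intro Aint_diff s \<epsilon>)
    also have "\<dots> \<le> 24 / real (Suc k) ^ 2"
    proof -
      have "1 / real (Suc (Suc k)) ^ 2 \<le> 1 / real (Suc k) ^ 2"
        by (intro divide_left_mono power_mono) auto
      then show ?thesis unfolding \<epsilon> by simp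
    qed
    finally show ?thesis .
  qed
  have summ: "summable (\<lambda>k. \<integral>\<omega>. norm (d k \<omega>) \<partial>P)"
  proof (rule summable_comparison_test)
    have "summable (\<lambda>k. inverse (real (Suc k) ^ 2))"
      using inverse_power_summable[of 2, where 'a=real] by (subst summable_Suc_iff) auto
    from summable_mult[OF this, of 24] show "summable (\<lambda>k. 24 / real (Suc k) ^ 2)"
      by (simp add: divide_inverse)
    show "\<exists>N. \<forall>k\<ge>N. norm (\<integral>\<omega>. norm (d k \<omega>) \<partial>P) \<le> 24 / real (Suc k) ^ 2"
      using dL by (auto simp: integral_nonneg_AE)
  qed
  have ae: "AE \<omega> in P. summable (\<lambda>k. norm (d k \<omega>))"
  proof -
    have "(\<integral>\<^sup>+\<omega>. (\<Sum>k. ennreal (norm (d k \<omega>))) \<partial>P) = (\<Sum>k. \<integral>\<^sup>+\<omega>. ennreal (norm (d k \<omega>)) \<partial>P)"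
      using di by (intro nn_integral_suminf) auto
    also have "\<dots> = (\<Sum>k. ennreal (\<integral>\<omega>. norm (d k \<omega>) \<partial>P))"
      using di by (intro suminf_cong nn_integral_eq_integral) auto
    also have "\<dots> = ennreal (\<Sum>k. \<integral>\<omega>. norm (d k \<omega>) \<partial>P)"
      by (rule suminf_ennreal_eq[OF _ summable_sums[OF summ]]) (auto intro: integral_nonneg_AE)
    finally have "(\<integral>\<^sup>+\<omega>. (\<Sum>k. ennreal (norm (d k \<omega>))) \<partial>P) \<noteq> \<infinity>" by simp
    then have "AE \<omega> in P. (\<Sum>k. ennreal (norm (d k \<omega>))) \<noteq> \<infinity>"
      using di by (intro nn_integral_PInf_AE) auto
    then show ?thesis
      by eventually_elim (auto intro!: summable_suminf_not_top)
  qed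
  define L where "L \<omega> = A 0 \<omega> + (\<Sum>k. d k \<omega>)" for \<omega>
  have Li: "integrable P L"
    unfolding L_def by (rule Bochner_Integration.integrable_add[OF Ai integrable_suminf[OF di ae summ]])
  have AL: "AE \<omega> in P. (\<lambda>k. A k \<omega>) \<longlonglongrightarrow> L \<omega>"
    using ae
  proof eventually_elim
    case (elim \<omega>)
    then have "(\<lambda>k. d k \<omega>) sums (\<Sum>k. d k \<omega>)" by (rule summable_sums[OF summable_norm_cancel])
    then have "(\<lambda>n. A 0 \<omega> + (\<Sum>k<n. d k \<omega>)) \<longlonglongrightarrow> L \<omega>"
      unfolding sums_def L_def by (intro tendsto_intros)
    moreover have "A 0 \<omega> + (\<Sum>k<n. d k \<omega>) = A n \<omega>" for n
      unfolding d_def using sum_lessThan_telescope[of "\<lambda>k. A k \<omega>" n] by simp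
    ultimately show ?case by simp
  qed
  have AL1: "(\<lambda>k. \<integral>\<omega>. \<bar>A k \<omega> - L \<omega>\<bar> \<partial>P) \<longlonglongrightarrow> (\<integral>\<omega>. 0 \<partial>P)"
  proof (rule integral_dominated_convergence[where w="\<lambda>\<omega>. \<Sum>k. norm (d k \<omega>)"])
    show "AE \<omega> in P. (\<lambda>k. \<bar>A k \<omega> - L \<omega>\<bar>) \<longlonglongrightarrow> 0"
      using AL by eventually_elim (rule tendsto_rabs_zero[OF LIM_zero])
    show "integrable P (\<lambda>\<omega>. \<Sum>k. norm (d k \<omega>))"
      using di ae summ by (intro integrable_suminf) auto
    show "AE \<omega> in P. norm \<bar>A n \<omega> - L \<omega>\<bar> \<le> (\<Sum>k. norm (d k \<omega>))" for n
      using ae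
    proof eventually_elim
      case (elim \<omega>)
      have sd: "summable (\<lambda>k. d k \<omega>)" using elim by (rule summable_norm_cancel)
      have "A n \<omega> = A 0 \<omega> + (\<Sum>k<n. d k \<omega>)" unfolding d_def using sum_lessThan_telescope[of "\<lambda>k. A k \<omega>" n] by simp
      then have "L \<omega> - A n \<omega> = (\<Sum>k. d (k + n) \<omega>)"
        unfolding L_def using suminf_split_initial_segment[OF sd, of n] by simp
      then have "norm \<bar>A n \<omega> - L \<omega>\<bar> = norm (\<Sum>k. d (k + n) \<omega>)" by (simp add: abs_minus_commute)
      also have "\<dots> \<le> (\<Sum>k. norm (d (k + n) \<omega>))"
        using summable_ignore_initial_segment[OF elim, of n] by (intro summable_norm) auto
      also have "\<dots> \<le> (\<Sum>k. norm (d k \<omega>))"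
        using suminf_split_initial_segment[OF elim, of n] by (simp add: sum_nonneg)
      finally show ?case .
    qed
  qed (use Li in auto)
  show ?thesis
  proof (rule that[OF Li])
    show "AE \<omega> in P. ((\<lambda>e. 1 / (2 * e) * (LINT r:{0..s}|lborel. indicator {r. \<bar>X r \<omega>\<bar> < e} r)) \<longlongrightarrow> L \<omega>) (at_right 0)"
      using AL AE_space
    proof eventually_elim
      case (elim \<omega>)
      then show ?case unfolding A_def Aint_def \<epsilon>_def
        by (intro occupation_limit continuous_on_subset[OF X_continuous]) auto
    qed
    show "(\<lambda>n. \<integral>\<omega>. \<bar>Lam n (nat \<lfloor>real n * s\<rfloor>) \<omega> - L \<omega>\<bar> \<partial>P) \<longlonglongrightarrow> 0"
    proof (rule LIMSEQ_I)
      fix r :: real assume r: "r > 0"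
      have "(\<lambda>k. 12 * (1 / real (Suc k) ^ 2) + (\<integral>\<omega>. \<bar>A k \<omega> - L \<omega>\<bar> \<partial>P)) \<longlonglongrightarrow> 12 * 0 + 0"
      proof (intro tendsto_intros)
        show "(\<lambda>k. 1 / real (Suc k) ^ 2) \<longlonglongrightarrow> 0" by real_asymp
      qed (use AL1 in simp)
      then have "\<forall>\<^sub>F k in sequentially. 12 * (1 / real (Suc k) ^ 2) + (\<integral>\<omega>. \<bar>A k \<omega> - L \<omega>\<bar> \<partial>P) < r"
        using r by (intro order_tendstoD) auto
      then obtain k where k: "12 * sqrt (\<epsilon> k) + (\<integral>\<omega>. \<bar>A k \<omega> - L \<omega>\<bar> \<partial>P) < r"
        unfolding \<epsilon>(3) using eventually_happens'[OF sequentially_bot] by blast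
      have "\<forall>\<^sub>F n in sequentially. norm ((\<integral>\<omega>. \<bar>Lam n (nat \<lfloor>real n * s\<rfloor>) \<omega> - L \<omega>\<bar> \<partial>P) - 0) < r"
        using Lam_Aint[OF s \<epsilon>(1,2), of k] eventually_gt_at_top[of 0]
      proof eventually_elim
        case (elim n)
        have "(\<integral>\<omega>. \<bar>Lam n (nat \<lfloor>real n * s\<rfloor>) \<omega> - L \<omega>\<bar> \<partial>P) \<le>
          (\<integral>\<omega>. \<bar>Lam n (nat \<lfloor>real n * s\<rfloor>) \<omega> - A k \<omega>\<bar> \<partial>P) + (\<integral>\<omega>. \<bar>A k \<omega> - L \<omega>\<bar> \<partial>P)"
          using s elim(2) Li Ai by (intro L1_triangle Lam_integrable)
        moreover have "0 \<le> (\<integral>\<omega>. \<bar>Lam n (nat \<lfloor>real n * s\<rfloor>) \<omega> - L \<omega>\<bar> \<partial>P)" by (intro integral_nonneg_AE) auto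
        ultimately show ?case using elim(1) k unfolding A_def by simp
      qed
      then show "\<exists>no. \<forall>n\<ge>no. norm ((\<integral>\<omega>. \<bar>Lam n (nat \<lfloor>real n * s\<rfloor>) \<omega> - L \<omega>\<bar> \<partial>P) - 0) < r"
        by (simp add: eventually_sequentially)
    qed
  qed
qed

end

section \<open>Local time as a functional of the path\<close>

definition occupation :: "(real \<Rightarrow> 'a \<Rightarrow> real) \<Rightarrow> real \<Rightarrow> real \<Rightarrow> 'a \<Rightarrow> real" where
  "occupation Y s e x = 1 / (2 * e) * (LINT r:{0..s}|lborel. indicator {r. \<bar>Y r x\<bar> < e} r)"

lemma local_time0_occupation: "local_time0 Y s x = Lim (at_right 0) (\<lambda>e. occupation Y s e x)"
  by (simp add: local_time0_def occupation_def)

text \<open>Where no limit exists \<open>local_time0\<close> still has some value, so splitting a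
  local time into two is legitimate only on this event; it has to be tracked separately.\<close>

definition local_time_converges :: "(real \<Rightarrow> 'a \<Rightarrow> real) \<Rightarrow> real \<Rightarrow> 'a \<Rightarrow> bool" where
  "local_time_converges Y s x \<longleftrightarrow> (\<exists>l. ((\<lambda>e. occupation Y s e x) \<longlongrightarrow> l) (at_right 0))"

lemma local_time_converges_tendsto:
  "local_time_converges Y s x \<Longrightarrow> ((\<lambda>e. occupation Y s e x) \<longlongrightarrow> local_time0 Y s x) (at_right 0)"
  unfolding local_time_converges_def local_time0_occupation
  by (metis tendsto_Lim trivial_limit_at_right_real)

lemma local_time0_eqI:
  "((\<lambda>e. occupation Y s e x) \<longlongrightarrow> l) (at_right 0) \<Longrightarrow> local_time0 Y s x = l"
  unfolding local_time0_occupation by (rule tendsto_Lim) auto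

text \<open>Left continuity reduces the limit over the continuum of \<open>e\<close> to the rationals.\<close>

lemma Lim_at_right_measurable:
  fixes F :: "real \<Rightarrow> 'a \<Rightarrow> real"
  assumes F[measurable]: "\<And>e. F e \<in> borel_measurable M"
    and left: "\<And>e x. e > 0 \<Longrightarrow> x \<in> space M \<Longrightarrow> ((\<lambda>e'. F e' x) \<longlongrightarrow> F e x) (at_left e)"
  shows "{x \<in> space M. \<exists>l. ((\<lambda>e. F e x) \<longlongrightarrow> l) (at_right 0)} \<in> sets M"
    and "(\<lambda>x. Lim (at_right 0) (\<lambda>e. F e x)) \<in> borel_measurable M"
proof -
  \<comment> \<open>The Cauchy criterion at 0 from the right, restricted to rational arguments:
    countably many conditions, hence a measurable set.\<close>
  define C where "C = {x \<in> space M. \<forall>k::nat. \<exists>j::nat. \<forall>p::rat. \<forall>q::rat.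
     of_rat p \<in> {0<..<1 / real (Suc j)} \<longrightarrow> of_rat q \<in> {0<..<1 / real (Suc j)} \<longrightarrow> \<bar>F (of_rat p) x - F (of_rat q) x\<bar> \<le> 1 / real (Suc k)}"
  have C[measurable]: "C \<in> sets M" unfolding C_def by measurable
  have approx: "\<exists>q::rat. of_rat q \<in> {0<..<e} \<and> \<bar>F (of_rat q) x - F e x\<bar> < \<eta>"
    if e: "e > 0" "\<eta> > 0" "x \<in> space M" for e \<eta> x
  proof -
    have "\<forall>\<^sub>F e' in at_left e. dist (F e' x) (F e x) < \<eta>"
      using left[OF e(1,3)] e(2) by (rule tendstoD)
    then obtain b where b: "b < e" "\<And>y. b < y \<Longrightarrow> y < e \<Longrightarrow> dist (F y x) (F e x) < \<eta>"
      unfolding eventually_at_left_field by auto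
    obtain q :: rat where "max 0 b < of_rat q" "of_rat q < e"
      using of_rat_dense[of "max 0 b" e] b e by auto
    then show ?thesis using b(2)[of "of_rat q"] by (auto simp: dist_real_def)
  qed
  have conv: "((\<lambda>e. F e x) \<longlongrightarrow> lim (\<lambda>n. F (1 / real (Suc n)) x)) (at_right 0)" if x: "x \<in> C" for x
  proof -
    have xs: "x \<in> space M" using x by (simp add: C_def)
    have cauchy: "\<exists>j::nat. \<forall>a b. a \<in> {0<..<1 / real (Suc j)} \<longrightarrow> b \<in> {0<..<1 / real (Suc j)} \<longrightarrow> \<bar>F a x - F b x\<bar> < \<eta>"
      if \<eta>: "\<eta> > 0" for \<eta>
    proof -
      obtain k where k: "1 / real (Suc k) < \<eta> / 2" using nat_approx_posE[of "\<eta> / 2"] \<eta> by auto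
      obtain j where j: "\<And>p q::rat. of_rat p \<in> {0<..<1 / real (Suc j)} \<Longrightarrow> of_rat q \<in> {0<..<1 / real (Suc j)} \<Longrightarrow>
          \<bar>F (of_rat p) x - F (of_rat q) x\<bar> \<le> 1 / real (Suc k)"
        using x unfolding C_def by blast
      show ?thesis
      proof (intro exI[of _ j] allI impI)
        fix a b assume a: "a \<in> {0<..<1 / real (Suc j)}" and b: "b \<in> {0<..<1 / real (Suc j)}"
        obtain p :: rat where p: "of_rat p \<in> {0<..<a}" "\<bar>F (of_rat p) x - F a x\<bar> < \<eta> / 4"
          using approx[of a "\<eta> / 4"] a \<eta> xs by auto
        obtain q :: rat where q: "of_rat q \<in> {0<..<b}" "\<bar>F (of_rat q) x - F b x\<bar> < \<eta> / 4"
          using approx[of b "\<eta> / 4"] b \<eta> xs by auto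
        have "\<bar>F (of_rat p) x - F (of_rat q) x\<bar> \<le> 1 / real (Suc k)" using p q a b by (intro j) auto
        then show "\<bar>F a x - F b x\<bar> < \<eta>" using p(2) q(2) k by linarith
      qed
    qed
    have "Cauchy (\<lambda>n. F (1 / real (Suc n)) x)"
    proof (rule metric_CauchyI)
      fix \<eta> :: real assume "\<eta> > 0"
      then obtain j where j: "\<And>a b. a \<in> {0<..<1 / real (Suc j)} \<Longrightarrow> b \<in> {0<..<1 / real (Suc j)} \<Longrightarrow> \<bar>F a x - F b x\<bar> < \<eta>"
        using cauchy by blast
      have "1 / real (Suc n) \<in> {0<..<1 / real (Suc j)}" if "n \<ge> Suc j" for n
        using that by (auto simp: frac_less2)
      then show "\<exists>N. \<forall>m\<ge>N. \<forall>n\<ge>N. dist (F (1 / real (Suc m)) x) (F (1 / real (Suc n)) x) < \<eta>"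
        using j unfolding dist_real_def by blast
    qed
    then have lim: "(\<lambda>n. F (1 / real (Suc n)) x) \<longlonglongrightarrow> lim (\<lambda>n. F (1 / real (Suc n)) x)"
      using real_Cauchy_convergent convergent_LIMSEQ_iff by blast
    show ?thesis
    proof (rule tendstoI)
      fix \<eta> :: real assume \<eta>: "\<eta> > 0"
      then obtain j where j: "\<And>a b. a \<in> {0<..<1 / real (Suc j)} \<Longrightarrow> b \<in> {0<..<1 / real (Suc j)} \<Longrightarrow> \<bar>F a x - F b x\<bar> < \<eta> / 2"
        using cauchy[of "\<eta> / 2"] by auto
      have *: "\<bar>lim (\<lambda>n. F (1 / real (Suc n)) x) - F a x\<bar> \<le> \<eta> / 2" if a: "a \<in> {0<..<1 / real (Suc j)}" for a
      proof (rule LIMSEQ_le_const2[OF tendsto_rabs[OF tendsto_diff[OF lim tendsto_const]]])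
        have "\<bar>F (1 / real (Suc n)) x - F a x\<bar> \<le> \<eta> / 2" if "n \<ge> Suc j" for n
          using that a by (intro less_imp_le j) (auto simp: frac_less2)
        then show "\<exists>N. \<forall>n\<ge>N. \<bar>F (1 / real (Suc n)) x - F a x\<bar> \<le> \<eta> / 2" by blast
      qed
      have "\<forall>\<^sub>F a in at_right 0. a \<in> {0<..<1 / real (Suc j)}" by (rule eventually_at_right_real) simp
      then show "\<forall>\<^sub>F a in at_right 0. dist (F a x) (lim (\<lambda>n. F (1 / real (Suc n)) x)) < \<eta>"
      proof eventually_elim
        case (elim a)
        show ?case using *[OF elim] \<eta> by (simp add: dist_real_def abs_minus_commute)
      qed
    qed
  qed
  have C_eq: "C = {x \<in> space M. \<exists>l. ((\<lambda>e. F e x) \<longlongrightarrow> l) (at_right 0)}"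
  proof (intro set_eqI iffI)
    fix x assume "x \<in> C"
    then show "x \<in> {x \<in> space M. \<exists>l. ((\<lambda>e. F e x) \<longlongrightarrow> l) (at_right 0)}" using conv C_def by auto
  next
    fix x assume x: "x \<in> {x \<in> space M. \<exists>l. ((\<lambda>e. F e x) \<longlongrightarrow> l) (at_right 0)}"
    then obtain l where l: "((\<lambda>e. F e x) \<longlongrightarrow> l) (at_right 0)" by auto
    have "\<exists>j::nat. \<forall>p::rat. \<forall>q::rat.
     of_rat p \<in> {0<..<1 / real (Suc j)} \<longrightarrow> of_rat q \<in> {0<..<1 / real (Suc j)} \<longrightarrow> \<bar>F (of_rat p) x - F (of_rat q) x\<bar> \<le> 1 / real (Suc k)" for k
    proof -
      define \<delta> where "\<delta> = 1 / real (Suc k)"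
      have "\<forall>\<^sub>F e in at_right 0. dist (F e x) l < \<delta> / 2" by (rule tendstoD[OF l]) (simp add: \<delta>_def)
      then obtain b where b: "b > 0" "\<And>y. 0 < y \<Longrightarrow> y < b \<Longrightarrow> dist (F y x) l < \<delta> / 2"
        unfolding eventually_at_right_field by auto
      obtain j where j: "1 / real (Suc j) < b" using nat_approx_posE[OF b(1)] by auto
      show ?thesis
      proof (intro exI[of _ j] allI impI)
        fix p q :: rat assume "of_rat p \<in> {0<..<1 / real (Suc j)}" "of_rat q \<in> {0<..<1 / real (Suc j)}"
        then have pq: "0 < real_of_rat p" "real_of_rat p < b" "0 < real_of_rat q" "real_of_rat q < b"
          using j by (auto intro: less_trans)
        have "dist (F (of_rat p) x) l < \<delta> / 2" "dist (F (of_rat q) x) l < \<delta> / 2"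
          by (rule b(2)[OF pq(1,2)], rule b(2)[OF pq(3,4)])
        then show "\<bar>F (of_rat p) x - F (of_rat q) x\<bar> \<le> 1 / real (Suc k)"
          unfolding dist_real_def \<delta>_def[symmetric] by linarith
      qed
    qed
    then show "x \<in> C" using x unfolding C_def by auto
  qed
  show "{x \<in> space M. \<exists>l. ((\<lambda>e. F e x) \<longlongrightarrow> l) (at_right 0)} \<in> sets M" using C C_eq by simp
  \<comment> \<open>Off \<open>C\<close> no \<open>l\<close> is a limit, so the description behind
    \<open>Lim\<close> is that of the constantly false predicate: unspecified, but the same for
    every \<open>x\<close>, hence measurable.\<close>
  have "(\<lambda>x. if x \<in> C then lim (\<lambda>n. F (1 / real (Suc n)) x) else (THE l::real. False)) \<in> borel_measurable M"
    by (intro measurable_If borel_measurable_lim_metric) auto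
  also have "?this \<longleftrightarrow> (\<lambda>x. Lim (at_right 0) (\<lambda>e. F e x)) \<in> borel_measurable M"
  proof (rule measurable_cong)
    fix x assume x: "x \<in> space M"
    show "(if x \<in> C then lim (\<lambda>n. F (1 / real (Suc n)) x) else (THE l. False)) = Lim (at_right 0) (\<lambda>e. F e x)"
    proof (cases "x \<in> C")
      case True
      then show ?thesis using tendsto_Lim[OF _ conv[OF True]] by simp
    next
      case False
      then have "\<not> ((\<lambda>e. F e x) \<longlongrightarrow> l) (at_right 0)" for l using x C_eq by auto
      then show ?thesis using False by (simp add: t2_space_class.Lim_def)
    qed
  qed
  finally show "(\<lambda>x. Lim (at_right 0) (\<lambda>e. F e x)) \<in> borel_measurable M" .
qed

lemma local_time_measurable:
  fixes Y :: "real \<Rightarrow> 'a \<Rightarrow> real"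
  assumes Y: "(\<lambda>(x, r). Y r x) \<in> borel_measurable (M \<Otimes>\<^sub>M lborel)"
  shows "{x \<in> space M. local_time_converges Y s x} \<in> sets M" "local_time0 Y s \<in> borel_measurable M"
proof -
  have Yr: "(\<lambda>r. Y r x) \<in> borel_measurable borel" if "x \<in> space M" for x
    using measurable_Pair2[OF Y that] by simp
  have joint: "(\<lambda>(x, r). indicator {0..s} r *\<^sub>R (indicator {r. \<bar>Y r x\<bar> < e} r :: real)) \<in> borel_measurable (M \<Otimes>\<^sub>M lborel)" for e
  proof -
    have "(\<lambda>z. indicator {0..s} (snd z) *\<^sub>R (if \<bar>(\<lambda>(x, r). Y r x) z\<bar> < e then 1 else 0 :: real)) \<in> borel_measurable (M \<Otimes>\<^sub>M lborel)"
      using Y by measurable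
    then show ?thesis by (rule measurable_cong[THEN iffD1, rotated]) (auto simp: indicator_def)
  qed
  have m: "occupation Y s e \<in> borel_measurable M" for e
  proof -
    have "(\<lambda>x. LINT r:{0..s}|lborel. indicator {r. \<bar>Y r x\<bar> < e} r :: real) \<in> borel_measurable M"
      unfolding set_lebesgue_integral_def
      using lborel.borel_measurable_lebesgue_integral[OF joint] by simp
    then show ?thesis unfolding occupation_def by measurable
  qed
  \<comment> \<open>This uses the strict inequality in the occupation set: for e' increasing to e,
    the sets {\<bar>Y\<bar> < e'} increase to {\<bar>Y\<bar> < e}.\<close>
  have left: "((\<lambda>e'. occupation Y s e' x) \<longlongrightarrow> occupation Y s e x) (at_left e)" if e: "e > 0" and x: "x \<in> space M" for e x
  proof (rule tendsto_at_left_sequentially[of 0])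
    show "0 < e" by fact
    fix S assume S: "\<And>n. S n < e" "\<And>n. 0 < S n" "incseq S" "S \<longlonglongrightarrow> e"
    have "(\<lambda>n. LINT r:{0..s}|lborel. indicator {r. \<bar>Y r x\<bar> < S n} r :: real) \<longlonglongrightarrow> (LINT r:{0..s}|lborel. indicator {r. \<bar>Y r x\<bar> < e} r)"
      unfolding set_lebesgue_integral_def
    proof (rule integral_dominated_convergence[where w="indicator {0..s}"])
      show "integrable lborel (indicator {0..s} :: real \<Rightarrow> real)"
        by (rule integrable_real_indicator) (auto simp: emeasure_lborel_Icc_eq)
      have "(\<lambda>n. indicator {r. \<bar>Y r x\<bar> < S n} r :: real) \<longlonglongrightarrow> indicator {r. \<bar>Y r x\<bar> < e} r" for r
      proof (cases "\<bar>Y r x\<bar> < e")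
        case True
        then have "\<forall>\<^sub>F n in sequentially. \<bar>Y r x\<bar> < S n" using S(4) by (intro order_tendstoD) auto
        then have "\<forall>\<^sub>F n in sequentially. (indicator {r. \<bar>Y r x\<bar> < S n} r :: real) = indicator {r. \<bar>Y r x\<bar> < e} r"
          by eventually_elim (use True in simp)
        then show ?thesis by (rule tendsto_eventually)
      next
        case False
        then have "(indicator {r. \<bar>Y r x\<bar> < S n} r :: real) = indicator {r. \<bar>Y r x\<bar> < e} r" for n
          using S(1)[of n] by simp
        then show ?thesis by simp
      qed
      then show "AE r in lborel. (\<lambda>n. indicator {0..s} r *\<^sub>R (indicator {r. \<bar>Y r x\<bar> < S n} r :: real)) \<longlonglongrightarrow> indicator {0..s} r *\<^sub>R indicator {r. \<bar>Y r x\<bar> < e} r"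
        by (intro AE_I2 tendsto_intros)
      show "(\<lambda>r. indicator {0..s} r *\<^sub>R (indicator {r. \<bar>Y r x\<bar> < e} r :: real)) \<in> borel_measurable lborel" for e
        using measurable_Pair2[OF joint[of e] x] by simp
      show "(\<lambda>r. indicator {0..s} r *\<^sub>R (indicator {r. \<bar>Y r x\<bar> < S n} r :: real)) \<in> borel_measurable lborel" for n
        using measurable_Pair2[OF joint[of "S n"] x] by simp
    qed (auto simp: indicator_def)
    then show "(\<lambda>n. occupation Y s (S n) x) \<longlonglongrightarrow> occupation Y s e x"
      unfolding occupation_def using e S by (intro tendsto_intros) auto
  qed
  show "{x \<in> space M. local_time_converges Y s x} \<in> sets M"
    unfolding local_time_converges_def by (rule Lim_at_right_measurable(1)[OF m left])
  show "local_time0 Y s \<in> borel_measurable M"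
    unfolding local_time0_occupation[abs_def] by (rule Lim_at_right_measurable(2)[OF m left])
qed

text \<open>A jointly measurable reconstruction of a continuous path from its values at the grid points;
  local time thereby becomes a measurable functional on the product space.\<close>

definition path_of :: "real \<Rightarrow> real \<Rightarrow> (real \<Rightarrow> real) \<Rightarrow> real" where
  "path_of c r x = lim (\<lambda>m. x (min c (real (nat \<lfloor>real m * r\<rfloor>) / real m)))"

lemma path_of_measurable:
  assumes "c \<ge> 0"
  shows "(\<lambda>(x, r). path_of c r x) \<in> borel_measurable (PiM {0..c} (\<lambda>_. borel) \<Otimes>\<^sub>M lborel)"
proof -
  \<comment> \<open>The cap by \<open>c\<close> keeps every evaluated index inside {0..c}, for all
    real \<open>r\<close>, so each evaluation is a coordinate map of the product space.\<close>
  have m1: "(\<lambda>z. fst z (min c (real i / real m)) :: real) \<in> borel_measurable (PiM {0..c} (\<lambda>_. borel) \<Otimes>\<^sub>M lborel)" for i m :: nat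
    using assms by (intro measurable_compose[OF measurable_fst measurable_component_singleton]) auto
  have m2: "(\<lambda>z. nat \<lfloor>real m * snd z\<rfloor>) \<in> measurable (PiM {0..c} (\<lambda>_. borel :: real measure) \<Otimes>\<^sub>M lborel) (count_space UNIV)" for m :: nat
    by measurable
  have "(\<lambda>z. fst z (min c (real (nat \<lfloor>real m * snd z\<rfloor>) / real m)) :: real) \<in> borel_measurable (PiM {0..c} (\<lambda>_. borel) \<Otimes>\<^sub>M lborel)" for m
    by (rule measurable_compose_countable[where f="\<lambda>i z. fst z (min c (real i / real m))", OF m1 m2])
  then have "(\<lambda>z. lim (\<lambda>m. fst z (min c (real (nat \<lfloor>real m * snd z\<rfloor>) / real m))) :: real) \<in> borel_measurable (PiM {0..c} (\<lambda>_. borel) \<Otimes>\<^sub>M lborel)"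
    by (rule borel_measurable_lim_metric)
  then show ?thesis by (simp add: path_of_def case_prod_unfold)
qed

lemma path_of_continuous:
  assumes f: "continuous_on {0..c} f" and r: "0 \<le> r" "r \<le> c"
  shows "path_of c r (\<lambda>t\<in>{0..c}. f t) = f r"
proof -
  have g: "real (nat \<lfloor>real m * r\<rfloor>) / real m \<in> {0..c}" for m using grid_floor(1)[OF r(1), of m] r(2) by auto
  have "(\<lambda>m. f (real (nat \<lfloor>real m * r\<rfloor>) / real m)) \<longlonglongrightarrow> f r"
    by (rule continuous_on_tendsto_compose[OF f tendsto_grid_floor[OF r(1)]]) (use g r in auto)
  moreover have "(\<lambda>t\<in>{0..c}. f t) (min c (real (nat \<lfloor>real m * r\<rfloor>) / real m)) = f (real (nat \<lfloor>real m * r\<rfloor>) / real m)" for m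
    using g[of m] by (simp add: min_absorb2)
  ultimately show ?thesis unfolding path_of_def by (simp add: limI)
qed

lemma occupation_path_of:
  assumes f: "continuous_on {0..c} (\<lambda>t. Y t \<omega>)" and s: "s \<le> c"
  shows "occupation Y s e \<omega> = occupation (path_of c) s e (\<lambda>t\<in>{0..c}. Y t \<omega>)"
proof -
  have "(LINT r:{0..s}|lborel. indicator {r. \<bar>Y r \<omega>\<bar> < e} r :: real) =
      (LINT r:{0..s}|lborel. indicator {r. \<bar>path_of c r (\<lambda>t\<in>{0..c}. Y t \<omega>)\<bar> < e} r)"
    unfolding set_lebesgue_integral_def
    using path_of_continuous[OF f] s by (intro Bochner_Integration.integral_cong) (auto simp: indicator_def)
  then show ?thesis unfolding occupation_def by simp
qed

lemma local_time0_path_of: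
  assumes f: "continuous_on {0..c} (\<lambda>t. Y t \<omega>)" and s: "s \<le> c"
  shows "local_time0 Y s \<omega> = local_time0 (path_of c) s (\<lambda>t\<in>{0..c}. Y t \<omega>)"
    "local_time_converges Y s \<omega> \<longleftrightarrow> local_time_converges (path_of c) s (\<lambda>t\<in>{0..c}. Y t \<omega>)"
  unfolding local_time0_occupation local_time_converges_def using occupation_path_of[where Y=Y, OF assms] by simp_all

text \<open>The horizon \<open>c\<close> is a parameter because Brownian motion and the bridge are
  compared only up to times before 1, whereas suprema and local times are studied up to 1.\<close>

locale continuous_process =
  fixes M :: "'a measure" and c :: real and Y :: "real \<Rightarrow> 'a \<Rightarrow> real"
  assumes measurable_at: "t \<in> {0..c} \<Longrightarrow> Y t \<in> borel_measurable M"
    and continuous_path: "\<omega> \<in> space M \<Longrightarrow> continuous_on {0..c} (\<lambda>t. Y t \<omega>)"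
    and horizon: "0 \<le> c"
begin

definition path_law :: "(real \<Rightarrow> real) measure" where
  "path_law = distr M (PiM {0..c} (\<lambda>_. borel)) (\<lambda>\<omega>. \<lambda>t\<in>{0..c}. Y t \<omega>)"

lemma path_measurable: "(\<lambda>\<omega>. \<lambda>t\<in>{0..c}. Y t \<omega>) \<in> measurable M (PiM {0..c} (\<lambda>_. borel))"
  by (intro measurable_restrict measurable_at)

lemma local_time0_measurable:
  assumes "s \<le> c"
  shows "local_time0 Y s \<in> borel_measurable M"
proof -
  have "(\<lambda>\<omega>. local_time0 (path_of c) s (\<lambda>t\<in>{0..c}. Y t \<omega>)) \<in> borel_measurable M"
    by (rule measurable_compose[OF path_measurable local_time_measurable(2)[OF path_of_measurable[OF horizon]]])
  then show ?thesis
    by (rule measurable_cong[THEN iffD1, rotated]) (simp add: local_time0_path_of(1)[where Y=Y, OF continuous_path assms])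
qed

text \<open>Existence of the limit is an event of the path alone, so its almost sure validity
  depends only on the law of the path. In this way it is inherited by the bridge from Brownian
  motion.\<close>

lemma AE_local_time_converges_iff:
  assumes "s \<le> c"
  shows "(AE \<omega> in M. local_time_converges Y s \<omega>) \<longleftrightarrow> (AE x in path_law. local_time_converges (path_of c) s x)"
proof -
  have "(AE \<omega> in M. local_time_converges Y s \<omega>) \<longleftrightarrow> (AE \<omega> in M. local_time_converges (path_of c) s (\<lambda>t\<in>{0..c}. Y t \<omega>))"
    by (rule AE_cong) (use local_time0_path_of(2)[where Y=Y, OF continuous_path assms] in auto)
  also have "\<dots> \<longleftrightarrow> (AE x in path_law. local_time_converges (path_of c) s x)"
    unfolding path_law_def using local_time_measurable(1)[OF path_of_measurable[OF horizon], of s]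
    by (intro AE_distr_iff[OF path_measurable, symmetric]) simp
  finally show ?thesis .
qed

end

section \<open>Levy's equivalence\<close>

lemma norm_cis_diff: "norm (cis a - cis b) \<le> \<bar>a - b\<bar>"
proof -
  have "cis a - cis b = cis b * (cis (a - b) - 1)" by (simp add: cis_mult right_diff_distrib)
  moreover have "norm (cis (a - b) - 1) \<le> \<bar>a - b\<bar>"
    using iexp_approx1[of "a - b" 0] by (simp add: cis_conv_exp)
  ultimately show ?thesis by (simp add: norm_mult)
qed

lemma norm_cis_diff_le_2: "norm (cis a - cis b) \<le> 2"
  using norm_triangle_ineq4[of "cis a" "cis b"] by simp

text \<open>A functional of increments, not of positions, so that the same one applies to the
  increments \<open>D\<close> of the path and to the flipped increments \<open>V\<close>. The empty
  partial sum 0 is among the candidates.\<close>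

definition grid_max :: "nat \<Rightarrow> (nat \<Rightarrow> real) \<Rightarrow> real" where
  "grid_max k x = Max ((\<lambda>i. \<Sum>l<i. x l) ` {..k})"

lemma grid_max_ge: "i \<le> k \<Longrightarrow> (\<Sum>l<i. x l) \<le> grid_max k x"
  unfolding grid_max_def by (intro Max_ge) auto

lemma grid_max_le_iff: "grid_max k x \<le> b \<longleftrightarrow> (\<forall>i\<le>k. (\<Sum>l<i. x l) \<le> b)"
  unfolding grid_max_def by (subst Max_le_iff) auto

lemma grid_max_mono: "i \<le> k \<Longrightarrow> grid_max i x \<le> grid_max k x"
  unfolding grid_max_le_iff using grid_max_ge by auto

lemma grid_max_cong: "(\<And>l. l < k \<Longrightarrow> x l = y l) \<Longrightarrow> grid_max k x = grid_max k y"
  unfolding grid_max_def by (intro arg_cong[where f=Max] image_cong sum.cong) auto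

lemma grid_max_measurable:
  assumes "k \<le> n"
  shows "grid_max k \<in> borel_measurable (PiM {..<n} (\<lambda>_. borel))"
  unfolding grid_max_def using assms
  by (intro borel_measurable_Max borel_measurable_sum measurable_component_singleton) auto

text \<open>\<open>sign w\<close> is a subgradient of the absolute value at \<open>w\<close>, whence
  the first part. The defect is nonzero only if \<open>w\<close> and \<open>w + d\<close> have
  different \<open>sign\<close>, and then \<open>w + d\<close> lies no farther from 0 than the
  length of the jump.\<close>

lemma abs_sign_increment:
  "0 \<le> \<bar>w + d\<bar> - \<bar>w\<bar> - sign w * d" "\<bar>w + d\<bar> - \<bar>w\<bar> - sign w * d = 0 \<or> \<bar>w + d\<bar> \<le> \<bar>d\<bar>"
  unfolding sign_def by (auto simp: abs_if)

text \<open>The grid maximum never exceeds the supremum, and it is at least the value at the grid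
  point just below a maximiser \<open>t\<close>, which tends to the value at
  \<open>t\<close>.\<close>

lemma running_max_grid_tendsto:
  fixes f :: "real \<Rightarrow> real"
  assumes f: "continuous_on {0..1} f" and s: "0 \<le> s" "s \<le> 1"
  shows "(\<lambda>n. Max ((\<lambda>i. f (real i / real n)) ` {..nat \<lfloor>real n * s\<rfloor>})) \<longlonglongrightarrow> (SUP u\<in>{0..s}. f u)"
proof -
  let ?k = "\<lambda>n. nat \<lfloor>real n * s\<rfloor>"
  have fs: "continuous_on {0..s} f" using f s by (auto intro: continuous_on_subset)
  obtain t where t: "t \<in> {0..s}" "\<And>u. u \<in> {0..s} \<Longrightarrow> f u \<le> f t"
    using continuous_attains_sup[OF compact_Icc _ fs] s by auto
  have sup: "(SUP u\<in>{0..s}. f u) = f t"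
    using t by (intro cSup_eq_maximum) auto
  have lim: "(\<lambda>n. f (real (nat \<lfloor>real n * t\<rfloor>) / real n)) \<longlonglongrightarrow> f t"
  proof (rule continuous_on_tendsto_compose[OF f tendsto_grid_floor])
    show "t \<in> {0..1}" "0 \<le> t" using t s by auto
    have "real (nat \<lfloor>real n * t\<rfloor>) / real n \<in> {0..1}" for n
      using grid_floor(1)[of t n] t s by auto
    then show "\<forall>\<^sub>F n in sequentially. real (nat \<lfloor>real n * t\<rfloor>) / real n \<in> {0..1}" by simp
  qed
  have lo: "f (real (nat \<lfloor>real n * t\<rfloor>) / real n) \<le> Max ((\<lambda>i. f (real i / real n)) ` {..?k n})" for n
  proof (rule Max_ge)
    have "nat \<lfloor>real n * t\<rfloor> \<le> ?k n" using t by (intro nat_mono floor_mono mult_left_mono) auto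
    then show "f (real (nat \<lfloor>real n * t\<rfloor>) / real n) \<in> (\<lambda>i. f (real i / real n)) ` {..?k n}" by auto
  qed simp
  have hi: "Max ((\<lambda>i. f (real i / real n)) ` {..?k n}) \<le> f t" for n
  proof (rule Max.boundedI)
    fix a assume "a \<in> (\<lambda>i. f (real i / real n)) ` {..?k n}"
    then obtain i where i: "i \<le> ?k n" "a = f (real i / real n)" by auto
    have "real i / real n \<le> real (?k n) / real n" using i by (intro divide_right_mono) auto
    also have "\<dots> \<le> s" by (rule grid_floor(1)[OF s(1)])
    finally show "a \<le> f t" unfolding i(2) by (intro t) auto
  qed auto
  show ?thesis unfolding sup
    by (rule tendsto_sandwich[OF always_eventually always_eventually lim tendsto_const]) (use lo hi in blast)+
qed

lemma running_sup_borel_measurable: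
  assumes "continuous_process M 1 Y" and s: "0 \<le> s" "s \<le> 1"
  shows "running_sup Y s \<in> borel_measurable M"
  unfolding running_sup_def[abs_def]
proof (rule borel_measurable_LIMSEQ_real)
  interpret continuous_process M 1 Y by fact
  show "(\<lambda>n. Max ((\<lambda>i. Y (real i / real n) \<omega>) ` {..nat \<lfloor>real n * s\<rfloor>})) \<longlonglongrightarrow> (SUP u\<in>{0..s}. Y u \<omega>)"
    if "\<omega> \<in> space M" for \<omega>
    by (rule running_max_grid_tendsto[OF continuous_path[OF that] s])
  fix n
  show "(\<lambda>\<omega>. Max ((\<lambda>i. Y (real i / real n) \<omega>) ` {..nat \<lfloor>real n * s\<rfloor>})) \<in> borel_measurable M"
  proof (intro borel_measurable_Max measurable_at)
    fix i assume "i \<in> {..nat \<lfloor>real n * s\<rfloor>}"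
    then have "real i / real n \<le> real (nat \<lfloor>real n * s\<rfloor>) / real n" by (intro divide_right_mono) auto
    also have "\<dots> \<le> s" by (rule grid_floor(1)[OF s(1)])
    finally show "real i / real n \<in> {0..1}" using s by simp
  qed simp
qed

context brownian_motion
begin

text \<open>Split \<open>cis (u * x)\<close> into its even and odd parts. The even part does not see
  the sign \<open>g\<close>; the odd part has mean zero by symmetry and is independent of the past,
  so its contribution vanishes whatever sign the past attaches to it.\<close>

lemma integral_cis_signed_increments:
  assumes n: "n > 0" and [measurable]: "g \<in> borel_measurable borel" and g: "\<And>x. g x = 1 \<or> g x = (-1 :: real)"
  shows "(\<integral>\<omega>. cis (\<Sum>j<m. u j * (g (W n j \<omega>) * D n j \<omega>)) \<partial>P) = of_real (exp (- (\<Sum>j<m. (u j)\<^sup>2) / real n / 2))"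
proof (induction m)
  case (Suc m)
  define S where "S j x = (\<Sum>i<j. x i)" for j and x :: "nat \<Rightarrow> real"
  define F where "F x = cis (\<Sum>j<m. u j * (g (S j x) * x j))" for x
  define G where "G x = F x * of_real (g (S m x))" for x
  have comp: "(\<lambda>x. x i) \<in> borel_measurable (PiM {..<m} (\<lambda>_. borel))" if "i < m" for i
    using that by (intro measurable_component_singleton) auto
  have S_m: "S j \<in> borel_measurable (PiM {..<m} (\<lambda>_. borel))" if "j \<le> m" for j
    unfolding S_def using that by (intro borel_measurable_sum comp) auto
  have F_m: "F \<in> borel_measurable (PiM {..<m} (\<lambda>_. borel))"
    unfolding F_def
    by (intro measurable_compose[OF _ borel_measurable_cis] borel_measurable_sum borel_measurable_times
         measurable_compose[OF S_m] measurable_compose[OF comp] borel_measurable_const) auto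
  have G_m: "G \<in> borel_measurable (PiM {..<m} (\<lambda>_. borel))"
    unfolding G_def
    by (intro borel_measurable_times F_m measurable_compose[OF _ borel_measurable_of_real] measurable_compose[OF S_m]) auto
  have S_eq: "S j (\<lambda>i\<in>{..<m}. D n i \<omega>) = W n j \<omega>" if "j \<le> m" for j \<omega>
    unfolding S_def W_def using that by (intro sum.cong) auto
  have F_eq: "F (\<lambda>i\<in>{..<m}. D n i \<omega>) = cis (\<Sum>j<m. u j * (g (W n j \<omega>) * D n j \<omega>))" for \<omega>
    unfolding F_def by (intro arg_cong[where f=cis] sum.cong) (auto simp: S_eq)
  have G_eq: "G (\<lambda>i\<in>{..<m}. D n i \<omega>) = cis (\<Sum>j<m. u j * (g (W n j \<omega>) * D n j \<omega>)) * of_real (g (W n m \<omega>))" for \<omega>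
    unfolding G_def F_eq by (simp add: S_eq)
  have normg: "norm (complex_of_real (g x)) = 1" for x using g[of x] by auto
  have Fi: "integrable P (\<lambda>\<omega>. F (\<lambda>i\<in>{..<m}. D n i \<omega>))"
    unfolding F_eq by (intro integrable_const_bound[of _ 1]) auto
  have Gi: "integrable P (\<lambda>\<omega>. G (\<lambda>i\<in>{..<m}. D n i \<omega>))"
    unfolding G_eq using normg by (intro integrable_const_bound[of _ 1] AE_I2) (simp_all add: norm_mult)
  define c where "c x = complex_of_real (cos (u m * x))" for x
  define s where "s x = \<i> * complex_of_real (sin (u m * x))" for x
  have csm[measurable]: "c \<in> borel_measurable borel" "s \<in> borel_measurable borel" unfolding c_def s_def by measurable
  have ci: "integrable P (\<lambda>\<omega>. c (D n m \<omega>))" "integrable P (\<lambda>\<omega>. s (D n m \<omega>))"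
    by (intro integrable_const_bound[of _ 1]; simp add: c_def s_def norm_mult)+
  have cs: "cis (u m * x) = c x + s x" for x by (simp add: c_def s_def complex_eq_iff)
  have E: "(\<integral>\<omega>. cis (u m * D n m \<omega>) \<partial>P) = of_real (exp (- (u m)\<^sup>2 / real n / 2))"
    using integral_cis_normal[OF D_normal[OF n], of "u m" m] n by (simp add: power_mult_distrib)
  then have E': "(\<integral>\<omega>. c (D n m \<omega>) \<partial>P) + (\<integral>\<omega>. s (D n m \<omega>) \<partial>P) = of_real (exp (- (u m)\<^sup>2 / real n / 2))"
    using ci unfolding cs by simp
  moreover have "(\<integral>\<omega>. c (D n m \<omega>) \<partial>P) = of_real (\<integral>\<omega>. cos (u m * D n m \<omega>) \<partial>P)"
    "(\<integral>\<omega>. s (D n m \<omega>) \<partial>P) = \<i> * of_real (\<integral>\<omega>. sin (u m * D n m \<omega>) \<partial>P)"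
    unfolding c_def s_def by simp_all
  ultimately have Es: "(\<integral>\<omega>. s (D n m \<omega>) \<partial>P) = 0" and Ec: "(\<integral>\<omega>. c (D n m \<omega>) \<partial>P) = of_real (exp (- (u m)\<^sup>2 / real n / 2))"
    by (auto simp: complex_eq_iff)
  have split: "cis (\<Sum>j<Suc m. u j * (g (W n j \<omega>) * D n j \<omega>)) =
     F (\<lambda>i\<in>{..<m}. D n i \<omega>) * c (D n m \<omega>) + G (\<lambda>i\<in>{..<m}. D n i \<omega>) * s (D n m \<omega>)" for \<omega>
  proof -
    have "cis (u m * (g y * d)) = c d + of_real (g y) * s d" for y d
      using g[of y] by (auto simp: c_def s_def complex_eq_iff)
    note e = this
    show ?thesis unfolding F_eq G_eq sum.lessThan_Suc cis_mult[symmetric] e by (simp add: algebra_simps)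
  qed
  note I = D_indep_integral[OF F_m csm(1) Fi ci(1)] D_indep_integral[OF G_m csm(2) Gi ci(2)]
  have "(\<integral>\<omega>. cis (\<Sum>j<Suc m. u j * (g (W n j \<omega>) * D n j \<omega>)) \<partial>P) =
     (\<integral>\<omega>. F (\<lambda>i\<in>{..<m}. D n i \<omega>) \<partial>P) * (\<integral>\<omega>. c (D n m \<omega>) \<partial>P)"
    unfolding split Bochner_Integration.integral_add[OF I(2,4)] I(1,3) Es by simp
  also have "\<dots> = of_real (exp (- (\<Sum>j<m. (u j)\<^sup>2) / real n / 2)) * of_real (exp (- (u m)\<^sup>2 / real n / 2))"
    unfolding Ec F_eq Suc ..
  also have "\<dots> = of_real (exp (- (\<Sum>j<Suc m. (u j)\<^sup>2) / real n / 2))"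
    by (simp add: of_real_mult[symmetric] exp_add[symmetric] add_divide_distrib diff_divide_distrib del: of_real_mult)
  finally show ?case .
qed (simp add: prob_space)

definition V :: "nat \<Rightarrow> nat \<Rightarrow> 'w \<Rightarrow> real" where
  "V n j \<omega> = - sign (W n j \<omega>) * D n j \<omega>"

lemma V_measurable [measurable]: "V n j \<in> borel_measurable P"
  unfolding V_def by measurable

text \<open>The sign of the current position depends on the past only, and the increments are symmetric.\<close>

lemma distr_signed_increments:
  assumes n: "n > 0"
  shows "distr P (PiM {..<n} (\<lambda>_. borel)) (\<lambda>\<omega>. \<lambda>j\<in>{..<n}. V n j \<omega>) =
    distr P (PiM {..<n} (\<lambda>_. borel)) (\<lambda>\<omega>. \<lambda>j\<in>{..<n}. D n j \<omega>)"
proof (rule distr_PiM_eq_if_cis_integrals_eq[OF finite_measure_axioms finite_measure_axioms V_measurable D_measurable])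
  fix J and u :: "nat \<Rightarrow> real" assume J: "finite J" "J \<subseteq> {..<n}"
  define u' where "u' j = (if j \<in> J then u j else 0)" for j
  have *: "(\<Sum>j\<in>J. u j * f j) = (\<Sum>j<n. u' j * f j)" for f :: "nat \<Rightarrow> real"
    unfolding u'_def using J by (intro sum.mono_neutral_cong_left) auto
  have "(\<integral>\<omega>. cis (\<Sum>j<n. u' j * ((\<lambda>x. - sign x) (W n j \<omega>) * D n j \<omega>)) \<partial>P) =
        (\<integral>\<omega>. cis (\<Sum>j<n. u' j * ((\<lambda>_. 1) (W n j \<omega>) * D n j \<omega>)) \<partial>P)"
    by (subst (1 2) integral_cis_signed_increments[OF n]) (auto simp: sign_def)
  then show "(\<integral>\<omega>. cis (\<Sum>j\<in>J. u j * V n j \<omega>) \<partial>P) = (\<integral>\<omega>. cis (\<Sum>j\<in>J. u j * D n j \<omega>) \<partial>P)"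
    unfolding * V_def by simp
qed

lemma Lam_V: "Lam n k \<omega> = \<bar>W n k \<omega>\<bar> + (\<Sum>j<k. V n j \<omega>)"
  unfolding Lam_def V_def by (simp add: sum_negf)

text \<open>Skorokhod reflection: \<open>Lam\<close> increases only at sign changes of \<open>W\<close>, and after a sign change \<open>\<bar>W\<bar>\<close> is
  at most one increment.\<close>

lemma grid_max_Lam:
  assumes osc: "\<And>j. j < k \<Longrightarrow> \<bar>D n j \<omega>\<bar> \<le> b" and b: "0 \<le> b"
  shows "\<bar>grid_max k (\<lambda>j. V n j \<omega>) - Lam n k \<omega>\<bar> \<le> b"
proof -
  have inc: "Lam n (Suc j) \<omega> - Lam n j \<omega> = \<bar>W n j \<omega> + D n j \<omega>\<bar> - \<bar>W n j \<omega>\<bar> - sign (W n j \<omega>) * D n j \<omega>" for j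
    by (simp add: Lam_def W_Suc)
  have mono: "Lam n i \<omega> \<le> Lam n j \<omega>" if "i \<le> j" for i j
    using that
  proof (induction rule: dec_induct)
    case (step j)
    then show ?case using abs_sign_increment(1)[of "W n j \<omega>" "D n j \<omega>"] inc[of j] by simp
  qed simp
  have "grid_max k (\<lambda>j. V n j \<omega>) \<le> Lam n k \<omega>"
    unfolding grid_max_le_iff
  proof (intro allI impI)
    fix i assume "i \<le> k"
    then have "Lam n i \<omega> \<le> Lam n k \<omega>" by (rule mono)
    then show "(\<Sum>l<i. V n l \<omega>) \<le> Lam n k \<omega>" unfolding Lam_V[of n i] by simp
  qed
  \<comment> \<open>If \<open>Lam\<close> moves at a step, then \<bar>W\<bar> is at most
    \<open>b\<close> afterwards, and by \<open>Lam_V\<close> it exceeds the current partial sum of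
    \<open>V\<close> by at most \<open>b\<close>. If it does not move, the bound is inherited from
    the previous step.\<close>
  moreover have "Lam n k \<omega> \<le> grid_max k (\<lambda>j. V n j \<omega>) + b"
    using osc
  proof (induction k)
    case 0
    then show ?case using b by (simp add: Lam_def W_def grid_max_def)
  next
    case (Suc k)
    have le: "grid_max k (\<lambda>j. V n j \<omega>) \<le> grid_max (Suc k) (\<lambda>j. V n j \<omega>)" by (rule grid_max_mono) simp
    consider "Lam n (Suc k) \<omega> = Lam n k \<omega>" | "\<bar>W n (Suc k) \<omega>\<bar> \<le> \<bar>D n k \<omega>\<bar>"
      using abs_sign_increment(2)[of "W n k \<omega>" "D n k \<omega>"] inc[of k] by (auto simp: W_Suc)
    then show ?case
    proof cases
      case 1
      then show ?thesis using Suc le by fastforce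
    next
      case 2
      then have "\<bar>W n (Suc k) \<omega>\<bar> \<le> b" using Suc.prems[of k] by simp
      then show ?thesis using grid_max_ge[of "Suc k" "Suc k" "\<lambda>j. V n j \<omega>"] unfolding Lam_V by simp
    qed
  qed
  ultimately show ?thesis by simp
qed

lemma grid_max_D_tendsto:
  assumes \<omega>: "\<omega> \<in> space P" and s: "0 \<le> s" "s \<le> 1"
  shows "(\<lambda>n. grid_max (nat \<lfloor>real n * s\<rfloor>) (\<lambda>j. D n j \<omega>)) \<longlonglongrightarrow> running_sup X s \<omega>"
proof -
  have "continuous_on {0..1} (\<lambda>t. X t \<omega>)" by (rule continuous_on_subset[OF X_continuous[OF \<omega>]]) auto
  from running_max_grid_tendsto[OF this s]
  show ?thesis using W_eq[OF \<omega>] unfolding grid_max_def running_sup_def W_def by simp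
qed

lemma oscillation_tendsto:
  assumes \<omega>: "\<omega> \<in> space P" and b: "b > 0"
  shows "\<forall>\<^sub>F n in sequentially. \<forall>j<n. \<bar>D n j \<omega>\<bar> \<le> b"
proof -
  have "uniformly_continuous_on {0..1} (\<lambda>t. X t \<omega>)"
    by (intro compact_uniformly_continuous continuous_on_subset[OF X_continuous[OF \<omega>]]) auto
  then obtain d where d: "d > 0" "\<And>x y. x \<in> {0..1} \<Longrightarrow> y \<in> {0..1} \<Longrightarrow> dist y x < d \<Longrightarrow> dist (X y \<omega>) (X x \<omega>) < b"
    unfolding uniformly_continuous_on_def using b by metis
  have "\<forall>\<^sub>F n in sequentially. 1 / real n < d"
    using lim_1_over_n d(1) by (rule order_tendstoD)
  then show ?thesis using eventually_gt_at_top[of 0]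
  proof eventually_elim
    case (elim n)
    show ?case
    proof (intro allI impI)
      fix j assume j: "j < n"
      have "dist (real (Suc j) / real n) (real j / real n) = 1 / real n"
        by (simp add: dist_real_def diff_divide_distrib[symmetric])
      then have "dist (X (real (Suc j) / real n) \<omega>) (X (real j / real n) \<omega>) < b"
        using j elim by (intro d(2)) auto
      then show "\<bar>D n j \<omega>\<bar> \<le> b" by (simp add: D_def dist_real_def)
    qed
  qed
qed

sublocale brownian_path: continuous_process P 1 X
proof
  show "continuous_on {0..1} (\<lambda>t. X t \<omega>)" if "\<omega> \<in> space P" for \<omega>
    by (rule continuous_on_subset[OF X_continuous[OF that]]) auto
qed (auto intro: X_measurable)

lemma running_sup_measurable: "0 \<le> s \<Longrightarrow> s \<le> 1 \<Longrightarrow> running_sup X s \<in> borel_measurable P"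
  by (rule running_sup_borel_measurable[OF brownian_path.continuous_process_axioms])

text \<open>Identifies the abstract limit of \<open>local_time_exists\<close> with the
  \<open>Lim\<close> in the definition: they agree wherever the limit exists, hence almost
  surely.\<close>

lemma local_time0_L1:
  assumes s: "0 \<le> s" "s \<le> 1"
  shows "AE \<omega> in P. local_time_converges X s \<omega>" "integrable P (local_time0 X s)"
    "(\<lambda>n. \<integral>\<omega>. \<bar>Lam n (nat \<lfloor>real n * s\<rfloor>) \<omega> - local_time0 X s \<omega>\<bar> \<partial>P) \<longlonglongrightarrow> 0"
proof -
  obtain L where L: "integrable P L"
    "AE \<omega> in P. ((\<lambda>e. occupation X s e \<omega>) \<longlongrightarrow> L \<omega>) (at_right 0)"
    "(\<lambda>n. \<integral>\<omega>. \<bar>Lam n (nat \<lfloor>real n * s\<rfloor>) \<omega> - L \<omega>\<bar> \<partial>P) \<longlonglongrightarrow> 0"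
    using local_time_exists[OF s] unfolding occupation_def by blast
  show "AE \<omega> in P. local_time_converges X s \<omega>" using L(2) unfolding local_time_converges_def by eventually_elim auto
  have eq: "AE \<omega> in P. L \<omega> = local_time0 X s \<omega>"
    using L(2) by eventually_elim (simp add: local_time0_eqI)
  have [measurable]: "local_time0 X s \<in> borel_measurable P" by (rule brownian_path.local_time0_measurable[OF s(2)])
  have [measurable]: "L \<in> borel_measurable P" using L(1) by auto
  show "integrable P (local_time0 X s)" by (rule integrable_cong_AE_imp[OF L(1) _ eq]) measurable
  have "(\<integral>\<omega>. \<bar>Lam n (nat \<lfloor>real n * s\<rfloor>) \<omega> - L \<omega>\<bar> \<partial>P) = (\<integral>\<omega>. \<bar>Lam n (nat \<lfloor>real n * s\<rfloor>) \<omega> - local_time0 X s \<omega>\<bar> \<partial>P)" for n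
    using eq by (intro integral_cong_AE) auto
  then show "(\<lambda>n. \<integral>\<omega>. \<bar>Lam n (nat \<lfloor>real n * s\<rfloor>) \<omega> - local_time0 X s \<omega>\<bar> \<partial>P) \<longlonglongrightarrow> 0" using L(3) by simp
qed

text \<open>One functional \<Phi> of the increments is evaluated on \<open>D\<close> and on
  \<open>V\<close>, whose laws agree. On \<open>D\<close> it tends to the left side by continuity of
  paths. On \<open>V\<close> the running maximum is \<open>Lam\<close> up to the largest increment,
  and \<open>Lam\<close> tends to local time.\<close>

theorem levy_cis:
  assumes J: "finite J" "J \<subseteq> {0..1}"
  shows "(\<integral>\<omega>. cis ((\<Sum>s\<in>J. u s * running_sup X s \<omega>) + v * (running_sup X 1 \<omega> - X 1 \<omega>)) \<partial>P) =
    (\<integral>\<omega>. cis ((\<Sum>s\<in>J. u s * local_time0 X s \<omega>) + v * \<bar>X 1 \<omega>\<bar>) \<partial>P)"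
proof -
  define k where "k n s = nat \<lfloor>real n * s\<rfloor>" for n s
  have kn: "k n s \<le> n" if "s \<in> J" for n s unfolding k_def using that J by (intro grid_floor(3)) auto
  have k1: "k n 1 = n" for n by (simp add: k_def)
  define \<Phi> where "\<Phi> n x = cis ((\<Sum>s\<in>J. u s * grid_max (k n s) x) + v * (grid_max n x - (\<Sum>l<n. x l)))" for n x
  have [measurable]: "X 1 \<in> borel_measurable P" by (simp add: X_measurable)
  have [measurable]: "running_sup X s \<in> borel_measurable P" if "s \<in> insert 1 J" for s
    using that J by (intro running_sup_measurable) auto
  have Lm[measurable]: "local_time0 X s \<in> borel_measurable P" if "s \<in> J" for s
    using local_time0_L1(2)[of s] that J by auto
  have \<Phi>m[measurable]: "\<Phi> n \<in> borel_measurable (PiM {..<n} (\<lambda>_. borel))" for n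
    unfolding \<Phi>_def
    by (intro measurable_compose[OF _ borel_measurable_cis] borel_measurable_add borel_measurable_sum borel_measurable_times
      borel_measurable_diff borel_measurable_const grid_max_measurable kn measurable_component_singleton) auto
  have restr: "\<Phi> n (\<lambda>j\<in>{..<n}. x j) = \<Phi> n x" for n x
    unfolding \<Phi>_def using kn by (intro arg_cong[where f=cis] arg_cong2[where f="(+)"] arg_cong2[where f="(*)"]
       arg_cong2[where f="(-)"] sum.cong grid_max_cong refl) (auto dest: less_le_trans[OF _ kn])
  have mD: "(\<lambda>\<omega>. \<lambda>j\<in>{..<n}. D n j \<omega>) \<in> measurable P (PiM {..<n} (\<lambda>_. borel))"
    and mV: "(\<lambda>\<omega>. \<lambda>j\<in>{..<n}. V n j \<omega>) \<in> measurable P (PiM {..<n} (\<lambda>_. borel))" for n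
    by (intro measurable_restrict; measurable)+
  have \<Phi>D[measurable]: "(\<lambda>\<omega>. \<Phi> n (\<lambda>j. D n j \<omega>)) \<in> borel_measurable P" for n
    using measurable_compose[OF mD \<Phi>m, of n] unfolding restr .
  have \<Phi>V[measurable]: "(\<lambda>\<omega>. \<Phi> n (\<lambda>j. V n j \<omega>)) \<in> borel_measurable P" for n
    using measurable_compose[OF mV \<Phi>m, of n] unfolding restr .
  have law: "(\<integral>\<omega>. \<Phi> n (\<lambda>j. D n j \<omega>) \<partial>P) = (\<integral>\<omega>. \<Phi> n (\<lambda>j. V n j \<omega>) \<partial>P)" if "n > 0" for n
  proof -
    have "(\<integral>x. \<Phi> n x \<partial>distr P (PiM {..<n} (\<lambda>_. borel)) (\<lambda>\<omega>. \<lambda>j\<in>{..<n}. V n j \<omega>)) =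
       (\<integral>x. \<Phi> n x \<partial>distr P (PiM {..<n} (\<lambda>_. borel)) (\<lambda>\<omega>. \<lambda>j\<in>{..<n}. D n j \<omega>))"
      by (simp only: distr_signed_increments[OF that])
    then show ?thesis unfolding integral_distr[OF mD \<Phi>m] integral_distr[OF mV \<Phi>m] restr ..
  qed
  let ?S = "\<integral>\<omega>. cis ((\<Sum>s\<in>J. u s * running_sup X s \<omega>) + v * (running_sup X 1 \<omega> - X 1 \<omega>)) \<partial>P"
  let ?L = "\<integral>\<omega>. cis ((\<Sum>s\<in>J. u s * local_time0 X s \<omega>) + v * \<bar>X 1 \<omega>\<bar>) \<partial>P"
  have W1: "W n n \<omega> = X 1 \<omega>" if "\<omega> \<in> space P" "n > 0" for n \<omega> using W_eq[OF that(1), of n n] that(2) by simp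
  have limS: "(\<lambda>n. \<integral>\<omega>. \<Phi> n (\<lambda>j. D n j \<omega>) \<partial>P) \<longlonglongrightarrow> ?S"
  proof (rule integral_dominated_convergence[where w="\<lambda>_. 1"])
    have cc: "isCont cis x" for x by (rule continuous_intros isCont_def[THEN iffD2] tendsto_intros)+
    show "AE \<omega> in P. (\<lambda>n. \<Phi> n (\<lambda>j. D n j \<omega>)) \<longlonglongrightarrow> cis ((\<Sum>s\<in>J. u s * running_sup X s \<omega>) + v * (running_sup X 1 \<omega> - X 1 \<omega>))"
    proof (rule AE_I2)
      fix \<omega> assume \<omega>: "\<omega> \<in> space P"
      have "(\<lambda>n. W n n \<omega>) \<longlonglongrightarrow> X 1 \<omega>"
        by (rule tendsto_eventually, rule eventually_mono[OF eventually_gt_at_top[of 0]]) (rule W1[OF \<omega>])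
      moreover have "(\<lambda>n. grid_max n (\<lambda>j. D n j \<omega>)) \<longlonglongrightarrow> running_sup X 1 \<omega>"
        using grid_max_D_tendsto[OF \<omega>, of 1] by simp
      moreover have "(\<lambda>n. grid_max (k n s) (\<lambda>j. D n j \<omega>)) \<longlonglongrightarrow> running_sup X s \<omega>" if "s \<in> J" for s
        unfolding k_def using that J by (intro grid_max_D_tendsto[OF \<omega>]) auto
      ultimately show "(\<lambda>n. \<Phi> n (\<lambda>j. D n j \<omega>)) \<longlonglongrightarrow> cis ((\<Sum>s\<in>J. u s * running_sup X s \<omega>) + v * (running_sup X 1 \<omega> - X 1 \<omega>))"
        unfolding \<Phi>_def W_def[symmetric] by (intro isCont_tendsto_compose[OF cc] tendsto_intros)
    qed
    show "AE \<omega> in P. norm (\<Phi> n (\<lambda>j. D n j \<omega>)) \<le> 1" for n by (simp add: \<Phi>_def)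
    show "(\<lambda>\<omega>. \<Phi> n (\<lambda>j. D n j \<omega>)) \<in> borel_measurable P" for n by (rule \<Phi>D)
    show "(\<lambda>\<omega>. cis ((\<Sum>s\<in>J. u s * running_sup X s \<omega>) + v * (running_sup X 1 \<omega> - X 1 \<omega>))) \<in> borel_measurable P"
      by measurable
  qed simp
  have limL: "(\<lambda>n. \<integral>\<omega>. \<Phi> n (\<lambda>j. V n j \<omega>) \<partial>P) \<longlonglongrightarrow> ?L"
  proof -
    define Z where "Z n \<omega> = cis ((\<Sum>s\<in>J. u s * Lam n (k n s) \<omega>) + v * \<bar>W n n \<omega>\<bar>)" for n \<omega>
    have [measurable]: "Z n \<in> borel_measurable P" for n unfolding Z_def by measurable
    have Zi: "integrable P (Z n)" for n by (intro integrable_const_bound[of _ 1]) (auto simp: Z_def)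
    have \<Phi>Vi: "integrable P (\<lambda>\<omega>. \<Phi> n (\<lambda>j. V n j \<omega>))" for n
      by (intro integrable_const_bound[of _ 1] AE_I2 \<Phi>V) (auto simp: \<Phi>_def)
    have "(\<lambda>n. \<integral>\<omega>. \<Phi> n (\<lambda>j. V n j \<omega>) - Z n \<omega> \<partial>P) \<longlonglongrightarrow> (\<integral>\<omega>. 0 \<partial>P)"
    proof (rule integral_dominated_convergence[where w="\<lambda>_. 2"])
      show "AE \<omega> in P. (\<lambda>n. \<Phi> n (\<lambda>j. V n j \<omega>) - Z n \<omega>) \<longlonglongrightarrow> 0"
      proof (rule AE_I2, rule tendstoI)
        fix \<omega> and e :: real assume \<omega>: "\<omega> \<in> space P" and e: "e > 0"
        define B where "B = (\<Sum>s\<in>J. \<bar>u s\<bar>) + \<bar>v\<bar> + 1"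
        have B: "B > 0" unfolding B_def by (intro add_nonneg_pos add_nonneg_nonneg sum_nonneg) auto
        have "\<forall>\<^sub>F n in sequentially. \<forall>j<n. \<bar>D n j \<omega>\<bar> \<le> e / B / 2"
          using e B by (intro oscillation_tendsto[OF \<omega>]) auto
        then show "\<forall>\<^sub>F n in sequentially. dist (\<Phi> n (\<lambda>j. V n j \<omega>) - Z n \<omega>) 0 < e"
        proof eventually_elim
          case (elim n)
          define b where "b = e / B / 2"
          have b: "b > 0" using e B by (simp add: b_def)
          have g: "\<bar>grid_max i (\<lambda>j. V n j \<omega>) - Lam n i \<omega>\<bar> \<le> b" if "i \<le> n" for i
            using elim that b unfolding b_def by (intro grid_max_Lam) auto
          \<comment> \<open>Since \<open>Lam\<close> is \<bar>W\<bar> plus the partial sum of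
            \<open>V\<close>, the error in the last component is again that of the maximum against
            \<open>Lam\<close> and needs no separate estimate.\<close>
          have n: "grid_max n (\<lambda>j. V n j \<omega>) - (\<Sum>l<n. V n l \<omega>) - \<bar>W n n \<omega>\<bar> = grid_max n (\<lambda>j. V n j \<omega>) - Lam n n \<omega>"
            by (simp add: Lam_V)
          have "norm (\<Phi> n (\<lambda>j. V n j \<omega>) - Z n \<omega>) \<le>
            \<bar>((\<Sum>s\<in>J. u s * grid_max (k n s) (\<lambda>j. V n j \<omega>)) + v * (grid_max n (\<lambda>j. V n j \<omega>) - (\<Sum>l<n. V n l \<omega>)))
              - ((\<Sum>s\<in>J. u s * Lam n (k n s) \<omega>) + v * \<bar>W n n \<omega>\<bar>)\<bar>"
            unfolding \<Phi>_def Z_def by (rule norm_cis_diff)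
          also have "\<dots> = \<bar>(\<Sum>s\<in>J. u s * (grid_max (k n s) (\<lambda>j. V n j \<omega>) - Lam n (k n s) \<omega>)) + v * (grid_max n (\<lambda>j. V n j \<omega>) - Lam n n \<omega>)\<bar>"
            unfolding n[symmetric] by (simp add: right_diff_distrib sum_subtractf)
          also have "\<dots> \<le> (\<Sum>s\<in>J. \<bar>u s\<bar> * b) + \<bar>v\<bar> * b"
            using g kn by (intro order_trans[OF abs_triangle_ineq] add_mono order_trans[OF sum_abs] sum_mono)
              (auto simp: abs_mult intro!: mult_left_mono)
          also have "\<dots> \<le> B * b" using b unfolding B_def by (simp add: sum_distrib_right distrib_right)
          also have "\<dots> < e" using e B by (simp add: b_def)
          finally show ?case by simp
        qed
      qed
      show "AE \<omega> in P. norm (\<Phi> n (\<lambda>j. V n j \<omega>) - Z n \<omega>) \<le> 2" for n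
        unfolding \<Phi>_def Z_def by (intro AE_I2 norm_cis_diff_le_2)
    qed auto
    \<comment> \<open>\<open>Lam\<close> is known to converge only in L1, so this comparison goes
      through expectations, using that \<open>cis\<close> is 1-Lipschitz; the term \<bar>W n n\<bar>
      is exactly \<bar>X 1\<bar>.\<close>
    moreover have "(\<lambda>n. \<integral>\<omega>. Z n \<omega> \<partial>P) \<longlonglongrightarrow> ?L"
    proof (rule Lim_transform2)
      show "(\<lambda>n. ?L) \<longlonglongrightarrow> ?L" by simp
      have Li: "integrable P (\<lambda>\<omega>. cis ((\<Sum>s\<in>J. u s * local_time0 X s \<omega>) + v * \<bar>X 1 \<omega>\<bar>))"
        by (intro integrable_const_bound[of _ 1] AE_I2) auto
      show "(\<lambda>n. ?L - (\<integral>\<omega>. Z n \<omega> \<partial>P)) \<longlonglongrightarrow> 0"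
      proof (rule Lim_null_comparison)
        show "(\<lambda>n. \<Sum>s\<in>J. \<bar>u s\<bar> * (\<integral>\<omega>. \<bar>Lam n (k n s) \<omega> - local_time0 X s \<omega>\<bar> \<partial>P)) \<longlonglongrightarrow> 0"
          unfolding k_def using J by (intro tendsto_null_sum tendsto_mult_right_zero local_time0_L1(3)) auto
        show "\<forall>\<^sub>F n in sequentially. norm (?L - (\<integral>\<omega>. Z n \<omega> \<partial>P)) \<le> (\<Sum>s\<in>J. \<bar>u s\<bar> * (\<integral>\<omega>. \<bar>Lam n (k n s) \<omega> - local_time0 X s \<omega>\<bar> \<partial>P))"
          using eventually_gt_at_top[of 0]
        proof eventually_elim
          case (elim n)
          have i: "integrable P (\<lambda>\<omega>. \<bar>Lam n (k n s) \<omega> - local_time0 X s \<omega>\<bar>)" if "s \<in> J" for s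
            unfolding k_def
            by (intro integrable_abs Bochner_Integration.integrable_diff Lam_integrable local_time0_L1(2)) (use that J elim in auto)
          have "norm (?L - (\<integral>\<omega>. Z n \<omega> \<partial>P)) = norm (\<integral>\<omega>. cis ((\<Sum>s\<in>J. u s * local_time0 X s \<omega>) + v * \<bar>X 1 \<omega>\<bar>) - Z n \<omega> \<partial>P)"
            using Li Zi by simp
          also have "\<dots> \<le> (\<integral>\<omega>. norm (cis ((\<Sum>s\<in>J. u s * local_time0 X s \<omega>) + v * \<bar>X 1 \<omega>\<bar>) - Z n \<omega>) \<partial>P)"
            by (rule integral_norm_bound)
          also have "\<dots> \<le> (\<integral>\<omega>. (\<Sum>s\<in>J. \<bar>u s\<bar> * \<bar>Lam n (k n s) \<omega> - local_time0 X s \<omega>\<bar>) \<partial>P)"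
          proof (rule integral_mono)
            show "integrable P (\<lambda>\<omega>. norm (cis ((\<Sum>s\<in>J. u s * local_time0 X s \<omega>) + v * \<bar>X 1 \<omega>\<bar>) - Z n \<omega>))"
              using Li Zi by auto
            show "integrable P (\<lambda>\<omega>. \<Sum>s\<in>J. \<bar>u s\<bar> * \<bar>Lam n (k n s) \<omega> - local_time0 X s \<omega>\<bar>)"
              using i by (intro Bochner_Integration.integrable_sum integrable_mult_right) auto
            fix \<omega> assume \<omega>: "\<omega> \<in> space P"
            have "norm (cis ((\<Sum>s\<in>J. u s * local_time0 X s \<omega>) + v * \<bar>X 1 \<omega>\<bar>) - Z n \<omega>) \<le>
              \<bar>((\<Sum>s\<in>J. u s * local_time0 X s \<omega>) + v * \<bar>X 1 \<omega>\<bar>) - ((\<Sum>s\<in>J. u s * Lam n (k n s) \<omega>) + v * \<bar>W n n \<omega>\<bar>)\<bar>"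
              unfolding Z_def by (rule norm_cis_diff)
            also have "\<dots> = \<bar>\<Sum>s\<in>J. u s * (local_time0 X s \<omega> - Lam n (k n s) \<omega>)\<bar>"
              unfolding W1[OF \<omega> elim] by (simp add: right_diff_distrib sum_subtractf)
            also have "\<dots> \<le> (\<Sum>s\<in>J. \<bar>u s\<bar> * \<bar>Lam n (k n s) \<omega> - local_time0 X s \<omega>\<bar>)"
              by (intro order_trans[OF sum_abs] sum_mono) (simp add: abs_mult abs_minus_commute)
            finally show "norm (cis ((\<Sum>s\<in>J. u s * local_time0 X s \<omega>) + v * \<bar>X 1 \<omega>\<bar>) - Z n \<omega>) \<le>
              (\<Sum>s\<in>J. \<bar>u s\<bar> * \<bar>Lam n (k n s) \<omega> - local_time0 X s \<omega>\<bar>)" .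
          qed
          also have "\<dots> = (\<Sum>s\<in>J. \<bar>u s\<bar> * (\<integral>\<omega>. \<bar>Lam n (k n s) \<omega> - local_time0 X s \<omega>\<bar> \<partial>P))"
            using i by (subst Bochner_Integration.integral_sum) auto
          finally show ?case .
        qed
      qed
    qed
    ultimately have "(\<lambda>n. (\<integral>\<omega>. \<Phi> n (\<lambda>j. V n j \<omega>) - Z n \<omega> \<partial>P) + (\<integral>\<omega>. Z n \<omega> \<partial>P)) \<longlonglongrightarrow> 0 + ?L"
      by (intro tendsto_add) simp_all
    then show ?thesis using Zi \<Phi>Vi by simp
  qed
  have "\<forall>\<^sub>F n in sequentially. (\<integral>\<omega>. \<Phi> n (\<lambda>j. V n j \<omega>) \<partial>P) = (\<integral>\<omega>. \<Phi> n (\<lambda>j. D n j \<omega>) \<partial>P)"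
    using eventually_gt_at_top[of 0] by eventually_elim (rule law[symmetric])
  from LIMSEQ_unique[OF limS Lim_transform_eventually[OF limL this]] show ?thesis .
qed

end

section \<open>Conditioning on the final value\<close>

lemma sum_double_insert:
  fixes f :: "'i \<Rightarrow> 'i \<Rightarrow> real"
  assumes "finite J" "a \<notin> J" "\<And>s t. f s t = f t s"
  shows "(\<Sum>s\<in>insert a J. \<Sum>t\<in>insert a J. f s t) = (\<Sum>s\<in>J. \<Sum>t\<in>J. f s t) + 2 * (\<Sum>t\<in>J. f a t) + f a a"
proof -
  have "(\<Sum>s\<in>insert a J. \<Sum>t\<in>insert a J. f s t) = f a a + (\<Sum>t\<in>J. f a t) + (\<Sum>s\<in>J. f s a + (\<Sum>t\<in>J. f s t))"
    using assms by simp
  also have "(\<Sum>s\<in>J. f s a + (\<Sum>t\<in>J. f s t)) = (\<Sum>t\<in>J. f a t) + (\<Sum>s\<in>J. \<Sum>t\<in>J. f s t)"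
    using assms(3) by (simp add: sum.distrib)
  finally show ?thesis by simp
qed

text \<open>The characteristic function of the normal law of variance 1 / \<delta> is, up to a
  factor, the density of variance \<delta>.\<close>

lemma normal_density_fourier:
  assumes "\<delta> > 0"
  shows "(\<integral>v. cis (v * x) \<partial>density lborel (normal_density 0 (1 / sqrt \<delta>))) =
    of_real (normal_density 0 (sqrt \<delta>) x * sqrt (2 * pi * \<delta>))"
proof -
  interpret N: prob_space "density lborel (normal_density 0 (1 / sqrt \<delta>))"
    using assms by (intro prob_space_normal_density) simp
  have "distributed (density lborel (normal_density 0 (1 / sqrt \<delta>))) lborel (\<lambda>v. v) (normal_density 0 (1 / sqrt \<delta>))"
    unfolding distributed_def by (auto simp: distr_id2)
  from N.integral_cis_normal[OF this, of x] assms show ?thesis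
    by (simp add: mult.commute[of x] normal_density_def power_divide)
qed

lemma normal_density_bound: "\<sigma> > 0 \<Longrightarrow> normal_density 0 \<sigma> x \<le> normal_density 0 \<sigma> 0"
  by (auto simp: normal_density_def divide_simps)

text \<open>With \<sigma>^2 = 1 - c this is the conditional probability of \<bar>X 1\<bar> < e given
  that X is at \<open>x\<close> at time \<open>c\<close>.\<close>

definition ball_mass :: "real \<Rightarrow> real \<Rightarrow> real \<Rightarrow> real" where
  "ball_mass \<sigma> e x = (\<integral>y. (if \<bar>x + y\<bar> < e then 1 else 0 :: real) \<partial>density lborel (normal_density 0 \<sigma>))"

text \<open>The substitution y = e z - x fixes the domain of integration and moves \<open>e\<close>
  into the integrand, where it can tend to 0.\<close>

lemma ball_mass_eq:
  assumes "\<sigma> > 0" "e > 0"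
  shows "ball_mass \<sigma> e x = e * (\<integral>z. indicator {-1<..<1} z * normal_density 0 \<sigma> (e * z - x) \<partial>lborel)"
proof -
  have "ball_mass \<sigma> e x = (\<integral>y. normal_density 0 \<sigma> y * (if \<bar>x + y\<bar> < e then 1 else 0 :: real) \<partial>lborel)"
    unfolding ball_mass_def by (subst integral_real_density) auto
  also have "\<dots> = \<bar>e\<bar> *\<^sub>R (\<integral>z. normal_density 0 \<sigma> (- x + e * z) * (if \<bar>x + (- x + e * z)\<bar> < e then 1 else 0 :: real) \<partial>lborel)"
    using assms by (intro lborel_integral_real_affine) simp
  also have "(\<lambda>z. normal_density 0 \<sigma> (- x + e * z) * (if \<bar>x + (- x + e * z)\<bar> < e then 1 else 0 :: real)) =
      (\<lambda>z. indicator {-1<..<1} z * normal_density 0 \<sigma> (e * z - x))"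
  proof
    fix z
    have "\<bar>x + (- x + e * z)\<bar> < e \<longleftrightarrow> z \<in> {-1<..<1}"
      using assms by (simp add: abs_mult abs_less_iff conj_commute)
    then show "normal_density 0 \<sigma> (- x + e * z) * (if \<bar>x + (- x + e * z)\<bar> < e then 1 else 0 :: real) =
      indicator {-1<..<1} z * normal_density 0 \<sigma> (e * z - x)" by (simp add: indicator_def)
  qed
  finally show ?thesis using assms by simp
qed

lemma normal_density_continuous: "isCont (normal_density \<mu> \<sigma>) x"
  unfolding normal_density_def[abs_def] by (cases "\<sigma> = 0") (auto intro!: continuous_intros)

text \<open>The average of a continuous density over a shrinking interval. The bounds are uniform in
  \<open>x\<close> and \<open>n\<close> and provide the dominating constant in
  \<open>conditioned_limit\<close>.\<close>

lemma ball_mass_limit: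
  assumes \<sigma>: "\<sigma> > 0" and e: "\<And>n. e n > 0" "e \<longlonglongrightarrow> 0"
  shows "(\<lambda>n. ball_mass \<sigma> (e n) x / (2 * e n)) \<longlonglongrightarrow> normal_density 0 \<sigma> x"
    and "0 \<le> ball_mass \<sigma> (e n) x / (2 * e n)" "ball_mass \<sigma> (e n) x / (2 * e n) \<le> normal_density 0 \<sigma> 0"
proof -
  define I where "I n = (\<integral>z. indicator {-1<..<1::real} z * normal_density 0 \<sigma> (e n * z - x) \<partial>lborel)" for n
  have eq: "ball_mass \<sigma> (e n) x / (2 * e n) = I n / 2" for n
    using ball_mass_eq[OF \<sigma> e(1)] e(1)[of n] unfolding I_def by simp
  have w: "integrable lborel (\<lambda>z::real. indicator {-1<..<1::real} z * normal_density 0 \<sigma> 0)"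
    by (intro integrable_mult_left integrable_real_indicator) auto
  have bd: "norm (indicator {-1<..<1::real} z * normal_density 0 \<sigma> y) \<le> indicator {-1<..<1::real} z * normal_density 0 \<sigma> 0" for z y :: real
    using normal_density_bound[OF \<sigma>] by (auto simp: indicator_def)
  have "I \<longlonglongrightarrow> (\<integral>z. indicator {-1<..<1::real} z * normal_density 0 \<sigma> x \<partial>lborel)"
    unfolding I_def
  proof (rule integral_dominated_convergence[where w="\<lambda>z. indicator {-1<..<1::real} z * normal_density 0 \<sigma> 0"])
    show "integrable lborel (\<lambda>z::real. indicator {-1<..<1::real} z * normal_density 0 \<sigma> 0)" by (rule w)
    have "(\<lambda>n. normal_density 0 \<sigma> (e n * z - x)) \<longlonglongrightarrow> normal_density 0 \<sigma> (0 * z - x)" for z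
      by (intro isCont_tendsto_compose[OF normal_density_continuous] tendsto_intros e)
    moreover have "normal_density 0 \<sigma> (0 * z - x) = normal_density 0 \<sigma> x" for z by (simp add: normal_density_def)
    ultimately show "AE z in lborel. (\<lambda>n. indicator {-1<..<1::real} z * normal_density 0 \<sigma> (e n * z - x)) \<longlonglongrightarrow> indicator {-1<..<1::real} z * normal_density 0 \<sigma> x"
      by (intro AE_I2 tendsto_mult_left) simp
  qed (use bd in auto)
  from tendsto_divide[OF this tendsto_const[of 2]]
  show "(\<lambda>n. ball_mass \<sigma> (e n) x / (2 * e n)) \<longlonglongrightarrow> normal_density 0 \<sigma> x"
    unfolding eq by simp
  have "0 \<le> I n" unfolding I_def by (rule Bochner_Integration.integral_nonneg) auto
  then show "0 \<le> ball_mass \<sigma> (e n) x / (2 * e n)" unfolding eq by simp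
  have "I n \<le> (\<integral>z. indicator {-1<..<1::real} z * normal_density 0 \<sigma> 0 \<partial>lborel)"
    unfolding I_def
  proof (rule integral_mono[OF _ w])
    show "integrable lborel (\<lambda>z. indicator {-1<..<1::real} z * normal_density 0 \<sigma> (e n * z - x))"
      using bd order_trans[OF bd abs_ge_self] by (intro Bochner_Integration.integrable_bound[OF w]) auto
    show "indicator {-1<..<1::real} z * normal_density 0 \<sigma> (e n * z - x) \<le> indicator {-1<..<1::real} z * normal_density 0 \<sigma> 0" for z
      using normal_density_bound[OF \<sigma>] by (intro mult_left_mono) auto
  qed
  then show "ball_mass \<sigma> (e n) x / (2 * e n) \<le> normal_density 0 \<sigma> 0" unfolding eq by simp
qed

lemma ball_mass_measurable:
  assumes "\<sigma> > 0"
  shows "ball_mass \<sigma> e \<in> borel_measurable borel"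
proof -
  interpret prob_space "density lborel (normal_density 0 \<sigma>)" by (rule prob_space_normal_density[OF assms])
  have "(\<lambda>(x, y). if \<bar>x + y\<bar> < e then 1 else 0 :: real) \<in> borel_measurable (borel \<Otimes>\<^sub>M lborel)"
    by measurable
  then have "(\<lambda>(x, y). if \<bar>x + y\<bar> < e then 1 else 0 :: real) \<in> borel_measurable (borel \<Otimes>\<^sub>M density lborel (normal_density 0 \<sigma>))"
    by (subst measurable_cong_sets[OF sets_pair_measure_cong refl]) auto
  from borel_measurable_lebesgue_integral[OF this] show ?thesis
    unfolding ball_mass_def[abs_def] .
qed

section \<open>The Markov property at time c and the density of the bridge\<close>

context brownian_motion
begin

text \<open>In place of conditional expectations, the path on [0, c] together with the value at 1 is
  realised in law on a product space, as the path followed by an independent normal jump;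
  integrating out the jump by Fubini leaves \<open>ball_mass\<close>.\<close>

lemma markov_at:
  fixes G :: "(real \<Rightarrow> real) \<Rightarrow> complex"
  assumes c: "0 \<le> c" "c < 1"
    and [measurable]: "G \<in> borel_measurable (PiM {0..c} (\<lambda>_. borel))" and G: "\<And>x. norm (G x) \<le> 1"
  shows "(\<integral>\<omega>. (if \<bar>X 1 \<omega>\<bar> < e then 1 else 0 :: real) *\<^sub>R G (\<lambda>t\<in>{0..c}. X t \<omega>) \<partial>P) =
    (\<integral>\<omega>. ball_mass (sqrt (1 - c)) e (X c \<omega>) *\<^sub>R G (\<lambda>t\<in>{0..c}. X t \<omega>) \<partial>P)"
proof -
  define \<delta> where "\<delta> = 1 - c"
  have \<delta>: "\<delta> > 0" using c by (simp add: \<delta>_def)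
  define N where "N = density lborel (normal_density 0 (sqrt \<delta>))"
  interpret N: prob_space N unfolding N_def using \<delta> by (intro prob_space_normal_density) simp
  interpret PN: pair_prob_space P N ..
  have sN[measurable_cong]: "sets N = sets borel" by (simp add: N_def)
  let ?I = "insert 1 {0..c}"
  have Xm: "X t \<in> borel_measurable P" if "t \<in> ?I" for t using that c by (intro X_measurable) auto
  \<comment> \<open>The path is frozen at time \<open>c\<close>, and only index 1, which lies beyond
    \<open>c\<close>, receives the independent increment.\<close>
  define Z where "Z t = (\<lambda>(\<omega>, y). X (min t c) \<omega> + (if t = 1 then y else 0))" for t :: real
  have Zm: "Z t \<in> borel_measurable (P \<Otimes>\<^sub>M N)" if "t \<in> ?I" for t
  proof -
    have [measurable]: "X (min t c) \<in> borel_measurable P" using that c by (intro X_measurable) auto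
    show ?thesis unfolding Z_def by measurable
  qed
  have law: "distr P (PiM ?I (\<lambda>_. borel)) (\<lambda>\<omega>. \<lambda>t\<in>?I. X t \<omega>) = distr (P \<Otimes>\<^sub>M N) (PiM ?I (\<lambda>_. borel)) (\<lambda>z. \<lambda>t\<in>?I. Z t z)"
  proof (rule distr_PiM_eq_if_cis_integrals_eq[OF finite_measure_axioms PN.finite_measure_axioms Xm Zm])
    fix J and u :: "real \<Rightarrow> real" assume J: "finite J" "J \<subseteq> ?I"
    define u1 where "u1 = (if 1 \<in> J then u 1 else 0)"
    have min: "min s t = min (min s c) (min t c) + (if s = 1 \<and> t = 1 then \<delta> else 0)" if "s \<in> J" "t \<in> J" for s t
      using that J c by (auto simp: \<delta>_def min_def)
    have "(\<Sum>s\<in>J. \<Sum>t\<in>J. u s * u t * min s t) = (\<Sum>s\<in>J. \<Sum>t\<in>J. u s * u t * min (min s c) (min t c) + u s * u t * (if s = 1 \<and> t = 1 then \<delta> else 0))"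
      by (intro sum.cong refl) (simp only: min distrib_left)
    also have "\<dots> = (\<Sum>s\<in>J. \<Sum>t\<in>J. u s * u t * min (min s c) (min t c)) + (\<Sum>s\<in>J. \<Sum>t\<in>J. u s * u t * (if s = 1 \<and> t = 1 then \<delta> else 0))"
      by (simp only: sum.distrib)
    also have "(\<Sum>s\<in>J. \<Sum>t\<in>J. u s * u t * (if s = 1 \<and> t = 1 then \<delta> else 0)) = u1\<^sup>2 * \<delta>"
    proof -
      have "(\<Sum>t\<in>J. u s * u t * (if s = 1 \<and> t = 1 then \<delta> else 0)) = (if s = 1 then u s * u1 * \<delta> else 0)" for s
      proof (cases "s = 1")
        case True
        have "(\<Sum>t\<in>J. u s * u t * (if s = 1 \<and> t = 1 then \<delta> else 0)) = (\<Sum>t\<in>J. if t = 1 then u s * u 1 * \<delta> else 0)"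
          using True by (intro sum.cong) auto
        then show ?thesis using True J by (simp add: u1_def)
      qed simp
      then have "(\<Sum>s\<in>J. \<Sum>t\<in>J. u s * u t * (if s = 1 \<and> t = 1 then \<delta> else 0)) = (\<Sum>s\<in>J. if s = 1 then u 1 * u1 * \<delta> else 0)"
        by (simp cong: if_cong)
      then show ?thesis using J by (simp add: u1_def power2_eq_square)
    qed
    finally have var: "(\<Sum>s\<in>J. \<Sum>t\<in>J. u s * u t * min s t) = (\<Sum>s\<in>J. \<Sum>t\<in>J. u s * u t * min (min s c) (min t c)) + u1\<^sup>2 * \<delta>" .
    have X1: "(\<integral>\<omega>. cis (\<Sum>t\<in>J. u t * X t \<omega>) \<partial>P) = of_real (exp (- (\<Sum>s\<in>J. \<Sum>t\<in>J. u s * u t * min s t) / 2))"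
      using J c by (intro integral_cis_brownian_motion[where T="\<lambda>t. t"]) auto
    have Xc: "(\<integral>\<omega>. cis (\<Sum>t\<in>J. u t * X (min t c) \<omega>) \<partial>P) = of_real (exp (- (\<Sum>s\<in>J. \<Sum>t\<in>J. u s * u t * min (min s c) (min t c)) / 2))"
      using J c by (intro integral_cis_brownian_motion) auto
    have dist: "distributed N lborel (\<lambda>y. y) (normal_density 0 (sqrt \<delta>))"
      unfolding distributed_def N_def by (auto simp: distr_id2)
    have Ny: "(\<integral>y. cis (u1 * y) \<partial>N) = of_real (exp (- u1\<^sup>2 * \<delta> / 2))"
      using N.integral_cis_normal[OF dist, of u1] \<delta> by (simp add: power_mult_distrib)
    have split: "cis (\<Sum>t\<in>J. u t * Z t (\<omega>, y)) = cis (\<Sum>t\<in>J. u t * X (min t c) \<omega>) * cis (u1 * y)" for \<omega> y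
    proof -
      have "(\<Sum>t\<in>J. u t * Z t (\<omega>, y)) = (\<Sum>t\<in>J. u t * X (min t c) \<omega>) + (\<Sum>t\<in>J. if t = 1 then u 1 * y else 0)"
        unfolding Z_def sum.distrib[symmetric] by (intro sum.cong) (auto simp: distrib_left)
      also have "(\<Sum>t\<in>J. if t = 1 then u 1 * y else 0) = u1 * y" using J by (simp add: u1_def)
      finally show ?thesis by (simp add: cis_mult)
    qed
    have Zi: "integrable (P \<Otimes>\<^sub>M N) (\<lambda>z. cis (\<Sum>t\<in>J. u t * Z t z))"
      using J Zm by (intro PN.integrable_const_bound[of _ 1] AE_I2 measurable_compose[OF _ borel_measurable_cis] borel_measurable_sum borel_measurable_times) auto
    have "(\<integral>z. cis (\<Sum>t\<in>J. u t * Z t z) \<partial>(P \<Otimes>\<^sub>M N)) = (\<integral>\<omega>. (\<integral>y. cis (\<Sum>t\<in>J. u t * Z t (\<omega>, y)) \<partial>N) \<partial>P)"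
      by (rule PN.integral_fst'[symmetric]) (rule Zi)
    also have "\<dots> = (\<integral>\<omega>. cis (\<Sum>t\<in>J. u t * X (min t c) \<omega>) \<partial>P) * (\<integral>y. cis (u1 * y) \<partial>N)"
      unfolding split by simp
    also have "\<dots> = of_real (exp (- (\<Sum>s\<in>J. \<Sum>t\<in>J. u s * u t * min s t) / 2))"
      unfolding Xc Ny var by (simp add: of_real_mult[symmetric] exp_add[symmetric] add_divide_distrib diff_divide_distrib del: of_real_mult)
    finally show "(\<integral>\<omega>. cis (\<Sum>t\<in>J. u t * X t \<omega>) \<partial>P) = (\<integral>z. cis (\<Sum>t\<in>J. u t * Z t z) \<partial>(P \<Otimes>\<^sub>M N))"
      unfolding X1 by simp
  qed
  define H where "H x = (if \<bar>x 1\<bar> < e then 1 else 0 :: real) *\<^sub>R G (restrict x {0..c})" for x :: "real \<Rightarrow> real"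
  have Hm: "H \<in> borel_measurable (PiM ?I (\<lambda>_. borel))"
  proof -
    have [measurable]: "(\<lambda>x. G (restrict x {0..c})) \<in> borel_measurable (PiM ?I (\<lambda>_. borel))"
      by (rule measurable_compose[OF measurable_restrict_subset]) auto
    have [measurable]: "(\<lambda>x. x 1) \<in> borel_measurable (PiM ?I (\<lambda>_. borel :: real measure))"
      by (rule measurable_component_singleton) auto
    show ?thesis unfolding H_def by measurable
  qed
  have mX: "(\<lambda>\<omega>. \<lambda>t\<in>?I. X t \<omega>) \<in> measurable P (PiM ?I (\<lambda>_. borel))"
    by (intro measurable_restrict Xm)
  have mZ: "(\<lambda>z. \<lambda>t\<in>?I. Z t z) \<in> measurable (P \<Otimes>\<^sub>M N) (PiM ?I (\<lambda>_. borel))"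
    by (intro measurable_restrict Zm)
  have resX: "restrict (\<lambda>t\<in>?I. X t \<omega>) {0..c} = (\<lambda>t\<in>{0..c}. X t \<omega>)" for \<omega> by (auto simp: fun_eq_iff)
  have resZ: "restrict (\<lambda>t\<in>?I. Z t (\<omega>, y)) {0..c} = (\<lambda>t\<in>{0..c}. X t \<omega>)" for \<omega> y
    using c by (auto simp: fun_eq_iff Z_def min_absorb1)
  have HX: "H (\<lambda>t\<in>?I. X t \<omega>) = (if \<bar>X 1 \<omega>\<bar> < e then 1 else 0 :: real) *\<^sub>R G (\<lambda>t\<in>{0..c}. X t \<omega>)" for \<omega>
    unfolding H_def resX by simp
  have HZ: "H (\<lambda>t\<in>?I. Z t (\<omega>, y)) = (if \<bar>X c \<omega> + y\<bar> < e then 1 else 0 :: real) *\<^sub>R G (\<lambda>t\<in>{0..c}. X t \<omega>)" for \<omega> y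
    unfolding H_def resZ using c by (simp add: Z_def min_absorb2)
  have HZi: "integrable (P \<Otimes>\<^sub>M N) (\<lambda>z. H (\<lambda>t\<in>?I. Z t z))"
    by (intro PN.integrable_const_bound[of _ 1] AE_I2 measurable_compose[OF mZ Hm]) (use G in \<open>auto simp: H_def\<close>)
  have "(\<integral>\<omega>. H (\<lambda>t\<in>?I. X t \<omega>) \<partial>P) = (\<integral>z. H (\<lambda>t\<in>?I. Z t z) \<partial>(P \<Otimes>\<^sub>M N))"
    unfolding integral_distr[OF mX Hm, symmetric] integral_distr[OF mZ Hm, symmetric] law ..
  also have "\<dots> = (\<integral>\<omega>. (\<integral>y. H (\<lambda>t\<in>?I. Z t (\<omega>, y)) \<partial>N) \<partial>P)"
    by (rule PN.integral_fst'[symmetric]) (rule HZi)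
  also have "\<dots> = (\<integral>\<omega>. ball_mass (sqrt (1 - c)) e (X c \<omega>) *\<^sub>R G (\<lambda>t\<in>{0..c}. X t \<omega>) \<partial>P)"
  proof (intro Bochner_Integration.integral_cong refl)
    fix \<omega>
    have "integrable N (\<lambda>y. if \<bar>X c \<omega> + y\<bar> < e then 1 else 0 :: real)"
      by (intro N.integrable_const_bound[of _ 1]) auto
    then show "(\<integral>y. H (\<lambda>t\<in>?I. Z t (\<omega>, y)) \<partial>N) = ball_mass (sqrt (1 - c)) e (X c \<omega>) *\<^sub>R G (\<lambda>t\<in>{0..c}. X t \<omega>)"
      unfolding HZ by (simp add: ball_mass_def N_def \<delta>_def)
  qed
  finally show ?thesis unfolding HX .
qed

text \<open>The normal density is itself a Fourier integral, so that the weighted characteristic function is a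
  mixture of characteristic functions of Brownian motion.\<close>

lemma bridge_density:
  fixes G :: "(real \<Rightarrow> real) \<Rightarrow> complex"
  assumes c: "0 \<le> c" "c < 1" and b: "brownian_bridge M b"
    and [measurable]: "G \<in> borel_measurable (PiM {0..c} (\<lambda>_. borel))"
  defines "w \<equiv> \<lambda>\<omega>. normal_density 0 (sqrt (1 - c)) (X c \<omega>) / normal_density 0 1 0"
  shows "distr (density P w) (PiM {0..c} (\<lambda>_. borel)) (\<lambda>\<omega>. \<lambda>t\<in>{0..c}. X t \<omega>) =
      distr M (PiM {0..c} (\<lambda>_. borel)) (\<lambda>\<omega>. \<lambda>t\<in>{0..c}. b t \<omega>)"
    and "(\<integral>\<omega>. w \<omega> *\<^sub>R G (\<lambda>t\<in>{0..c}. X t \<omega>) \<partial>P) = (\<integral>\<omega>. G (\<lambda>t\<in>{0..c}. b t \<omega>) \<partial>M)"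
proof -
  define \<delta> where "\<delta> = 1 - c"
  have \<delta>: "\<delta> > 0" "sqrt \<delta> > 0" using c by (simp_all add: \<delta>_def)
  interpret M: prob_space M using b by (simp add: brownian_bridge_def)
  define N where "N = density lborel (normal_density 0 (1 / sqrt \<delta>))"
  interpret N: prob_space N unfolding N_def using \<delta> by (intro prob_space_normal_density) simp
  interpret PN: pair_prob_space P N ..
  have sN[measurable_cong]: "sets N = sets borel" by (simp add: N_def)
  have Xm: "X t \<in> borel_measurable P" if "t \<in> {0..c}" for t using that by (intro X_measurable) auto
  have [measurable]: "X c \<in> borel_measurable P" using c by (intro Xm) auto
  have bm: "b t \<in> borel_measurable M" if "t \<in> {0..c}" for t using that b c by (auto simp: brownian_bridge_def)
  have wm[measurable]: "w \<in> borel_measurable P" unfolding w_def by measurable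
  have p0: "normal_density 0 1 0 > 0" by (intro normal_density_pos) simp
  have w0: "0 \<le> w \<omega>" for \<omega> unfolding w_def using p0 by (intro divide_nonneg_pos) auto
  have wb: "w \<omega> \<le> normal_density 0 (sqrt \<delta>) 0 / normal_density 0 1 0" for \<omega>
    unfolding w_def \<delta>_def[symmetric] using p0 normal_density_bound[OF \<delta>(2)] by (intro divide_right_mono) auto
  have wi: "integrable P w"
    using w0 wb by (intro integrable_const_bound[of _ "normal_density 0 (sqrt \<delta>) 0 / normal_density 0 1 0"] AE_I2) simp_all
  have fin: "finite_measure (density P w)"
    using w0 wi by (intro finite_measureI) (simp add: emeasure_density nn_integral_eq_integral)
  \<comment> \<open>The factor sqrt (2 pi \<delta>) of the Fourier integral, set against p_1(0) = 1
    / sqrt (2 pi), leaves 1 / sqrt \<delta>.\<close>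
  have weq: "complex_of_real (w \<omega>) = of_real (1 / sqrt \<delta>) * (\<integral>v. cis (v * X c \<omega>) \<partial>N)" for \<omega>
    unfolding N_def normal_density_fourier[OF \<delta>(1)] w_def \<delta>_def[symmetric] of_real_mult[symmetric] of_real_eq_iff
    using \<delta> by (simp add: normal_density_def[of 0 1] real_sqrt_mult)
  show law: "distr (density P w) (PiM {0..c} (\<lambda>_. borel)) (\<lambda>\<omega>. \<lambda>t\<in>{0..c}. X t \<omega>) =
      distr M (PiM {0..c} (\<lambda>_. borel)) (\<lambda>\<omega>. \<lambda>t\<in>{0..c}. b t \<omega>)"
  proof (rule distr_PiM_eq_if_cis_integrals_eq[OF fin M.finite_measure_axioms])
    fix J and u :: "real \<Rightarrow> real" assume J: "finite J" "J \<subseteq> {0..c}"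
    define V where "V = (\<Sum>s\<in>J. \<Sum>t\<in>J. u s * u t * min s t)"
    define m where "m = (\<Sum>t\<in>J. u t * t)"
    have Zm[measurable]: "(\<lambda>\<omega>. \<Sum>t\<in>J. u t * X t \<omega>) \<in> borel_measurable P"
      using J Xm by (intro borel_measurable_sum borel_measurable_times) auto
    have E: "(\<integral>\<omega>. cis ((\<Sum>t\<in>J. u t * X t \<omega>) + v * X c \<omega>) \<partial>P) = of_real (exp (- (V + 2 * v * m + v\<^sup>2 * c) / 2))" for v
    proof -
      \<comment> \<open>The additional index 2 lies outside \<open>J\<close>, and min 2 c = c makes
        it a second copy of time \<open>c\<close>, usable even when \<open>c\<close> itself belongs
        to \<open>J\<close>.\<close>
      define u' where "u' t = (if t = 2 then v else u t)" for t
      have J2: "2 \<notin> J" using J c by auto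
      have "(\<Sum>t\<in>insert 2 J. u' t * X (min t c) \<omega>) = (\<Sum>t\<in>J. u t * X t \<omega>) + v * X c \<omega>" for \<omega>
      proof -
        have "(\<Sum>t\<in>J. u' t * X (min t c) \<omega>) = (\<Sum>t\<in>J. u t * X t \<omega>)"
          using J J2 by (intro sum.cong) (auto simp: u'_def min_absorb1 subset_iff)
        then show ?thesis using J J2 c by (simp add: u'_def min_absorb2)
      qed
      moreover have "(\<integral>\<omega>. cis (\<Sum>t\<in>insert 2 J. u' t * X (min t c) \<omega>) \<partial>P) =
          of_real (exp (- (\<Sum>s\<in>insert 2 J. \<Sum>t\<in>insert 2 J. u' s * u' t * min (min s c) (min t c)) / 2))"
        using J c by (intro integral_cis_brownian_motion) auto
      moreover have "(\<Sum>s\<in>insert 2 J. \<Sum>t\<in>insert 2 J. u' s * u' t * min (min s c) (min t c)) = V + 2 * v * m + v\<^sup>2 * c"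
      proof -
        have a: "(\<Sum>s\<in>J. \<Sum>t\<in>J. u' s * u' t * min (min s c) (min t c)) = V"
          unfolding V_def using J J2 by (intro sum.cong) (auto simp: u'_def min_absorb1 subset_iff)
        have b: "(\<Sum>t\<in>J. u' 2 * u' t * min (min 2 c) (min t c)) = v * m"
          unfolding m_def sum_distrib_left using J J2 c by (intro sum.cong) (auto simp: u'_def min_def subset_iff)
        have c: "u' 2 * u' 2 * min (min 2 c) (min 2 c) = v\<^sup>2 * c" using c by (simp add: u'_def power2_eq_square)
        have sym: "u' s * u' t * min (min s c) (min t c) = u' t * u' s * min (min t c) (min s c)" for s t
          by (metis mult.commute min.commute)
        show ?thesis
          unfolding sum_double_insert[where f="\<lambda>s t. u' s * u' t * min (min s c) (min t c)", OF J(1) J2 sym]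
          unfolding a b c by (simp only: mult.assoc)
      qed
      ultimately show ?thesis by simp
    qed
    have Fi: "integrable (P \<Otimes>\<^sub>M N) (\<lambda>(\<omega>, v). cis ((\<Sum>t\<in>J. u t * X t \<omega>) + v * X c \<omega>))"
      by (intro PN.integrable_const_bound[of _ 1] AE_I2) (auto simp: split_beta')
    have "(\<integral>\<omega>. cis (\<Sum>t\<in>J. u t * X t \<omega>) \<partial>density P w) = (\<integral>\<omega>. w \<omega> *\<^sub>R cis (\<Sum>t\<in>J. u t * X t \<omega>) \<partial>P)"
      using w0 by (subst integral_density) auto
    also have "\<dots> = (\<integral>\<omega>. of_real (1 / sqrt \<delta>) * (\<integral>v. cis ((\<Sum>t\<in>J. u t * X t \<omega>) + v * X c \<omega>) \<partial>N) \<partial>P)"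
    proof (intro Bochner_Integration.integral_cong refl)
      fix \<omega>
      have "(\<integral>v. cis ((\<Sum>t\<in>J. u t * X t \<omega>) + v * X c \<omega>) \<partial>N) = cis (\<Sum>t\<in>J. u t * X t \<omega>) * (\<integral>v. cis (v * X c \<omega>) \<partial>N)"
        by (simp add: cis_mult[symmetric])
      then show "w \<omega> *\<^sub>R cis (\<Sum>t\<in>J. u t * X t \<omega>) = of_real (1 / sqrt \<delta>) * (\<integral>v. cis ((\<Sum>t\<in>J. u t * X t \<omega>) + v * X c \<omega>) \<partial>N)"
        unfolding scaleR_conv_of_real weq by simp
    qed
    also have "\<dots> = of_real (1 / sqrt \<delta>) * (\<integral>\<omega>. (\<integral>v. cis ((\<Sum>t\<in>J. u t * X t \<omega>) + v * X c \<omega>) \<partial>N) \<partial>P)"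
      by (rule integral_mult_right_zero)
    also have "(\<integral>\<omega>. (\<integral>v. cis ((\<Sum>t\<in>J. u t * X t \<omega>) + v * X c \<omega>) \<partial>N) \<partial>P) = (\<integral>v. (\<integral>\<omega>. cis ((\<Sum>t\<in>J. u t * X t \<omega>) + v * X c \<omega>) \<partial>P) \<partial>N)"
      by (rule PN.Fubini_integral[symmetric]) (rule Fi)
    also have "\<dots> = of_real (\<integral>v. exp (- (V + 2 * v * m + v\<^sup>2 * c) / 2) \<partial>N)"
      unfolding E by simp
    also have "(\<integral>v. exp (- (V + 2 * v * m + v\<^sup>2 * c) / 2) \<partial>N) = (\<integral>v. normal_density 0 (1 / sqrt \<delta>) v * exp (- (V + 2 * v * m + v\<^sup>2 * c) / 2) \<partial>lborel)"
      unfolding N_def by (subst integral_real_density) auto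
    \<comment> \<open>Completing the square: the coefficients \<delta> and \<open>c\<close> of v^2
      add up to 1, so the integrand is a normal density of mean -m and variance 1. What remains, V -
      m^2, is the bridge variance: subtracting m^2 subtracts s t from min s t.\<close>
    also have "\<dots> = (\<integral>v. sqrt \<delta> * exp (- (V - m\<^sup>2) / 2) * normal_density (- m) 1 v \<partial>lborel)"
    proof (intro Bochner_Integration.integral_cong refl)
      fix v
      have "- (v\<^sup>2 * \<delta>) / 2 + - (V + 2 * v * m + v\<^sup>2 * c) / 2 = - (V - m\<^sup>2) / 2 + - (v - (- m))\<^sup>2 / 2"
        unfolding \<delta>_def by (simp add: field_simps power2_eq_square)
      then have "exp (- (v\<^sup>2 * \<delta>) / 2) * exp (- (V + 2 * v * m + v\<^sup>2 * c) / 2) = exp (- (V - m\<^sup>2) / 2) * exp (- (v - (- m))\<^sup>2 / 2)"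
        unfolding exp_add[symmetric] by simp
      moreover have "normal_density 0 (1 / sqrt \<delta>) v = sqrt \<delta> / sqrt (2 * pi) * exp (- (v\<^sup>2 * \<delta>) / 2)"
        using \<delta> by (simp add: normal_density_def power_divide real_sqrt_divide)
      moreover have "normal_density (- m) 1 v = 1 / sqrt (2 * pi) * exp (- (v - (- m))\<^sup>2 / 2)"
        by (simp add: normal_density_def)
      ultimately show "normal_density 0 (1 / sqrt \<delta>) v * exp (- (V + 2 * v * m + v\<^sup>2 * c) / 2) = sqrt \<delta> * exp (- (V - m\<^sup>2) / 2) * normal_density (- m) 1 v"
        by (simp only: times_divide_eq_left times_divide_eq_right mult.assoc mult_1)
    qed
    also have "\<dots> = sqrt \<delta> * exp (- (V - m\<^sup>2) / 2)" by simp
    finally have "(\<integral>\<omega>. cis (\<Sum>t\<in>J. u t * X t \<omega>) \<partial>density P w) = of_real (1 / sqrt \<delta>) * of_real (sqrt \<delta> * exp (- (V - m\<^sup>2) / 2))" .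
    also have "\<dots> = of_real (exp (- (V - m\<^sup>2) / 2))" unfolding of_real_mult[symmetric] using \<delta> by (subst of_real_eq_iff) simp
    also have "V - m\<^sup>2 = (\<Sum>s\<in>J. \<Sum>t\<in>J. u s * u t * (min s t - s * t))"
      unfolding V_def m_def power2_eq_square sum_product by (simp add: sum_subtractf[symmetric] algebra_simps)
    also have "of_real (exp (- (\<Sum>s\<in>J. \<Sum>t\<in>J. u s * u t * (min s t - s * t)) / 2)) = (\<integral>\<omega>. cis (\<Sum>t\<in>J. u t * b t \<omega>) \<partial>M)"
      using J c by (intro integral_cis_brownian_bridge[OF b, symmetric]) auto
    finally show "(\<integral>\<omega>. cis (\<Sum>t\<in>J. u t * X t \<omega>) \<partial>density P w) = (\<integral>\<omega>. cis (\<Sum>t\<in>J. u t * b t \<omega>) \<partial>M)" .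
  qed (use Xm bm in auto)
  have mX: "(\<lambda>\<omega>. \<lambda>t\<in>{0..c}. X t \<omega>) \<in> measurable P (PiM {0..c} (\<lambda>_. borel))" by (intro measurable_restrict Xm)
  then have mX': "(\<lambda>\<omega>. \<lambda>t\<in>{0..c}. X t \<omega>) \<in> measurable (density P w) (PiM {0..c} (\<lambda>_. borel))" by simp
  have mb: "(\<lambda>\<omega>. \<lambda>t\<in>{0..c}. b t \<omega>) \<in> measurable M (PiM {0..c} (\<lambda>_. borel))" by (intro measurable_restrict bm)
  have Gm: "G \<in> borel_measurable (PiM {0..c} (\<lambda>_. borel))" by measurable
  have "(\<integral>\<omega>. w \<omega> *\<^sub>R G (\<lambda>t\<in>{0..c}. X t \<omega>) \<partial>P) = (\<integral>\<omega>. G (\<lambda>t\<in>{0..c}. X t \<omega>) \<partial>density P w)"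
    using w0 measurable_compose[OF mX Gm] by (subst integral_density) auto
  also have "\<dots> = (\<integral>\<omega>. G (\<lambda>t\<in>{0..c}. b t \<omega>) \<partial>M)"
    unfolding integral_distr[OF mX' Gm, symmetric] integral_distr[OF mb Gm, symmetric] law ..
  finally show "(\<integral>\<omega>. w \<omega> *\<^sub>R G (\<lambda>t\<in>{0..c}. X t \<omega>) \<partial>P) = (\<integral>\<omega>. G (\<lambda>t\<in>{0..c}. b t \<omega>) \<partial>M)" .
qed

text \<open>The case \<open>c = 0\<close> of \<open>markov_at\<close>, which puts the denominator of
  the conditional probability into the same form as the numerator.\<close>

lemma small_value_probability:
  "(\<integral>\<omega>. (if \<bar>X 1 \<omega>\<bar> < e then 1 else 0 :: real) \<partial>P) = ball_mass 1 e 0"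
proof -
  have "(\<integral>\<omega>. (if \<bar>X 1 \<omega>\<bar> < e then 1 else 0 :: real) *\<^sub>R (1 :: complex) \<partial>P) = (\<integral>\<omega>. ball_mass (sqrt (1 - 0)) e (X 0 \<omega>) *\<^sub>R 1 \<partial>P)"
    using markov_at[of 0 "\<lambda>_. 1" e] by simp
  also have "\<dots> = (\<integral>\<omega>. ball_mass 1 e 0 *\<^sub>R 1 \<partial>P)"
    by (intro Bochner_Integration.integral_cong) (auto simp: X_0)
  also have "\<dots> = of_real (ball_mass 1 e 0)" by (simp add: prob_space scaleR_conv_of_real)
  finally have "(\<integral>\<omega>. (if \<bar>X 1 \<omega>\<bar> < e then 1 else 0 :: real) *\<^sub>R (1 :: complex) \<partial>P) = of_real (ball_mass 1 e 0)" .
  moreover have "(\<integral>\<omega>. (if \<bar>X 1 \<omega>\<bar> < e then 1 else 0 :: real) *\<^sub>R (1 :: complex) \<partial>P) =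
      of_real (\<integral>\<omega>. (if \<bar>X 1 \<omega>\<bar> < e then 1 else 0 :: real) \<partial>P)"
    by (simp only: scaleR_conv_of_real mult_1_right integral_complex_of_real)
  ultimately show ?thesis by (simp only: of_real_eq_iff)
qed

text \<open>After \<open>markov_at\<close> the conditioning acts only through the weight ball_mass /
  (2 e), which converges boundedly to a density. Dominated convergence then works for any bounded
  measurable \<open>G\<close>, with no continuity in the path, so \<open>G\<close> may involve local
  time.\<close>

lemma conditioned_limit:
  fixes G :: "(real \<Rightarrow> real) \<Rightarrow> complex"
  assumes c: "0 \<le> c" "c < 1" and b: "brownian_bridge M b"
    and Gm: "G \<in> borel_measurable (PiM {0..c} (\<lambda>_. borel))" and G: "\<And>x. norm (G x) \<le> 1"
    and e: "\<And>n. e n > 0" "e \<longlonglongrightarrow> 0"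
  shows "(\<lambda>n. (\<integral>\<omega>. (if \<bar>X 1 \<omega>\<bar> < e n then 1 else 0 :: real) *\<^sub>R G (\<lambda>t\<in>{0..c}. X t \<omega>) \<partial>P) /
      of_real (\<integral>\<omega>. (if \<bar>X 1 \<omega>\<bar> < e n then 1 else 0 :: real) \<partial>P)) \<longlonglongrightarrow> (\<integral>\<omega>. G (\<lambda>t\<in>{0..c}. b t \<omega>) \<partial>M)"
proof -
  let ?\<sigma> = "sqrt (1 - c)"
  have \<sigma>: "?\<sigma> > 0" using c by simp
  have [measurable]: "X c \<in> borel_measurable P" using c by (intro X_measurable) auto
  note [measurable] = ball_mass_measurable[OF \<sigma>]
  have mX: "(\<lambda>\<omega>. \<lambda>t\<in>{0..c}. X t \<omega>) \<in> measurable P (PiM {0..c} (\<lambda>_. borel))"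
    by (intro measurable_restrict X_measurable) auto
  have [measurable]: "(\<lambda>\<omega>. G (\<lambda>t\<in>{0..c}. X t \<omega>)) \<in> borel_measurable P" by (rule measurable_compose[OF mX Gm])
  have num: "(\<lambda>n. \<integral>\<omega>. (ball_mass ?\<sigma> (e n) (X c \<omega>) / (2 * e n)) *\<^sub>R G (\<lambda>t\<in>{0..c}. X t \<omega>) \<partial>P) \<longlonglongrightarrow>
      (\<integral>\<omega>. normal_density 0 ?\<sigma> (X c \<omega>) *\<^sub>R G (\<lambda>t\<in>{0..c}. X t \<omega>) \<partial>P)"
  proof (rule integral_dominated_convergence[where w="\<lambda>_. normal_density 0 ?\<sigma> 0"])
    show "AE \<omega> in P. (\<lambda>n. (ball_mass ?\<sigma> (e n) (X c \<omega>) / (2 * e n)) *\<^sub>R G (\<lambda>t\<in>{0..c}. X t \<omega>)) \<longlonglongrightarrow>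
       normal_density 0 ?\<sigma> (X c \<omega>) *\<^sub>R G (\<lambda>t\<in>{0..c}. X t \<omega>)"
      by (intro AE_I2 tendsto_intros ball_mass_limit(1)[OF \<sigma> e])
    show "AE \<omega> in P. norm ((ball_mass ?\<sigma> (e n) (X c \<omega>) / (2 * e n)) *\<^sub>R G (\<lambda>t\<in>{0..c}. X t \<omega>)) \<le> normal_density 0 ?\<sigma> 0" for n
    proof (rule AE_I2)
      fix \<omega>
      have "norm ((ball_mass ?\<sigma> (e n) (X c \<omega>) / (2 * e n)) *\<^sub>R G (\<lambda>t\<in>{0..c}. X t \<omega>)) \<le> (ball_mass ?\<sigma> (e n) (X c \<omega>) / (2 * e n)) * 1"
        unfolding norm_scaleR using ball_mass_limit(2)[OF \<sigma> e, of n "X c \<omega>"] G by (intro mult_mono) (auto simp: abs_of_nonneg)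
      then show "norm ((ball_mass ?\<sigma> (e n) (X c \<omega>) / (2 * e n)) *\<^sub>R G (\<lambda>t\<in>{0..c}. X t \<omega>)) \<le> normal_density 0 ?\<sigma> 0"
        using ball_mass_limit(3)[OF \<sigma> e, of n "X c \<omega>"] by simp
    qed
  qed auto
  have den: "(\<lambda>n. complex_of_real (ball_mass 1 (e n) 0 / (2 * e n))) \<longlonglongrightarrow> of_real (normal_density 0 1 0)"
    by (intro tendsto_of_real ball_mass_limit(1) e) simp
  have p0: "normal_density 0 1 0 > 0" by (intro normal_density_pos) simp
  have "(\<lambda>n. (\<integral>\<omega>. (ball_mass ?\<sigma> (e n) (X c \<omega>) / (2 * e n)) *\<^sub>R G (\<lambda>t\<in>{0..c}. X t \<omega>) \<partial>P) / of_real (ball_mass 1 (e n) 0 / (2 * e n)))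
     \<longlonglongrightarrow> (\<integral>\<omega>. normal_density 0 ?\<sigma> (X c \<omega>) *\<^sub>R G (\<lambda>t\<in>{0..c}. X t \<omega>) \<partial>P) / of_real (normal_density 0 1 0)"
    using p0 by (intro tendsto_divide num den) simp
  moreover have "(\<integral>\<omega>. (ball_mass ?\<sigma> (e n) (X c \<omega>) / (2 * e n)) *\<^sub>R G (\<lambda>t\<in>{0..c}. X t \<omega>) \<partial>P) / of_real (ball_mass 1 (e n) 0 / (2 * e n)) =
     (\<integral>\<omega>. (if \<bar>X 1 \<omega>\<bar> < e n then 1 else 0 :: real) *\<^sub>R G (\<lambda>t\<in>{0..c}. X t \<omega>) \<partial>P) / of_real (\<integral>\<omega>. (if \<bar>X 1 \<omega>\<bar> < e n then 1 else 0 :: real) \<partial>P)" for n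
  proof -
    have "(\<integral>\<omega>. (ball_mass ?\<sigma> (e n) (X c \<omega>) / (2 * e n)) *\<^sub>R G (\<lambda>t\<in>{0..c}. X t \<omega>) \<partial>P) =
        (1 / (2 * e n)) *\<^sub>R (\<integral>\<omega>. ball_mass ?\<sigma> (e n) (X c \<omega>) *\<^sub>R G (\<lambda>t\<in>{0..c}. X t \<omega>) \<partial>P)"
      by (simp only: integral_scaleR_right[symmetric] scaleR_scaleR times_divide_eq_left mult_1)
    then show ?thesis
      unfolding markov_at[OF c Gm G] small_value_probability
      using e(1)[of n] by (simp add: scaleR_conv_of_real)
  qed
  moreover have "(\<integral>\<omega>. normal_density 0 ?\<sigma> (X c \<omega>) *\<^sub>R G (\<lambda>t\<in>{0..c}. X t \<omega>) \<partial>P) / of_real (normal_density 0 1 0) =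
     (\<integral>\<omega>. G (\<lambda>t\<in>{0..c}. b t \<omega>) \<partial>M)"
  proof -
    have "(\<integral>\<omega>. (normal_density 0 ?\<sigma> (X c \<omega>) / normal_density 0 1 0) *\<^sub>R G (\<lambda>t\<in>{0..c}. X t \<omega>) \<partial>P) =
        (1 / normal_density 0 1 0) *\<^sub>R (\<integral>\<omega>. normal_density 0 ?\<sigma> (X c \<omega>) *\<^sub>R G (\<lambda>t\<in>{0..c}. X t \<omega>) \<partial>P)"
      by (simp only: integral_scaleR_right[symmetric] scaleR_scaleR times_divide_eq_left mult_1)
    then show ?thesis using bridge_density(2)[OF c b Gm] by (simp add: scaleR_conv_of_real)
  qed
  ultimately show ?thesis by simp
qed

end

section \<open>Path space\<close>

lemma continuous_bound_rationals:
  fixes f :: "real \<Rightarrow> real"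
  assumes f: "continuous_on {0..1} f" and r: "\<And>x. x \<in> \<rat> \<Longrightarrow> x \<in> {0..1} \<Longrightarrow> \<bar>f x\<bar> \<le> r" and x: "x \<in> {0..1}"
  shows "\<bar>f x\<bar> \<le> r"
proof -
  have g: "real (nat \<lfloor>real m * x\<rfloor>) / real m \<in> {0..1}" for m using grid_floor(1)[of x m] x by auto
  have "(\<lambda>m. f (real (nat \<lfloor>real m * x\<rfloor>) / real m)) \<longlonglongrightarrow> f x"
    by (rule continuous_on_tendsto_compose[OF f tendsto_grid_floor]) (use g x in auto)
  then show ?thesis
    by (rule LIMSEQ_le_const2[OF tendsto_rabs]) (use r g in auto)
qed

text \<open>The coefficients form a list because lists of rationals are a countable type; the degree
  is the length minus one.\<close>

definition rat_bernstein :: "rat list \<Rightarrow> real \<Rightarrow> real" where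
  "rat_bernstein q x = (\<Sum>k\<le>length q - 1. of_rat (q ! k) * Bernstein (length q - 1) k x)"

lemma continuous_rat_bernstein: "continuous_on S (rat_bernstein q)"
  unfolding rat_bernstein_def Bernstein_def by (intro continuous_intros)

text \<open>Bernstein polynomials are nonnegative and sum to 1, so coefficient errors are not
  amplified: half of \<open>e\<close> pays for the rational coefficients and half for the
  approximation itself.\<close>

lemma rat_bernstein_dense:
  fixes f :: "real \<Rightarrow> real"
  assumes f: "continuous_on {0..1} f" and e: "e > 0"
  shows "\<exists>q. \<forall>x\<in>{0..1}. \<bar>f x - rat_bernstein q x\<bar> \<le> e"
proof -
  have e2: "e / 2 > 0" using e by simp
  obtain n where n: "\<And>x. x \<in> {0..1} \<Longrightarrow> \<bar>f x - (\<Sum>k\<le>n. f (real k / real n) * Bernstein n k x)\<bar> < e / 2"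
    using Bernstein_Weierstrass[OF f e2] by blast
  have "\<exists>p::rat. \<bar>f (real k / real n) - of_rat p\<bar> < e / 2" for k
  proof -
    obtain p :: rat where "f (real k / real n) - e / 2 < of_rat p" "of_rat p < f (real k / real n) + e / 2"
      using of_rat_dense[of "f (real k / real n) - e / 2" "f (real k / real n) + e / 2"] e by auto
    then have "\<bar>f (real k / real n) - of_rat p\<bar> < e / 2" unfolding abs_less_iff by linarith
    then show ?thesis by blast
  qed
  then obtain p :: "nat \<Rightarrow> rat" where p: "\<And>k. \<bar>f (real k / real n) - of_rat (p k)\<bar> < e / 2" by metis
  define q where "q = map p [0..<Suc n]"
  have B: "rat_bernstein q x = (\<Sum>k\<le>n. of_rat (p k) * Bernstein n k x)" for x
    unfolding rat_bernstein_def q_def by (intro sum.cong) (auto simp del: upt_Suc)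
  have "\<bar>f x - rat_bernstein q x\<bar> \<le> e" if x: "x \<in> {0..1}" for x
  proof -
    have "\<bar>(\<Sum>k\<le>n. f (real k / real n) * Bernstein n k x) - rat_bernstein q x\<bar> = \<bar>\<Sum>k\<le>n. (f (real k / real n) - of_rat (p k)) * Bernstein n k x\<bar>"
      unfolding B by (simp add: left_diff_distrib sum_subtractf)
    also have "\<dots> \<le> (\<Sum>k\<le>n. e / 2 * Bernstein n k x)"
    proof (intro order_trans[OF sum_abs] sum_mono)
      fix k
      have B0: "0 \<le> Bernstein n k x" using x by (intro Bernstein_nonneg) auto
      show "\<bar>(f (real k / real n) - of_rat (p k)) * Bernstein n k x\<bar> \<le> e / 2 * Bernstein n k x"
        unfolding abs_mult abs_of_nonneg[OF B0] by (rule mult_right_mono[OF less_imp_le[OF p] B0])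
    qed
    also have "\<dots> = e / 2" unfolding sum_distrib_left[symmetric] sum_Bernstein by simp
    finally show ?thesis using n[OF x] by linarith
  qed
  then show ?thesis by blast
qed

lemma mdist_C01_le:
  assumes "f \<in> mspace C01" "g \<in> mspace C01"
  shows "mdist C01 f g \<le> r \<longleftrightarrow> (\<forall>x\<in>{0..1}. \<bar>f x - g x\<bar> \<le> r)"
  using cfunspace_mdist_le[OF assms, of r] by (simp add: dist_real_def)

lemma openin_C01:
  "openin (mtopology_of C01) U \<longleftrightarrow> U \<subseteq> mspace C01 \<and>
     (\<forall>f\<in>U. \<exists>r>0. \<forall>g\<in>mspace C01. mdist C01 f g < r \<longrightarrow> g \<in> U)"
proof -
  interpret Metric_space "mspace C01" "mdist C01" by (rule Metric_space_mspace_mdist)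
  have "mball f r \<subseteq> U \<longleftrightarrow> (\<forall>g\<in>mspace C01. mdist C01 f g < r \<longrightarrow> g \<in> U)" if "f \<in> mspace C01" for f r
    unfolding subset_iff in_mball using that by blast
  then show ?thesis unfolding mtopology_of_def openin_mtopology by (meson subsetD)
qed

lemma sets_borel_C01_openin: "openin (mtopology_of C01) U \<Longrightarrow> U \<in> sets borel_C01"
  unfolding borel_C01_def using openin_subset[of "mtopology_of C01"]
  by (subst sets_measure_of) (auto simp: openin_C01)

lemma space_borel_C01: "space borel_C01 = mspace C01"
  unfolding borel_C01_def by (rule space_measure_of) (auto simp: openin_C01)

lemma continuous_map_borel_C01:
  assumes "continuous_map (mtopology_of C01) euclideanreal \<phi>"
  shows "\<phi> \<in> borel_measurable borel_C01"
proof (rule borel_measurableI)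
  fix S :: "real set" assume "open S"
  then have "openin (mtopology_of C01) {f \<in> topspace (mtopology_of C01). \<phi> f \<in> S}"
    using assms by (simp add: continuous_map_def)
  moreover have "{f \<in> topspace (mtopology_of C01). \<phi> f \<in> S} = \<phi> -` S \<inter> space borel_C01"
    by (auto simp: space_borel_C01)
  ultimately show "\<phi> -` S \<inter> space borel_C01 \<in> sets borel_C01" using sets_borel_C01_openin by simp
qed

lemma Lipschitz_continuous_map_C01:
  assumes "\<And>f g. f \<in> mspace C01 \<Longrightarrow> g \<in> mspace C01 \<Longrightarrow> \<bar>\<phi> f - \<phi> g\<bar> \<le> B * mdist C01 f g"
  shows "continuous_map (mtopology_of C01) euclideanreal \<phi>"
proof -
  have "Lipschitz_continuous_map C01 euclidean_metric \<phi>"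
    unfolding Lipschitz_continuous_map_def using assms by (auto simp: dist_real_def)
  then have "continuous_map (mtopology_of C01) (mtopology_of euclidean_metric) \<phi>"
    by (intro uniformly_continuous_imp_continuous_map Lipschitz_imp_uniformly_continuous_map)
  then show ?thesis by simp
qed

text \<open>An open set of paths is a countable union of closed balls around the (countably many) rational
  Bernstein polynomials, and membership in a closed ball can be tested at rational times.\<close>

lemma path_measurable_C01:
  assumes "continuous_process M 1 Y"
  shows "(\<lambda>\<omega>. \<lambda>t\<in>{0..1}. Y t \<omega>) \<in> measurable M borel_C01"
proof -
  interpret continuous_process M 1 Y by fact
  define path where "path \<omega> = (\<lambda>t\<in>{0..1}. Y t \<omega>)" for \<omega>
  have pathC: "path \<omega> \<in> mspace C01" if "\<omega> \<in> space M" for \<omega>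
    unfolding path_def mspace_C01 using continuous_on_eq[OF continuous_path[OF that], of "\<lambda>t\<in>{0..1}. Y t \<omega>"] by auto
  show ?thesis
    unfolding borel_C01_def path_def[symmetric]
  proof (rule measurable_measure_of)
    show "{U. openin (mtopology_of C01) U} \<subseteq> Pow (mspace C01)" by (auto simp: openin_C01)
    show "path \<in> space M \<rightarrow> mspace C01" using pathC by auto
    fix U assume "U \<in> {U. openin (mtopology_of C01) U}"
    then have U: "U \<subseteq> mspace C01" "\<And>f. f \<in> U \<Longrightarrow> \<exists>r>0. \<forall>g\<in>mspace C01. mdist C01 f g < r \<longrightarrow> g \<in> U"
      unfolding openin_C01 by auto
    \<comment> \<open>The pairs whose closed ball lies in \<open>U\<close>. The ball is described by
      pointwise inequalities because \<open>rat_bernstein q\<close> is not extensional and so is not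
      itself a point of \<open>C01\<close>.\<close>
    define I where "I = {(q, k). \<forall>g\<in>mspace C01. (\<forall>x\<in>{0..1}. \<bar>g x - rat_bernstein q x\<bar> \<le> 1 / real (Suc k)) \<longrightarrow> g \<in> U}"
    define A where "A q k = {\<omega> \<in> space M. \<forall>x\<in>\<rat> \<inter> {0..1}. \<bar>Y x \<omega> - rat_bernstein q x\<bar> \<le> 1 / real (Suc k)}" for q k
    have A_all: "\<omega> \<in> A q k \<longleftrightarrow> \<omega> \<in> space M \<and> (\<forall>x\<in>{0..1}. \<bar>path \<omega> x - rat_bernstein q x\<bar> \<le> 1 / real (Suc k))" for q k \<omega>
    proof
      assume \<omega>: "\<omega> \<in> A q k"
      then have "continuous_on {0..1} (\<lambda>x. Y x \<omega> - rat_bernstein q x)"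
        unfolding A_def by (intro continuous_intros continuous_rat_bernstein continuous_path) auto
      from continuous_bound_rationals[OF this] \<omega>
      show "\<omega> \<in> space M \<and> (\<forall>x\<in>{0..1}. \<bar>path \<omega> x - rat_bernstein q x\<bar> \<le> 1 / real (Suc k))"
        by (auto simp: A_def path_def)
    qed (auto simp: A_def path_def)
    have "countable (\<rat> \<inter> {0..1} :: real set)" by (intro countable_Int1 countable_rat)
    then have "(\<Inter>x\<in>\<rat> \<inter> {0..1}. {\<omega> \<in> space M. \<bar>Y x \<omega> - rat_bernstein q x\<bar> \<le> 1 / real (Suc k)}) \<in> sets M" for q k
    proof (intro sets.countable_INT')
      show "\<rat> \<inter> {0..1} \<noteq> ({} :: real set)" by (auto intro: exI[of _ 0])
      show "(\<lambda>x. {\<omega> \<in> space M. \<bar>Y x \<omega> - rat_bernstein q x\<bar> \<le> 1 / real (Suc k)}) ` (\<rat> \<inter> {0..1}) \<subseteq> sets M"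
      proof clarify
        fix x :: real assume "x \<in> \<rat>" "x \<in> {0..1}"
        then have [measurable]: "Y x \<in> borel_measurable M" by (intro measurable_at) auto
        show "{\<omega> \<in> space M. \<bar>Y x \<omega> - rat_bernstein q x\<bar> \<le> 1 / real (Suc k)} \<in> sets M" by measurable
      qed
    qed
    moreover have "A q k = (\<Inter>x\<in>\<rat> \<inter> {0..1}. {\<omega> \<in> space M. \<bar>Y x \<omega> - rat_bernstein q x\<bar> \<le> 1 / real (Suc k)})" for q k
      unfolding A_def using Rats_0 by force
    ultimately have Am: "A q k \<in> sets M" for q k by simp
    have "path -` U \<inter> space M = (\<Union>(q, k)\<in>I. A q k)"
    proof (intro set_eqI iffI)
      fix \<omega> assume \<omega>: "\<omega> \<in> path -` U \<inter> space M"
      then obtain r where r: "r > 0" "\<And>g. g \<in> mspace C01 \<Longrightarrow> mdist C01 (path \<omega>) g < r \<Longrightarrow> g \<in> U"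
        using U(2)[of "path \<omega>"] by auto
      \<comment> \<open>Half of the radius, since two paths in the same closed ball can be twice its
        radius apart.\<close>
      obtain k where k: "1 / real (Suc k) < r / 2" using nat_approx_posE[of "r / 2"] r(1) by auto
      have pc: "continuous_on {0..1} (path \<omega>)" using pathC[of \<omega>] \<omega> by (auto simp: mspace_C01)
      have "0 < 1 / real (Suc k)" by simp
      from rat_bernstein_dense[OF pc this]
      obtain q where q: "\<forall>x\<in>{0..1}. \<bar>path \<omega> x - rat_bernstein q x\<bar> \<le> 1 / real (Suc k)" by blast
      have "(q, k) \<in> I"
        unfolding I_def
      proof (clarify, rule r(2))
        fix g assume g: "g \<in> mspace C01" "\<forall>x\<in>{0..1}. \<bar>g x - rat_bernstein q x\<bar> \<le> 1 / real (Suc k)"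
        have "\<bar>path \<omega> x - g x\<bar> \<le> 2 * (1 / real (Suc k))" if "x \<in> {0..1}" for x
          using q[rule_format, OF that] g(2)[rule_format, OF that] by linarith
        then have "mdist C01 (path \<omega>) g \<le> 2 * (1 / real (Suc k))"
          using mdist_C01_le[of "path \<omega>" g] pathC[of \<omega>] \<omega> g(1) by auto
        then show "mdist C01 (path \<omega>) g < r" using k by linarith
      qed
      moreover have "\<omega> \<in> A q k" using A_all q \<omega> by blast
      ultimately show "\<omega> \<in> (\<Union>(q, k)\<in>I. A q k)" by auto
    next
      fix \<omega> assume "\<omega> \<in> (\<Union>(q, k)\<in>I. A q k)"
      then obtain q k where "(q, k) \<in> I" "\<omega> \<in> A q k" by auto
      then show "\<omega> \<in> path -` U \<inter> space M" using pathC[of \<omega>] unfolding A_all I_def by auto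
    qed
    moreover have "(\<Union>(q, k)\<in>I. A q k) \<in> sets M"
      using Am by (intro sets.countable_UN' countableI_type) auto
    ultimately show "path -` U \<inter> space M \<in> sets M" by simp
  qed
qed

lemma integral_law_C01:
  assumes "continuous_process M 1 Y" "continuous_map (mtopology_of C01) euclideanreal \<phi>"
  shows "(LINT f|law_C01 M Y. \<phi> f) = (LINT \<omega>|M. \<phi> (\<lambda>t\<in>{0..1}. Y t \<omega>))"
  unfolding law_C01_def
  by (rule integral_distr[OF path_measurable_C01[OF assms(1)] continuous_map_borel_C01[OF assms(2)]])

section \<open>Running suprema as continuous functionals of the path\<close>

definition path_sup :: "real \<Rightarrow> (real \<Rightarrow> real) \<Rightarrow> real" where
  "path_sup s f = (SUP u\<in>{0..s}. f u)"

lemma path_sup_Lipschitz: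
  assumes "f \<in> mspace C01" "g \<in> mspace C01" and s: "0 \<le> s" "s \<le> 1"
  shows "\<bar>path_sup s f - path_sup s g\<bar> \<le> mdist C01 f g"
proof -
  have d: "\<bar>f x - g x\<bar> \<le> mdist C01 f g" if "x \<in> {0..1}" for x
    using mdist_C01_le[OF assms(1,2), of "mdist C01 f g"] that by simp
  have bdd: "bdd_above (h ` {0..s})" if "h \<in> mspace C01" for h
  proof -
    have "continuous_on {0..1} h" using that unfolding mspace_C01 by simp
    then have "continuous_on {0..s} h" by (rule continuous_on_subset) (use s in auto)
    then have "compact (h ` {0..s})" by (rule compact_continuous_image[OF _ compact_Icc])
    then show ?thesis by (rule bounded_imp_bdd_above[OF compact_imp_bounded])
  qed
  have ne: "{0..s} \<noteq> {}" using s by simp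
  have 1: "path_sup s f \<le> path_sup s g + mdist C01 f g"
    unfolding path_sup_def
  proof (rule cSUP_least[OF ne])
    fix x assume x: "x \<in> {0..s}"
    have "f x \<le> g x + mdist C01 f g" using d[of x] x s by auto
    also have "g x \<le> (SUP u\<in>{0..s}. g u)" by (rule cSUP_upper[OF x bdd[OF assms(2)]])
    finally show "f x \<le> (SUP u\<in>{0..s}. g u) + mdist C01 f g" by simp
  qed
  have 2: "path_sup s g \<le> path_sup s f + mdist C01 f g"
    unfolding path_sup_def
  proof (rule cSUP_least[OF ne])
    fix x assume x: "x \<in> {0..s}"
    have "g x \<le> f x + mdist C01 f g" using d[of x] x s by auto
    also have "f x \<le> (SUP u\<in>{0..s}. f u)" by (rule cSUP_upper[OF x bdd[OF assms(1)]])
    finally show "g x \<le> (SUP u\<in>{0..s}. f u) + mdist C01 f g" by simp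
  qed
  show ?thesis using 1 2 by linarith
qed

lemma path_sup_restrict: "s \<le> 1 \<Longrightarrow> path_sup s (\<lambda>t\<in>{0..1}. Y t \<omega>) = running_sup Y s \<omega>"
  unfolding path_sup_def running_sup_def by (intro SUP_cong) auto

text \<open>Weak convergence is tested on real functionals, so the characteristic function is
  approached through its real and imaginary parts; \<open>h\<close> stands for \<open>cos\<close>
  and \<open>sin\<close>, both of which are 1-Lipschitz.\<close>

lemma continuous_map_trig_path_sup:
  fixes h :: "real \<Rightarrow> real"
  assumes h: "\<And>x y. \<bar>h x - h y\<bar> \<le> \<bar>x - y\<bar>" and J: "finite J" "J \<subseteq> {0..1}"
  shows "continuous_map (mtopology_of C01) euclideanreal (\<lambda>f. h (\<Sum>s\<in>J. u s * path_sup s f))"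
proof (rule Lipschitz_continuous_map_C01)
  fix f g assume fg: "f \<in> mspace C01" "g \<in> mspace C01"
  have "\<bar>h (\<Sum>s\<in>J. u s * path_sup s f) - h (\<Sum>s\<in>J. u s * path_sup s g)\<bar> \<le> \<bar>(\<Sum>s\<in>J. u s * path_sup s f) - (\<Sum>s\<in>J. u s * path_sup s g)\<bar>"
    by (rule h)
  also have "\<dots> = \<bar>\<Sum>s\<in>J. u s * (path_sup s f - path_sup s g)\<bar>"
    by (simp add: right_diff_distrib sum_subtractf)
  also have "\<dots> \<le> (\<Sum>s\<in>J. \<bar>u s\<bar> * mdist C01 f g)"
  proof (intro order_trans[OF sum_abs] sum_mono)
    fix s assume "s \<in> J"
    then have "\<bar>path_sup s f - path_sup s g\<bar> \<le> mdist C01 f g" using J by (intro path_sup_Lipschitz[OF fg]) auto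
    then show "\<bar>u s * (path_sup s f - path_sup s g)\<bar> \<le> \<bar>u s\<bar> * mdist C01 f g"
      unfolding abs_mult by (rule mult_left_mono) simp
  qed
  also have "\<dots> = (\<Sum>s\<in>J. \<bar>u s\<bar>) * mdist C01 f g" by (simp add: sum_distrib_right)
  finally show "\<bar>h (\<Sum>s\<in>J. u s * path_sup s f) - h (\<Sum>s\<in>J. u s * path_sup s g)\<bar> \<le> (\<Sum>s\<in>J. \<bar>u s\<bar>) * mdist C01 f g" .
qed

lemma sum_path_sup_restrict:
  "J \<subseteq> {..1} \<Longrightarrow> (\<Sum>s\<in>J. u s * path_sup s (\<lambda>t\<in>{0..1}. Y t \<omega>)) = (\<Sum>s\<in>J. u s * running_sup Y s \<omega>)"
  by (intro sum.cong) (auto simp: path_sup_restrict)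

lemma weak_conv_C01_running_sup:
  fixes h :: "real \<Rightarrow> real"
  assumes w: "weak_conv_C01 (\<lambda>e. law_C01 (Q e) Y) (law_C01 N a) F"
    and Q: "\<And>e. continuous_process (Q e) 1 Y" and a: "continuous_process N 1 a"
    and J: "finite J" "J \<subseteq> {0..1}"
    and h: "\<And>x y. \<bar>h x - h y\<bar> \<le> \<bar>x - y\<bar>" and b: "\<And>x. \<bar>h x\<bar> \<le> 1"
  shows "((\<lambda>e. \<integral>\<omega>. h (\<Sum>s\<in>J. u s * running_sup Y s \<omega>) \<partial>Q e) \<longlongrightarrow> (\<integral>\<omega>. h (\<Sum>s\<in>J. u s * running_sup a s \<omega>) \<partial>N)) F"
proof -
  have J1: "J \<subseteq> {..1}" using J by auto
  let ?\<phi> = "\<lambda>f. h (\<Sum>s\<in>J. u s * path_sup s f)"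
  note c = continuous_map_trig_path_sup[of h, OF h J, of u]
  have "bounded (?\<phi> ` mspace C01)" unfolding bounded_iff using b by (intro exI[of _ 1]) auto
  then have "((\<lambda>e. LINT f|law_C01 (Q e) Y. ?\<phi> f) \<longlongrightarrow> (LINT f|law_C01 N a. ?\<phi> f)) F"
    using w c unfolding weak_conv_C01_def by blast
  then show ?thesis
    unfolding integral_law_C01[OF Q c] integral_law_C01[OF a c] sum_path_sup_restrict[OF J1] .
qed

section \<open>The ascent and the bridge\<close>

lemma integral_uniform_measure:
  fixes h :: "'a \<Rightarrow> real"
  assumes "finite_measure M" and A[measurable]: "A \<in> sets M" and p: "measure M A > 0" and [measurable]: "h \<in> borel_measurable M"
  shows "(\<integral>\<omega>. h \<omega> \<partial>uniform_measure M A) = (\<integral>\<omega>. indicator A \<omega> * h \<omega> \<partial>M) / measure M A"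
proof -
  interpret finite_measure M by fact
  have "uniform_measure M A = density M (\<lambda>\<omega>. ennreal (indicator A \<omega> / measure M A))"
    unfolding uniform_measure_def emeasure_eq_measure
    using p by (intro density_cong) (auto simp: divide_ennreal[symmetric] ennreal_indicator)
  then have "(\<integral>\<omega>. h \<omega> \<partial>uniform_measure M A) = (\<integral>\<omega>. indicator A \<omega> / measure M A * h \<omega> \<partial>M)"
    using p by (simp add: integral_real_density)
  also have "\<dots> = (\<integral>\<omega>. indicator A \<omega> * h \<omega> / measure M A \<partial>M)" by simp
  finally show ?thesis by (simp only: integral_divide_zero)
qed

text \<open>Cutting a point \<open>x\<close> of [0, r] down to \<open>min x s\<close> moves it by
  less than \<open>d\<close>, so uniform continuity bounds the loss by \<eta>.\<close>

lemma sup_interval_close: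
  fixes f :: "real \<Rightarrow> real"
  assumes f: "continuous_on {0..1} f" and \<eta>: "\<eta> > 0"
  shows "\<exists>d>0. \<forall>r\<in>{0..1}. \<forall>s\<in>{0..1}. \<bar>r - s\<bar> < d \<longrightarrow> (SUP u\<in>{0..r}. f u) \<le> (SUP u\<in>{0..s}. f u) + \<eta>"
proof -
  have "uniformly_continuous_on {0..1} f" using f compact_uniformly_continuous by blast
  then obtain d where d: "d > 0" "\<And>x y. x \<in> {0..1} \<Longrightarrow> y \<in> {0..1} \<Longrightarrow> dist y x < d \<Longrightarrow> dist (f y) (f x) < \<eta>"
    unfolding uniformly_continuous_on_def using \<eta> by metis
  show ?thesis
  proof (intro exI[of _ d] conjI ballI impI d(1))
    fix r s :: real assume rs: "r \<in> {0..1}" "s \<in> {0..1}" "\<bar>r - s\<bar> < d"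
    have "continuous_on {0..s} f" using f by (rule continuous_on_subset) (use rs in auto)
    then have "compact (f ` {0..s})" by (rule compact_continuous_image[OF _ compact_Icc])
    then have bdd: "bdd_above (f ` {0..s})" by (rule bounded_imp_bdd_above[OF compact_imp_bounded])
    show "(SUP u\<in>{0..r}. f u) \<le> (SUP u\<in>{0..s}. f u) + \<eta>"
    proof (rule cSUP_least)
      show "{0..r} \<noteq> {}" using rs by simp
      fix x assume x: "x \<in> {0..r}"
      have m: "min x s \<in> {0..s}" using x rs by auto
      have "dist (f x) (f (min x s)) < \<eta>"
        using x rs by (intro d(2)) (auto simp: dist_real_def min_def)
      then have "f x \<le> f (min x s) + \<eta>" by (simp add: dist_real_def abs_less_iff)
      also have "f (min x s) \<le> (SUP u\<in>{0..s}. f u)" by (rule cSUP_upper[OF m bdd])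
      finally show "f x \<le> (SUP u\<in>{0..s}. f u) + \<eta>" by simp
    qed
  qed
qed

lemma running_sup_tendsto:
  assumes Y: "continuous_on {0..1} (\<lambda>t. Y t \<omega>)" and s: "s \<in> {0..1}" and r: "\<And>n. r n \<in> {0..1}" "r \<longlonglongrightarrow> s"
  shows "(\<lambda>n. running_sup Y (r n) \<omega>) \<longlonglongrightarrow> running_sup Y s \<omega>"
proof (rule LIMSEQ_I)
  fix \<eta> :: real assume "\<eta> > 0"
  then have e: "\<eta> / 2 > 0" by simp
  obtain d where d: "d > 0" "\<And>r s. r \<in> {0..1} \<Longrightarrow> s \<in> {0..1} \<Longrightarrow> \<bar>r - s\<bar> < d \<Longrightarrow> running_sup Y r \<omega> \<le> running_sup Y s \<omega> + \<eta> / 2"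
    using sup_interval_close[OF Y e] unfolding running_sup_def by blast
  obtain N where N: "\<And>n. n \<ge> N \<Longrightarrow> \<bar>r n - s\<bar> < d"
    using LIMSEQ_D[OF r(2) d(1)] by auto
  show "\<exists>N. \<forall>n\<ge>N. norm (running_sup Y (r n) \<omega> - running_sup Y s \<omega>) < \<eta>"
  proof (intro exI[of _ N] allI impI)
    fix n assume n: "N \<le> n"
    have "running_sup Y (r n) \<omega> \<le> running_sup Y s \<omega> + \<eta> / 2" "running_sup Y s \<omega> \<le> running_sup Y (r n) \<omega> + \<eta> / 2"
      using N[OF n] by (auto intro!: d(2) r s simp: abs_minus_commute)
    then show "norm (running_sup Y (r n) \<omega> - running_sup Y s \<omega>) < \<eta>" using e by (simp add: abs_less_iff)
  qed
qed

context brownian_motion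
begin

text \<open>\<open>levy_cis\<close> fixes the joint characteristic functions;
  \<open>integrals_indicator_cis_eq\<close> then exchanges the character of the last coordinate for
  the indicator of {..<e}. That coordinate is labelled 2, outside [0, 1], to keep it apart from the
  times in \<open>J\<close>.\<close>

lemma levy_conditional:
  assumes J: "finite J" "J \<subseteq> {0..1}"
  shows "(\<integral>\<omega>. (if running_sup X 1 \<omega> - X 1 \<omega> < e then 1 else 0 :: real) *\<^sub>R cis (\<Sum>s\<in>J. u s * running_sup X s \<omega>) \<partial>P) =
    (\<integral>\<omega>. (if \<bar>X 1 \<omega>\<bar> < e then 1 else 0 :: real) *\<^sub>R cis (\<Sum>s\<in>J. u s * local_time0 X s \<omega>) \<partial>P)"
proof -
  define Y where "Y t \<omega> = (if t = 2 then running_sup X 1 \<omega> - X 1 \<omega> else running_sup X t \<omega>)" for t :: real and \<omega>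
  define Z where "Z t \<omega> = (if t = 2 then \<bar>X 1 \<omega>\<bar> else local_time0 X t \<omega>)" for t :: real and \<omega>
  have J2: "2 \<notin> J" using J by auto
  have [measurable]: "X 1 \<in> borel_measurable P" by (intro X_measurable) simp
  have Ym: "Y t \<in> borel_measurable P" and Zm: "Z t \<in> borel_measurable P" if "t \<in> insert 2 J" for t
  proof -
    have [measurable]: "running_sup X 1 \<in> borel_measurable P" by (intro running_sup_measurable) auto
    have S: "t \<noteq> 2 \<Longrightarrow> running_sup X t \<in> borel_measurable P" using that J by (intro running_sup_measurable) auto
    have L: "t \<noteq> 2 \<Longrightarrow> local_time0 X t \<in> borel_measurable P" using that J by (intro brownian_path.local_time0_measurable) auto
    show "Y t \<in> borel_measurable P" "Z t \<in> borel_measurable P"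
      unfolding Y_def Z_def using S L by (cases "t = 2"; simp)+
  qed
  have sumY: "(\<Sum>t\<in>insert 2 J. w t * Y t \<omega>) = (\<Sum>t\<in>J. w t * running_sup X t \<omega>) + w 2 * (running_sup X 1 \<omega> - X 1 \<omega>)" for w \<omega>
    using J J2 by (simp add: Y_def) (intro sum.cong; auto)
  have sumZ: "(\<Sum>t\<in>insert 2 J. w t * Z t \<omega>) = (\<Sum>t\<in>J. w t * local_time0 X t \<omega>) + w 2 * \<bar>X 1 \<omega>\<bar>" for w \<omega>
    using J J2 by (simp add: Z_def) (intro sum.cong; auto)
  have "(\<integral>\<omega>. (\<Prod>j\<in>{2}. indicator {..<e} (Y j \<omega>)) *\<^sub>R cis (\<Sum>j\<in>insert 2 J - {2}. u j * Y j \<omega>) \<partial>P) =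
    (\<integral>\<omega>. (\<Prod>j\<in>{2}. indicator {..<e} (Z j \<omega>)) *\<^sub>R cis (\<Sum>j\<in>insert 2 J - {2}. u j * Z j \<omega>) \<partial>P)"
    by (rule integrals_indicator_cis_eq[OF finite_measure_axioms finite_measure_axioms _ Ym Zm])
       (use J in \<open>auto simp: sumY sumZ levy_cis[OF J] simp del: sum.insert\<close>)
  moreover have "(\<Sum>j\<in>insert 2 J - {2}. u j * Y j \<omega>) = (\<Sum>s\<in>J. u s * running_sup X s \<omega>)" for \<omega>
    using J2 by (intro sum.cong) (auto simp: Y_def)
  moreover have "(\<Sum>j\<in>insert 2 J - {2}. u j * Z j \<omega>) = (\<Sum>s\<in>J. u s * local_time0 X s \<omega>)" for \<omega>
    using J2 by (intro sum.cong) (auto simp: Z_def)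
  moreover have "(indicator {..<e} x :: real) = (if x < e then 1 else 0)" for x by (simp add: indicator_def)
  ultimately show ?thesis by (simp add: Y_def Z_def)
qed

text \<open>After \<open>levy_conditional\<close> the suprema have become local times at times up to
  \<open>c\<close>, which are measurable in the path on [0, c] through \<open>path_of\<close>, so
  \<open>conditioned_limit\<close> applies.\<close>

lemma conditioned_sup_limit:
  assumes b: "brownian_bridge M b" and c: "0 \<le> c" "c < 1" and J: "finite J" "J \<subseteq> {0..c}"
    and e: "\<And>n. e n > 0" "e \<longlonglongrightarrow> 0"
  shows "(\<lambda>n. (\<integral>\<omega>. (if running_sup X 1 \<omega> - X 1 \<omega> < e n then 1 else 0 :: real) *\<^sub>R cis (\<Sum>s\<in>J. u s * running_sup X s \<omega>) \<partial>P) /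
      of_real (\<integral>\<omega>. (if \<bar>X 1 \<omega>\<bar> < e n then 1 else 0 :: real) \<partial>P)) \<longlonglongrightarrow> (\<integral>\<omega>. cis (\<Sum>s\<in>J. u s * local_time0 b s \<omega>) \<partial>M)"
proof -
  define G where "G x = cis (\<Sum>s\<in>J. u s * local_time0 (path_of c) s x)" for x
  have [measurable]: "local_time0 (path_of c) s \<in> borel_measurable (PiM {0..c} (\<lambda>_. borel))" for s
    by (rule local_time_measurable(2)[OF path_of_measurable[OF c(1)]])
  have Gm: "G \<in> borel_measurable (PiM {0..c} (\<lambda>_. borel))" unfolding G_def by measurable
  have G1: "norm (G x) \<le> 1" for x by (simp add: G_def)
  have J1: "J \<subseteq> {0..1}" using J c by auto
  have GX: "G (\<lambda>t\<in>{0..c}. X t \<omega>) = cis (\<Sum>s\<in>J. u s * local_time0 X s \<omega>)" if "\<omega> \<in> space P" for \<omega>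
  proof -
    have "continuous_on {0..c} (\<lambda>t. X t \<omega>)" by (rule continuous_on_subset[OF X_continuous[OF that]]) auto
    from local_time0_path_of(1)[where Y=X, OF this] show ?thesis
      unfolding G_def using J by (intro arg_cong[where f=cis] sum.cong) auto
  qed
  have Gb: "G (\<lambda>t\<in>{0..c}. b t \<omega>) = cis (\<Sum>s\<in>J. u s * local_time0 b s \<omega>)" if "\<omega> \<in> space M" for \<omega>
  proof -
    have "continuous_on {0..c} (\<lambda>t. b t \<omega>)"
      using b that c by (auto simp: brownian_bridge_def intro: continuous_on_subset)
    from local_time0_path_of(1)[where Y=b, OF this] show ?thesis
      unfolding G_def using J by (intro arg_cong[where f=cis] sum.cong) auto
  qed
  have "(\<integral>\<omega>. (if \<bar>X 1 \<omega>\<bar> < e n then 1 else 0 :: real) *\<^sub>R G (\<lambda>t\<in>{0..c}. X t \<omega>) \<partial>P) =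
      (\<integral>\<omega>. (if running_sup X 1 \<omega> - X 1 \<omega> < e n then 1 else 0 :: real) *\<^sub>R cis (\<Sum>s\<in>J. u s * running_sup X s \<omega>) \<partial>P)" for n
    unfolding levy_conditional[OF J(1) J1] by (intro Bochner_Integration.integral_cong) (auto simp: GX)
  moreover have "(\<integral>\<omega>. G (\<lambda>t\<in>{0..c}. b t \<omega>) \<partial>M) = (\<integral>\<omega>. cis (\<Sum>s\<in>J. u s * local_time0 b s \<omega>) \<partial>M)"
    by (intro Bochner_Integration.integral_cong) (auto simp: Gb)
  ultimately show ?thesis using conditioned_limit[OF c b Gm G1 e] by simp
qed

text \<open>The same sequence of conditional expectations has two limits: one by the weak
  convergence that defines the ascent, the other by \<open>conditioned_sup_limit\<close>.\<close>

lemma ascent_sup_local_time_cis: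
  assumes a: "brownian_ascent P X N a" and b: "brownian_bridge M b"
    and c: "0 \<le> c" "c < 1" and J: "finite J" "J \<subseteq> {0..c}"
  shows "(\<integral>\<omega>. cis (\<Sum>s\<in>J. u s * running_sup a s \<omega>) \<partial>N) = (\<integral>\<omega>. cis (\<Sum>s\<in>J. u s * local_time0 b s \<omega>) \<partial>M)"
proof -
  interpret N: prob_space N using a by (simp add: brownian_ascent_def)
  have aN: "continuous_process N 1 a" using a by (auto simp: brownian_ascent_def continuous_process_def)
  have J1: "J \<subseteq> {0..1}" using J c by auto
  define A where "A e = {\<omega>\<in>space P. running_sup X 1 \<omega> - X 1 \<omega> < e}" for e
  define Q where "Q e = uniform_measure P (A e)" for e
  have [measurable]: "X 1 \<in> borel_measurable P" by (intro X_measurable) simp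
  have [measurable]: "running_sup X s \<in> borel_measurable P" if "s \<in> insert 1 J" for s
    using that J1 by (intro running_sup_measurable) auto
  have [measurable]: "running_sup a s \<in> borel_measurable N" if "s \<in> J" for s
    using that J1 by (intro running_sup_borel_measurable[OF aN]) auto
  have Am[measurable]: "A e \<in> sets P" for e unfolding A_def by measurable
  have Qc: "continuous_process (Q e) 1 X" for e
    using brownian_path.continuous_process_axioms unfolding continuous_process_def Q_def
    by (auto simp: measurable_cong_sets[OF sets_uniform_measure refl])
  have w: "weak_conv_C01 (\<lambda>e. law_C01 (Q e) X) (law_C01 N a) (at_right 0)"
    using a unfolding brownian_ascent_def Q_def A_def by simp
  define e where "e n = 1 / real (Suc n)" for n
  have e: "e n > 0" "e \<longlonglongrightarrow> 0" for n
    unfolding e_def by (simp, rule LIMSEQ_Suc[OF lim_1_over_n])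
  have e0: "filterlim e (at_right 0) sequentially"
    unfolding filterlim_at using e less_imp_neq[OF e(1), symmetric] by simp
  define p where "p n = (\<integral>\<omega>. (if \<bar>X 1 \<omega>\<bar> < e n then 1 else 0 :: real) \<partial>P)" for n
  define S where "S \<omega> = (\<Sum>s\<in>J. u s * running_sup X s \<omega>)" for \<omega>
  have [measurable]: "S \<in> borel_measurable P" unfolding S_def by measurable
  have ind: "(if running_sup X 1 \<omega> - X 1 \<omega> < e n then 1 else 0 :: real) = indicator (A (e n)) \<omega>" if "\<omega> \<in> space P" for \<omega> n
    using that by (simp add: A_def indicator_def)
  \<comment> \<open>\<open>levy_conditional\<close> with empty \<open>J\<close>: the events \<bar>X
    1\<bar> < e and S_1 - X_1 < e are equally likely, so the two conditionings share one normalising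
    constant.\<close>
  have pA: "p n = measure P (A (e n))" for n
  proof -
    have "complex_of_real (p n) = (\<integral>\<omega>. (if \<bar>X 1 \<omega>\<bar> < e n then 1 else 0 :: real) *\<^sub>R 1 \<partial>P)"
      unfolding p_def by (simp only: scaleR_conv_of_real mult_1_right integral_complex_of_real)
    also have "\<dots> = (\<integral>\<omega>. (if running_sup X 1 \<omega> - X 1 \<omega> < e n then 1 else 0 :: real) *\<^sub>R 1 \<partial>P)"
      using levy_conditional[of "{}" "e n" "\<lambda>_. 0"] by (simp add: cis_zero)
    also have "\<dots> = of_real (\<integral>\<omega>. (if running_sup X 1 \<omega> - X 1 \<omega> < e n then 1 else 0 :: real) \<partial>P)"
      by (simp only: scaleR_conv_of_real mult_1_right integral_complex_of_real)
    also have "(\<integral>\<omega>. (if running_sup X 1 \<omega> - X 1 \<omega> < e n then 1 else 0 :: real) \<partial>P) = (\<integral>\<omega>. indicator (A (e n)) \<omega> \<partial>P)"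
      by (intro Bochner_Integration.integral_cong) (auto simp: ind)
    also have "\<dots> = measure P (A (e n))" using sets.sets_into_space[OF Am[of "e n"]] by (simp add: Int_absorb2)
    finally show ?thesis by (simp only: of_real_eq_iff)
  qed
  have "\<forall>\<^sub>F n in sequentially. 0 < ball_mass 1 (e n) 0 / (2 * e n)"
    using ball_mass_limit(1)[of 1 e 0, OF _ e] normal_density_pos[of 1 0 0] by (intro order_tendstoD) auto
  \<comment> \<open>Conditioning requires events of positive probability. Positivity for large
    \<open>n\<close> follows from the positive limit p_1(0) of the normalised probabilities, and
    suffices for passing to the limit.\<close>
  then have pos: "\<forall>\<^sub>F n in sequentially. p n > 0"
    unfolding p_def small_value_probability
    by eventually_elim (use e in \<open>auto simp: zero_less_divide_iff dest: less_trans[of _ 0 "e _"]\<close>)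
  define C where "C n = (\<integral>\<omega>. indicator (A (e n)) \<omega> *\<^sub>R cis (S \<omega>) \<partial>P) / of_real (p n)" for n
  have Ci: "integrable P (\<lambda>\<omega>. indicator (A (e n)) \<omega> *\<^sub>R cis (S \<omega>))" for n
    by (intro integrable_const_bound[of _ 1] AE_I2) (auto simp: indicator_def)
  have "(\<integral>\<omega>. (if running_sup X 1 \<omega> - X 1 \<omega> < e n then 1 else 0 :: real) *\<^sub>R cis (S \<omega>) \<partial>P) = (\<integral>\<omega>. indicator (A (e n)) \<omega> *\<^sub>R cis (S \<omega>) \<partial>P)" for n
    by (intro Bochner_Integration.integral_cong refl) (simp only: ind)
  then have C: "C \<longlonglongrightarrow> (\<integral>\<omega>. cis (\<Sum>s\<in>J. u s * local_time0 b s \<omega>) \<partial>M)"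
    using conditioned_sup_limit[OF b c J e, of u] unfolding C_def p_def S_def[symmetric] by simp
  have Q_int: "\<forall>\<^sub>F n in sequentially. (\<integral>\<omega>. h (S \<omega>) \<partial>Q (e n)) = (\<integral>\<omega>. indicator (A (e n)) \<omega> * h (S \<omega>) \<partial>P) / p n"
    if [measurable]: "h \<in> borel_measurable borel" for h :: "real \<Rightarrow> real"
    using pos
  proof eventually_elim
    case (elim n)
    then show ?case unfolding Q_def pA
      by (intro integral_uniform_measure finite_measure_axioms Am) (auto simp: pA)
  qed
  have Re: "Re (C n) = (\<integral>\<omega>. indicator (A (e n)) \<omega> * cos (S \<omega>) \<partial>P) / p n"
    and Im: "Im (C n) = (\<integral>\<omega>. indicator (A (e n)) \<omega> * sin (S \<omega>) \<partial>P) / p n" for n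
    unfolding C_def using Ci[of n] by (simp_all add: Re_divide_of_real Im_divide_of_real flip: integral_Re integral_Im)
  let ?K = "\<integral>\<omega>. cis (\<Sum>s\<in>J. u s * local_time0 b s \<omega>) \<partial>M"
  have lip: "\<bar>cos x - cos y\<bar> \<le> \<bar>x - y\<bar>" "\<bar>sin x - sin y\<bar> \<le> \<bar>x - y\<bar>" for x y :: real
    using order_trans[OF abs_Re_le_cmod norm_cis_diff[of x y]] order_trans[OF abs_Im_le_cmod norm_cis_diff[of x y]] by simp_all
  have eq: "(\<integral>\<omega>. h (\<Sum>s\<in>J. u s * running_sup a s \<omega>) \<partial>N) = l"
    if h: "h \<in> borel_measurable borel" "\<And>x y. \<bar>h x - h y\<bar> \<le> \<bar>x - y\<bar>" "\<And>x. \<bar>h x\<bar> \<le> 1"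
      and l: "(\<lambda>n. (\<integral>\<omega>. indicator (A (e n)) \<omega> * h (S \<omega>) \<partial>P) / p n) \<longlonglongrightarrow> l" for h :: "real \<Rightarrow> real" and l
  proof (rule LIMSEQ_unique)
    show "(\<lambda>n. \<integral>\<omega>. h (S \<omega>) \<partial>Q (e n)) \<longlonglongrightarrow> (\<integral>\<omega>. h (\<Sum>s\<in>J. u s * running_sup a s \<omega>) \<partial>N)"
      unfolding S_def by (rule filterlim_compose[OF weak_conv_C01_running_sup[OF w Qc aN J(1) J1 h(2,3)] e0])
    show "(\<lambda>n. \<integral>\<omega>. h (S \<omega>) \<partial>Q (e n)) \<longlonglongrightarrow> l"
      using Q_int[OF h(1)] by (intro Lim_transform_eventually[OF l]) (auto elim: eventually_mono)
  qed
  have "(\<integral>\<omega>. cos (\<Sum>s\<in>J. u s * running_sup a s \<omega>) \<partial>N) = Re ?K"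
    by (rule eq) (use tendsto_Re[OF C] lip in \<open>auto simp: Re\<close>)
  moreover have "(\<integral>\<omega>. sin (\<Sum>s\<in>J. u s * running_sup a s \<omega>) \<partial>N) = Im ?K"
    by (rule eq) (use tendsto_Im[OF C] lip in \<open>auto simp: Im\<close>)
  moreover have ai: "integrable N (\<lambda>\<omega>. cis (\<Sum>s\<in>J. u s * running_sup a s \<omega>))"
    by (intro N.integrable_const_bound[of _ 1] AE_I2) auto
  ultimately show ?thesis
    by (simp add: complex_eq_iff flip: integral_Re integral_Im)
qed

text \<open>A null set of \<open>P\<close> remains null under the density \<open>w\<close>, and the
  weighted law of \<open>X\<close> on [0, s] is the law of the bridge there. The density is
  available only for s < 1.\<close>

lemma bridge_local_time_converges:
  assumes b: "brownian_bridge M b" and s: "0 \<le> s" "s < 1"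
  shows "AE \<omega> in M. local_time_converges b s \<omega>"
proof -
  define w where "w \<omega> = normal_density 0 (sqrt (1 - s)) (X s \<omega>) / normal_density 0 1 0" for \<omega>
  have [measurable]: "X s \<in> borel_measurable P" using s by (intro X_measurable) auto
  have [measurable]: "w \<in> borel_measurable P" unfolding w_def by measurable
  have Xs: "continuous_on {0..s} (\<lambda>t. X t \<omega>)" if "\<omega> \<in> space P" for \<omega>
    by (rule continuous_on_subset[OF X_continuous[OF that]]) auto
  interpret X: continuous_process "density P w" s X
    using s by unfold_locales (auto intro: X_measurable Xs)
  interpret b: continuous_process M s b
    using b s by unfold_locales (auto simp: brownian_bridge_def intro: continuous_on_subset)
  have law: "X.path_law = b.path_law"
    unfolding X.path_law_def b.path_law_def
    by (rule bridge_density(1)[OF s b, of "\<lambda>_. 0", folded w_def]) simp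
  have "AE \<omega> in P. local_time_converges X s \<omega>" using local_time0_L1(1) s by simp
  then have "AE \<omega> in density P w. local_time_converges X s \<omega>"
    by (subst AE_density) (auto elim: eventually_mono)
  then show ?thesis
    unfolding X.AE_local_time_converges_iff[OF order_refl] b.AE_local_time_converges_iff[OF order_refl] law .
qed

end

section \<open>Time reversal and the endpoint 1\<close>

lemma brownian_bridge_reverse:
  assumes b: "brownian_bridge M b"
  shows "brownian_bridge M (\<lambda>t. b (1 - t))"
proof -
  have cont: "continuous_on {0..1} (\<lambda>t. b (1 - t) \<omega>)" if "\<omega> \<in> space M" for \<omega>
  proof (rule continuous_on_compose2[of "{0..1}" "\<lambda>t. b t \<omega>" _ "\<lambda>t. 1 - t"])
    show "continuous_on {0..1} (\<lambda>t. b t \<omega>)" using b that by (simp add: brownian_bridge_def)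
  qed (auto intro: continuous_intros)
  have gauss: "gaussian_process M {0..1} (\<lambda>t. b (1 - t))"
    unfolding gaussian_process_def
  proof (intro allI impI)
    fix J :: "real set" and c :: "real \<Rightarrow> real" assume J: "finite J \<and> J \<subseteq> {0..1}"
    have "(\<Sum>t\<in>J. c t * b (1 - t) \<omega>) = (\<Sum>t\<in>(\<lambda>t. 1 - t) ` J. c (1 - t) * b t \<omega>)" for \<omega>
      by (subst sum.reindex) (auto simp: inj_on_def)
    moreover have "normal_variable M (\<lambda>\<omega>. \<Sum>t\<in>(\<lambda>t. 1 - t) ` J. c (1 - t) * b t \<omega>)"
    proof -
      have "finite ((\<lambda>t. 1 - t) ` J) \<and> (\<lambda>t. 1 - t) ` J \<subseteq> {0..1}" using J by auto
      then show ?thesis using b unfolding brownian_bridge_def gaussian_process_def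
        by (elim conjE allE[of _ "(\<lambda>t. 1 - t) ` J"] allE[of _ "\<lambda>t. c (1 - t)"]) blast
    qed
    ultimately show "normal_variable M (\<lambda>\<omega>. \<Sum>t\<in>J. c t * b (1 - t) \<omega>)" by simp
  qed
  \<comment> \<open>The covariance s (1 - t) is invariant under replacing (s, t) by (1 - t, 1 - s),
    which also preserves the order of the two times.\<close>
  have cov: "(LINT \<omega>|M. b (1 - s) \<omega> * b (1 - t) \<omega>) = s * (1 - t)" if "0 \<le> s" "s \<le> t" "t \<le> 1" for s t
  proof -
    have "\<forall>s t. 0 \<le> s \<and> s \<le> t \<and> t \<le> 1 \<longrightarrow> (LINT \<omega>|M. b s \<omega> * b t \<omega>) = s * (1 - t)"
      using b unfolding brownian_bridge_def by blast
    from this[THEN spec, THEN spec, of "1 - t" "1 - s"] that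
    have "(LINT \<omega>|M. b (1 - t) \<omega> * b (1 - s) \<omega>) = (1 - t) * s" by simp
    then show ?thesis by (simp add: mult.commute)
  qed
  show ?thesis using b cont gauss cov unfolding brownian_bridge_def by auto
qed

lemma occupation_reverse:
  assumes y: "continuous_on {0..1} (\<lambda>t. Y t \<omega>)" and s: "0 \<le> s" "s \<le> 1"
  shows "occupation Y 1 e \<omega> = occupation Y s e \<omega> + occupation (\<lambda>t. Y (1 - t)) (1 - s) e \<omega>"
proof -
  define g where "g r = (indicator {r. \<bar>Y r \<omega>\<bar> < e} r :: real)" for r
  have i: "set_integrable lborel {0..1} g"
    using set_integrable_occupation[OF y, of e] unfolding g_def by simp
  have "(LINT r:{0..1}|lborel. g r) = (LINT r:{0..s} \<union> {s<..1}|lborel. g r)"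
    using s by (intro arg_cong[where f="\<lambda>A. LINT r:A|lborel. g r"]) auto
  also have "\<dots> = (LINT r:{0..s}|lborel. g r) + (LINT r:{s<..1}|lborel. g r)"
    using s by (intro set_integral_Un set_integrable_subset[OF i]) auto
  \<comment> \<open>The half-open interval was taken for disjointness; the null point
    \<open>s\<close> is now restored because reflection should produce the closed interval {0..1 -
    s}.\<close>
  also have "(LINT r:{s<..1}|lborel. g r) = (LINT r:{s..1}|lborel. g r)"
    unfolding set_lebesgue_integral_def
  proof (rule integral_cong_AE)
    have "(\<lambda>r. indicator {s<..1} r *\<^sub>R g r) \<in> borel_measurable lborel" "(\<lambda>r. indicator {s..1} r *\<^sub>R g r) \<in> borel_measurable lborel"
    proof -
      have "set_integrable lborel {s<..1} g" "set_integrable lborel {s..1} g"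
        by (rule set_integrable_subset[OF i]; use s in auto)+
      then show "(\<lambda>r. indicator {s<..1} r *\<^sub>R g r) \<in> borel_measurable lborel" "(\<lambda>r. indicator {s..1} r *\<^sub>R g r) \<in> borel_measurable lborel"
        unfolding set_integrable_def by (auto dest: borel_measurable_integrable)
    qed
    then show "(\<lambda>r. indicator {s<..1} r *\<^sub>R g r) \<in> borel_measurable lborel" "(\<lambda>r. indicator {s..1} r *\<^sub>R g r) \<in> borel_measurable lborel" .
    show "AE r in lborel. indicator {s<..1} r *\<^sub>R g r = indicator {s..1} r *\<^sub>R g r"
      using AE_lborel_singleton[of s] by eventually_elim (auto simp: indicator_def)
  qed
  also have "(LINT r:{s..1}|lborel. g r) = (LINT r:{0..1 - s}|lborel. g (1 - r))"
  proof -
    have "(\<integral>r. indicator {s..1} r *\<^sub>R g r \<partial>lborel) = \<bar>- 1\<bar> *\<^sub>R (\<integral>r. indicator {s..1} (1 + (- 1) * r) *\<^sub>R g (1 + (- 1) * r) \<partial>lborel)"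
      by (rule lborel_integral_real_affine) simp
    also have "\<dots> = (\<integral>r. indicator {0..1 - s} r *\<^sub>R g (1 - r) \<partial>lborel)"
      by (simp, intro Bochner_Integration.integral_cong) (auto simp: indicator_def)
    finally show ?thesis unfolding set_lebesgue_integral_def .
  qed
  also have "(\<lambda>r. g (1 - r)) = (\<lambda>r. indicator {r. \<bar>Y (1 - r) \<omega>\<bar> < e} r)" by (simp add: fun_eq_iff g_def indicator_def)
  finally show ?thesis unfolding occupation_def g_def by (simp only: distrib_left)
qed

theorem proposition6p2:
  fixes P :: "'w measure" and X :: "real \<Rightarrow> 'w \<Rightarrow> real"
    and N :: "'v measure" and a :: "real \<Rightarrow> 'v \<Rightarrow> real"
    and M :: "'u measure" and b :: "real \<Rightarrow> 'u \<Rightarrow> real"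
  assumes "standard_brownian_motion P X"
    and "brownian_ascent P X N a"
    and "brownian_bridge M b"
  shows "equal_in_law {0..1} N (running_sup a) M (local_time0 b)"
proof -
  interpret brownian_motion P X
    using assms(1) by (auto simp: brownian_motion_def brownian_motion_axioms_def standard_brownian_motion_def)
  interpret N: prob_space N using assms(2) by (simp add: brownian_ascent_def)
  interpret M: prob_space M using assms(3) by (simp add: brownian_bridge_def)
  interpret a: continuous_process N 1 a
    using assms(2) by (auto simp: brownian_ascent_def continuous_process_def)
  interpret b: continuous_process M 1 b
    using assms(3) by (auto simp: brownian_bridge_def continuous_process_def)
  have am: "running_sup a s \<in> borel_measurable N" if "s \<in> {0..1}" for s
    using that by (intro running_sup_borel_measurable[OF a.continuous_process_axioms]) auto
  have bm: "local_time0 b s \<in> borel_measurable M" if "s \<in> {0..1}" for s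
    using that by (intro b.local_time0_measurable) auto
  txt \<open>The local time of \<open>b\<close> over \<open>[1 - \<epsilon>, 1]\<close> is that of the reversed bridge \<open>b'\<close> over \<open>[0, \<epsilon>]\<close>, which has
    the law of the supremum of \<open>a\<close> over \<open>[0, \<epsilon>]\<close> and hence vanishes in the limit.\<close>
  define b' where "b' t = b (1 - t)" for t
  have b': "brownian_bridge M b'" unfolding b'_def by (rule brownian_bridge_reverse[OF assms(3)])
  interpret b': continuous_process M 1 b'
    using b' by (auto simp: brownian_bridge_def continuous_process_def)
  \<comment> \<open>Stated for an arbitrary bridge \<open>d\<close>, because it is applied both to
    \<open>b\<close> and to its reversal, and for times up to some \<open>c < 1\<close>, where the
    characteristic functions are known to agree.\<close>
  have law: "(\<integral>x. F x \<partial>distr N (PiM {0..c} (\<lambda>_. borel)) (\<lambda>\<omega>. \<lambda>s\<in>{0..c}. running_sup a s \<omega>)) =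
      (\<integral>x. F x \<partial>distr M (PiM {0..c} (\<lambda>_. borel)) (\<lambda>\<omega>. \<lambda>s\<in>{0..c}. local_time0 d s \<omega>))"
    if c: "0 \<le> c" "c < 1" and d: "brownian_bridge M d" "continuous_process M 1 d"
    for c and d :: "real \<Rightarrow> 'u \<Rightarrow> real" and F :: "(real \<Rightarrow> real) \<Rightarrow> complex"
  proof -
    have dm: "local_time0 d s \<in> borel_measurable M" if "s \<in> {0..c}" for s
      using that c by (intro continuous_process.local_time0_measurable[OF d(2)]) auto
    have am': "running_sup a s \<in> borel_measurable N" if "s \<in> {0..c}" for s
      using that c by (intro am) auto
    have "distr N (PiM {0..c} (\<lambda>_. borel)) (\<lambda>\<omega>. \<lambda>s\<in>{0..c}. running_sup a s \<omega>) =
      distr M (PiM {0..c} (\<lambda>_. borel)) (\<lambda>\<omega>. \<lambda>s\<in>{0..c}. local_time0 d s \<omega>)"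
      by (rule distr_PiM_eq_if_cis_integrals_eq[OF N.finite_measure_axioms M.finite_measure_axioms am' dm
            ascent_sup_local_time_cis[OF assms(2) d(1) c]])
    then show ?thesis by simp
  qed
  have transfer: "(\<integral>\<omega>. F (\<lambda>s\<in>{0..c}. running_sup a s \<omega>) \<partial>N) = (\<integral>\<omega>. F (\<lambda>s\<in>{0..c}. local_time0 d s \<omega>) \<partial>M)"
    if c: "0 \<le> c" "c < 1" and d: "brownian_bridge M d" "continuous_process M 1 d"
      and F: "F \<in> borel_measurable (PiM {0..c} (\<lambda>_. borel))"
    for c and d :: "real \<Rightarrow> 'u \<Rightarrow> real" and F :: "(real \<Rightarrow> real) \<Rightarrow> complex"
  proof -
    have "(\<lambda>\<omega>. \<lambda>s\<in>{0..c}. running_sup a s \<omega>) \<in> measurable N (PiM {0..c} (\<lambda>_. borel))"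
      using c by (intro measurable_restrict am) auto
    moreover have "(\<lambda>\<omega>. \<lambda>s\<in>{0..c}. local_time0 d s \<omega>) \<in> measurable M (PiM {0..c} (\<lambda>_. borel))"
      using c by (intro measurable_restrict continuous_process.local_time0_measurable[OF d(2)]) auto
    ultimately show ?thesis using law[OF c d, of F] F by (simp only: integral_distr)
  qed
  \<comment> \<open>The shift by two keeps every \<epsilon> n at most 1/2, so that the single
    product space over {0..1/2} serves all \<open>n\<close>.\<close>
  define \<epsilon> where "\<epsilon> n = 1 / real (Suc (Suc n))" for n
  have \<epsilon>: "\<epsilon> n \<in> {0<..1/2}" for n by (simp add: \<epsilon>_def divide_simps)
  have \<epsilon>0: "\<epsilon> \<longlonglongrightarrow> 0" unfolding \<epsilon>_def by (rule LIMSEQ_Suc[OF LIMSEQ_Suc[OF lim_1_over_n]])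
  have \<epsilon>01: "\<epsilon> n \<in> {0..1}" "1 - \<epsilon> n \<in> {0..1}" "0 \<le> 1 - \<epsilon> n" "1 - \<epsilon> n < 1" for n using \<epsilon>[of n] by auto
  \<comment> \<open>A bounded measure of how small the local time of \<open>b'\<close> is, in
    exactly the form in which it enters the error at time 1. Its mean depends only on a law and can
    be computed with \<open>a\<close>, whose running supremum is continuous in time.\<close>
  have cis_1: "((\<lambda>n. \<integral>\<omega>. of_real (norm (1 - cis (v * local_time0 b' (\<epsilon> n) \<omega>))) \<partial>M) \<longlonglongrightarrow> (0 :: complex))" for v
  proof -
    define F where "F t x = complex_of_real (norm (1 - cis (v * x t)))" for t and x :: "real \<Rightarrow> real"
    have Fm: "F t \<in> borel_measurable (PiM {0..1/2} (\<lambda>_. borel))" if "t \<in> {0..1/2}" for t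
    proof -
      have [measurable]: "(\<lambda>x. x t) \<in> borel_measurable (PiM {0..1/2} (\<lambda>_. borel :: real measure))"
        by (rule measurable_component_singleton[OF that])
      show ?thesis unfolding F_def by measurable
    qed
    have eq: "(\<integral>\<omega>. of_real (norm (1 - cis (v * running_sup a t \<omega>))) \<partial>N) = (\<integral>\<omega>. complex_of_real (norm (1 - cis (v * local_time0 b' t \<omega>))) \<partial>M)"
      if t: "t \<in> {0..1/2}" for t
      using transfer[OF _ _ b' b'.continuous_process_axioms Fm[OF t]] t unfolding F_def by simp
    have "(\<lambda>n. \<integral>\<omega>. complex_of_real (norm (1 - cis (v * running_sup a (\<epsilon> n) \<omega>))) \<partial>N) \<longlonglongrightarrow>
        (\<integral>\<omega>. complex_of_real (norm (1 - cis (v * running_sup a 0 \<omega>))) \<partial>N)"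
    proof (rule integral_dominated_convergence[where w="\<lambda>_. 2"])
      have cc: "isCont cis x" for x by (simp add: isCont_def tendsto_intros)
      show "AE \<omega> in N. (\<lambda>n. complex_of_real (norm (1 - cis (v * running_sup a (\<epsilon> n) \<omega>)))) \<longlonglongrightarrow> complex_of_real (norm (1 - cis (v * running_sup a 0 \<omega>)))"
        by (intro AE_I2 tendsto_intros isCont_tendsto_compose[OF cc] running_sup_tendsto a.continuous_path \<epsilon>01 \<epsilon>0) auto
      show "(\<lambda>\<omega>. complex_of_real (norm (1 - cis (v * running_sup a 0 \<omega>)))) \<in> borel_measurable N"
        using am[of 0] by measurable
      show "(\<lambda>\<omega>. complex_of_real (norm (1 - cis (v * running_sup a (\<epsilon> n) \<omega>)))) \<in> borel_measurable N" for n
        using am[OF \<epsilon>01(1)[of n]] by measurable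
      show "AE \<omega> in N. norm (complex_of_real (norm (1 - cis (v * running_sup a (\<epsilon> n) \<omega>)))) \<le> 2" for n
        using norm_cis_diff_le_2[of 0] by (simp add: cis_zero)
    qed simp
    \<comment> \<open>The definition of the ascent does not assert \<open>a 0 = 0\<close>. The value
      of this integral is obtained by transferring it back to the local time at time 0, which is an
      integral over a single point.\<close>
    moreover have "(\<integral>\<omega>. complex_of_real (norm (1 - cis (v * running_sup a 0 \<omega>))) \<partial>N) = 0"
    proof -
      have "local_time0 b' 0 \<omega> = 0" for \<omega>
      proof (rule local_time0_eqI)
        have "occupation b' 0 e \<omega> = 0" for e
        proof -
          have "(LINT r:{0..0}|lborel. indicator {r. \<bar>b' r \<omega>\<bar> < e} r :: real) = 0"
            unfolding set_lebesgue_integral_def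
            by (rule integral_eq_zero_AE) (use AE_lborel_singleton[of "0::real"] in \<open>auto elim!: eventually_mono\<close>)
          then show ?thesis by (simp add: occupation_def)
        qed
        then show "((\<lambda>e. occupation b' 0 e \<omega>) \<longlongrightarrow> 0) (at_right 0)" by simp
      qed
      note L0 = this
      have z: "(0::real) \<in> {0..1/2}" by simp
      show ?thesis unfolding eq[OF z] L0 by (simp add: cis_zero)
    qed
    moreover have "\<epsilon> n \<in> {0..1/2}" for n using \<epsilon>[of n] by auto
    ultimately show ?thesis using eq by simp
  qed
  show ?thesis
    unfolding equal_in_law_def
  proof (intro conjI ballI am bm)
    show "distr N (PiM {0..1} (\<lambda>_. borel)) (\<lambda>\<omega>. \<lambda>s\<in>{0..1}. running_sup a s \<omega>) =
      distr M (PiM {0..1} (\<lambda>_. borel)) (\<lambda>\<omega>. \<lambda>s\<in>{0..1}. local_time0 b s \<omega>)"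
    proof (rule distr_PiM_eq_if_cis_integrals_eq[OF N.finite_measure_axioms M.finite_measure_axioms am bm])
      fix J :: "real set" and u :: "real \<Rightarrow> real" assume J: "finite J" "J \<subseteq> {0..1}"
      \<comment> \<open>All times are capped at 1 - \<epsilon> n, where the two laws are known to
        agree. For large \<open>n\<close> only \<open>s = 1\<close> is affected, so the error
        involves a single coefficient, \<open>v\<close> below.\<close>
      define T where "T n s = min s (1 - \<epsilon> n)" for n s
      have T: "T n s \<in> {0..1 - \<epsilon> n}" "T n s \<in> {0..1}" if "s \<in> J" for n s using that J \<epsilon>01[of n] by (auto simp: T_def)
      have eq: "(\<integral>\<omega>. cis (\<Sum>s\<in>J. u s * running_sup a (T n s) \<omega>) \<partial>N) = (\<integral>\<omega>. cis (\<Sum>s\<in>J. u s * local_time0 b (T n s) \<omega>) \<partial>M)" for n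
      proof -
        have "(\<lambda>x. cis (\<Sum>s\<in>J. u s * x (T n s))) \<in> borel_measurable (PiM {0..1 - \<epsilon> n} (\<lambda>_. borel))"
          using T by (intro measurable_compose[OF _ borel_measurable_cis] borel_measurable_sum borel_measurable_times
              borel_measurable_const measurable_component_singleton)
        from transfer[OF \<epsilon>01(3,4) assms(3) b.continuous_process_axioms this] show ?thesis using T by simp
      qed
      have limN: "(\<lambda>n. \<integral>\<omega>. cis (\<Sum>s\<in>J. u s * running_sup a (T n s) \<omega>) \<partial>N) \<longlonglongrightarrow> (\<integral>\<omega>. cis (\<Sum>s\<in>J. u s * running_sup a s \<omega>) \<partial>N)"
      proof (rule integral_dominated_convergence[where w="\<lambda>_. 1"])
        have cc: "isCont cis x" for x by (simp add: isCont_def tendsto_intros)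
        have Tlim: "(\<lambda>n. T n s) \<longlonglongrightarrow> s" if "s \<in> J" for s
        proof -
          have "(\<lambda>n. min s (1 - \<epsilon> n)) \<longlonglongrightarrow> min s (1 - 0)" by (intro tendsto_intros \<epsilon>0)
          then show ?thesis using that J unfolding T_def by (auto simp: min_absorb1)
        qed
        show "AE \<omega> in N. (\<lambda>n. cis (\<Sum>s\<in>J. u s * running_sup a (T n s) \<omega>)) \<longlonglongrightarrow> cis (\<Sum>s\<in>J. u s * running_sup a s \<omega>)"
          using J T by (intro AE_I2 isCont_tendsto_compose[OF cc] tendsto_intros running_sup_tendsto a.continuous_path Tlim) auto
        show "(\<lambda>\<omega>. cis (\<Sum>s\<in>J. u s * running_sup a s \<omega>)) \<in> borel_measurable N"
          using J by (intro measurable_compose[OF _ borel_measurable_cis] borel_measurable_sum borel_measurable_times borel_measurable_const am) auto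
        show "(\<lambda>\<omega>. cis (\<Sum>s\<in>J. u s * running_sup a (T n s) \<omega>)) \<in> borel_measurable N" for n
          using T by (intro measurable_compose[OF _ borel_measurable_cis] borel_measurable_sum borel_measurable_times borel_measurable_const am)
      qed auto
      have limM: "(\<lambda>n. \<integral>\<omega>. cis (\<Sum>s\<in>J. u s * local_time0 b (T n s) \<omega>) \<partial>M) \<longlonglongrightarrow> (\<integral>\<omega>. cis (\<Sum>s\<in>J. u s * local_time0 b s \<omega>) \<partial>M)"
      proof (rule Lim_transform2[OF tendsto_const], rule Lim_null_comparison)
        define v where "v = (if 1 \<in> J then u 1 else 0)"
        have m1: "(\<lambda>\<omega>. cis (\<Sum>s\<in>J. u s * local_time0 b s \<omega>)) \<in> borel_measurable M"
          using J by (intro measurable_compose[OF _ borel_measurable_cis] borel_measurable_sum borel_measurable_times borel_measurable_const bm) auto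
        have m2: "(\<lambda>\<omega>. cis (\<Sum>s\<in>J. u s * local_time0 b (T n s) \<omega>)) \<in> borel_measurable M" for n
          using T by (intro measurable_compose[OF _ borel_measurable_cis] borel_measurable_sum borel_measurable_times borel_measurable_const bm)
        have i1: "integrable M (\<lambda>\<omega>. cis (\<Sum>s\<in>J. u s * local_time0 b s \<omega>))"
          by (intro M.integrable_const_bound[of _ 1] AE_I2 m1) simp
        have i2: "integrable M (\<lambda>\<omega>. cis (\<Sum>s\<in>J. u s * local_time0 b (T n s) \<omega>))" for n
          by (intro M.integrable_const_bound[of _ 1] AE_I2 m2) simp
        have b'm: "local_time0 b' (\<epsilon> n) \<in> borel_measurable M" for n using \<epsilon>01[of n] by (intro b'.local_time0_measurable) auto
        have i3: "integrable M (\<lambda>\<omega>. norm (1 - cis (v * local_time0 b' (\<epsilon> n) \<omega>)))" for n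
        proof (intro M.integrable_const_bound[of _ 2] AE_I2)
          show "norm (norm (1 - cis (v * local_time0 b' (\<epsilon> n) \<omega>))) \<le> 2" for \<omega>
            using norm_cis_diff_le_2[of 0] by (simp add: cis_zero)
        qed (use b'm in measurable)
        show "(\<lambda>n. norm (\<integral>\<omega>. complex_of_real (norm (1 - cis (v * local_time0 b' (\<epsilon> n) \<omega>))) \<partial>M)) \<longlonglongrightarrow> 0"
          by (rule tendsto_norm_zero[OF cis_1])
        have "\<forall>\<^sub>F n in sequentially. \<forall>s\<in>J - {1}. \<epsilon> n < 1 - s"
          using J by (intro eventually_ball_finite ballI order_tendstoD(2)[OF \<epsilon>0]) auto
        then show "\<forall>\<^sub>F n in sequentially. norm ((\<integral>\<omega>. cis (\<Sum>s\<in>J. u s * local_time0 b s \<omega>) \<partial>M) -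
              (\<integral>\<omega>. cis (\<Sum>s\<in>J. u s * local_time0 b (T n s) \<omega>) \<partial>M))
            \<le> norm (\<integral>\<omega>. complex_of_real (norm (1 - cis (v * local_time0 b' (\<epsilon> n) \<omega>))) \<partial>M)"
        proof eventually_elim
          case (elim n)
          have Ts: "T n s = (if s = 1 then 1 - \<epsilon> n else s)" if "s \<in> J" for s
          proof (cases "s = 1")
            case False
            then have "\<epsilon> n < 1 - s" using elim that by blast
            then show ?thesis using False by (simp add: T_def)
          qed (use \<epsilon>[of n] in \<open>simp add: T_def\<close>)
          \<comment> \<open>Convergence is known for the bridge only before time 1. Adding the
            limits for the initial piece and for the reversed final piece yields the limit at time 1
            as well, and with it additivity.\<close>
          have "AE \<omega> in M. local_time_converges b (1 - \<epsilon> n) \<omega>" "AE \<omega> in M. local_time_converges b' (\<epsilon> n) \<omega>"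
            using \<epsilon>[of n] by (auto intro!: bridge_local_time_converges assms(3) b')
          then have add: "AE \<omega> in M. local_time0 b 1 \<omega> = local_time0 b (1 - \<epsilon> n) \<omega> + local_time0 b' (\<epsilon> n) \<omega>"
            using AE_space
          proof eventually_elim
            case (elim \<omega>)
            have "occupation b 1 e \<omega> = occupation b (1 - \<epsilon> n) e \<omega> + occupation b' (\<epsilon> n) e \<omega>" for e
              using occupation_reverse[of b \<omega> "1 - \<epsilon> n" e] b.continuous_path[OF elim(3)] \<epsilon>01[of n] unfolding b'_def by simp
            then show ?case
              using tendsto_add[OF local_time_converges_tendsto[OF elim(1)] local_time_converges_tendsto[OF elim(2)]]
              by (intro local_time0_eqI) simp
          qed
          have "AE \<omega> in M. norm (cis (\<Sum>s\<in>J. u s * local_time0 b s \<omega>) - cis (\<Sum>s\<in>J. u s * local_time0 b (T n s) \<omega>)) =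
              norm (1 - cis (v * local_time0 b' (\<epsilon> n) \<omega>))"
            using add
          proof eventually_elim
            case (elim \<omega>)
            have "(\<Sum>s\<in>J. u s * local_time0 b s \<omega>) - (\<Sum>s\<in>J. u s * local_time0 b (T n s) \<omega>) =
                (\<Sum>s\<in>J. if s = 1 then u 1 * local_time0 b' (\<epsilon> n) \<omega> else 0)"
              unfolding sum_subtractf[symmetric] by (intro sum.cong refl) (auto simp: Ts elim distrib_left)
            also have "\<dots> = v * local_time0 b' (\<epsilon> n) \<omega>" using J by (simp add: v_def)
            finally have "(\<Sum>s\<in>J. u s * local_time0 b s \<omega>) = (\<Sum>s\<in>J. u s * local_time0 b (T n s) \<omega>) + v * local_time0 b' (\<epsilon> n) \<omega>"
              by simp
            then have "cis (\<Sum>s\<in>J. u s * local_time0 b s \<omega>) - cis (\<Sum>s\<in>J. u s * local_time0 b (T n s) \<omega>) =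
                - cis (\<Sum>s\<in>J. u s * local_time0 b (T n s) \<omega>) * (1 - cis (v * local_time0 b' (\<epsilon> n) \<omega>))"
              by (simp add: cis_mult algebra_simps)
            then show ?case by (simp add: norm_mult)
          qed
          then have "(\<integral>\<omega>. norm (cis (\<Sum>s\<in>J. u s * local_time0 b s \<omega>) - cis (\<Sum>s\<in>J. u s * local_time0 b (T n s) \<omega>)) \<partial>M) =
              (\<integral>\<omega>. norm (1 - cis (v * local_time0 b' (\<epsilon> n) \<omega>)) \<partial>M)"
            using m1 m2 i3 by (intro integral_cong_AE) auto
          moreover have "norm ((\<integral>\<omega>. cis (\<Sum>s\<in>J. u s * local_time0 b s \<omega>) \<partial>M) - (\<integral>\<omega>. cis (\<Sum>s\<in>J. u s * local_time0 b (T n s) \<omega>) \<partial>M)) \<le>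
              (\<integral>\<omega>. norm (cis (\<Sum>s\<in>J. u s * local_time0 b s \<omega>) - cis (\<Sum>s\<in>J. u s * local_time0 b (T n s) \<omega>)) \<partial>M)"
            unfolding Bochner_Integration.integral_diff[OF i1 i2, symmetric] by (rule integral_norm_bound)
          moreover have "0 \<le> (\<integral>\<omega>. norm (1 - cis (v * local_time0 b' (\<epsilon> n) \<omega>)) \<partial>M)" by (rule Bochner_Integration.integral_nonneg) simp
          ultimately show ?case by (simp only: integral_complex_of_real norm_of_real abs_of_nonneg)
        qed
      qed
      show "(\<integral>\<omega>. cis (\<Sum>s\<in>J. u s * running_sup a s \<omega>) \<partial>N) = (\<integral>\<omega>. cis (\<Sum>s\<in>J. u s * local_time0 b s \<omega>) \<partial>M)"
        by (rule LIMSEQ_unique[OF limN[unfolded eq] limM])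
    qed
  qed
qed

end
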